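(* In the partially functional linear model described in the context, with $p=p_n$ allowed to increase with the sample size $n$, suppose that: (1) $p\le n$, and the matrices $D_n$ and $D$ are positive definite; (2) $\max_{1\le j\le p}\|X_j\|_G\le M_1<\infty$ and $\max_{1\le j\le p}\mathrm{E}|X_j|^2\le v^2<\infty$; (3) $\|Y(\cdot)\|_{L^2(\mathcal T)}\le M_2$ almost surely; (4) $\mathrm{E}(\varepsilon\mid \boldsymbol X,Y)=0$ and $\mathrm{E}(\varepsilon^2\mid\boldsymbol X,Y)<\sigma^2$; (5) there are constants $c>0$ and $\frac25<\theta\le1$ with $D(\lambda)\le c\lambda^{-\theta}$ for all $\lambda>0$; (6) $p_n^7\log^6(p_n)=o(n)$; (7) there exist positive constants $m'$ and $M'$ such that $m'<\lambda_{\min}(D)<\lambda_{\max}(D)<M'$ for all $n$ and $p$. Let $\lambda_n=\omega n^{-\frac1{1+\theta}}$ with $\omega>0$ fixed. Then the excess prediction risk is consistent: $$\mathcal E(\hat\eta_n)-\mathcal E(\eta_0)=o_p(1).$$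
   Context: Setting. $\mathcal T\subset\mathbb R$ is compact; $L^2(\mathcal T)$ has inner product $\langle\cdot,\cdot\rangle$ and norm $\|\cdot\|$. The model is $Z=\boldsymbol X^T\boldsymbol\alpha_0+\int_{\mathcal T}Y(t)\beta_0(t)\,dt+\varepsilon$, where $\boldsymbol X=(X_1,\dots,X_p)^T$ is a random vector in $\mathbb R^p$, $Y$ is a random function on $\mathcal T$ with values in $L^2(\mathcal T)$, $\boldsymbol X$ and $Y$ are independent, $\mathrm E\boldsymbol X=\boldsymbol 0$, $\mathrm EY(t)=0$, $\boldsymbol\alpha_0\in\mathbb R^p$. The data $(Z_i,\boldsymbol X_i,Y_i)$, $i=1,\dots,n$, are i.i.d. copies of $(Z,\boldsymbol X,Y)$. The dimension $p=p_n$ (with the law of $\boldsymbol X$ and $\boldsymbol\alpha_0$) may depend on $n$, while $K$, $\beta_0$, the covariance of $Y$, and the constants $M_1,v,M_2,\sigma,c,\theta,\omega,m',M'$ do not. Kernel. $K:\mathcal T\times\mathcal T\to\mathbb R$ is a continuous symmetric nonnegative definite (reproducing) kernel; for a square integrable kernel $R$, $L_R(f)(t)=\int_{\mathcal T}R(s,t)f(s)\,ds$ on $L^2(\mathcal T)$, and $L_K^{1/2}$ is the nonnegative square root of $L_K$. The RKHS is $\mathcal H(K)=L_K^{1/2}(L^2(\mathcal T))$ with norm $\|L_K^{1/2}f\|_K=\|f\|$; it is assumed dense in $L^2(\mathcal T)$ with $L_K^{1/2}$ injective. $\kappa:=\|L_K^{1/2}\|_{\mathrm{op}}<\infty$. The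 slope $\beta_0$ lies in $\mathcal H(K)$. It is assumed that $\kappa>1$ and $M_2>1$. Covariances. $D:=\mathrm E(\boldsymbol X\boldsymbol X^T)$ with extreme eigenvalues $\lambda_{\min}(D),\lambda_{\max}(D)$; $D_n:=\frac1n\sum_{i=1}^n\boldsymbol X_i\boldsymbol X_i^T$. $C(s,t):=\mathrm E(Y(s)Y(t))$, $T:=L_K^{1/2}L_CL_K^{1/2}$, and the effective dimension is $D(\lambda):=\mathrm{Tr}((T+\lambda I)^{-1}T)$ for $\lambda>0$ (not to be confused with the matrix $D$). Sub-Gaussian norm. For a real random variable $W$, $\|W\|_G:=\sup_{k\ge1}\bigl[\mathrm E W^{2k}/(2k-1)!!\bigr]^{1/(2k)}$. Estimator. $(\hat{\boldsymbol\alpha}_n,\hat f_n)$ is a minimizer over $(\boldsymbol\alpha,f)\in\mathbb R^p\times L^2(\mathcal T)$ of $\frac1n\sum_{i=1}^n\bigl(Z_i-\boldsymbol X_i^T\boldsymbol\alpha-\langle Y_i,L_K^{1/2}f\rangle\bigr)^2+\lambda_n\|f\|^2$, and $\hat\beta_n=L_K^{1/2}\hat f_n$. Risk. $\eta_0(\boldsymbol X,Y):=\boldsymbol X^T\boldsymbol\alpha_0+\int_{\mathcal T}Y\beta_0$, $\hat\eta_n(\boldsymbol X,Y):=\boldsymbol X^T\hat{\boldsymbol\alpha}_n+\int_{\mathcal T}Y\hat\beta_n$. For a prediction rule $\eta$, $\mathcal E(\eta):=\mathrm E[Z^*-\eta(\boldsymbol X^*,Y^* )]^2$, where $(Z^*,\boldsymbol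 X^*,Y^* )$ is a copy of $(Z,\boldsymbol X,Y)$ independent of the data and the expectation is over this copy only (the data being held fixed). $o_p(1)$ means convergence to $0$ in probability as $n\to\infty$. *)

theory Defs
  imports
    "HOL-Probability.Probability"
    "HOL-Library.Landau_Symbols"
    "Jordan_Normal_Form.Spectral_Radius"
begin

section \<open>The space \<open>L\<^sup>2(T)\<close>\<close>

text \<open>Elements of \<open>L\<^sup>2(T)\<close> are represented by Borel functions on \<open>T\<close> (values outside \<open>T\<close> are
  irrelevant), and equality in \<open>L\<^sup>2(T)\<close> is equality almost everywhere on \<open>T\<close>. Linearity, invertibility,
  completeness etc. below are therefore all stated modulo \<open>L2_eq\<close>.\<close>

abbreviation leb_on :: "real set \<Rightarrow> real measure" where
  "leb_on T \<equiv> restrict_space lborel T"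

definition L2 :: "real set \<Rightarrow> (real \<Rightarrow> real) set" where
  "L2 T = {f \<in> borel_measurable (leb_on T). integrable (leb_on T) (\<lambda>t. (f t)\<^sup>2)}"

definition L2_inner :: "real set \<Rightarrow> (real \<Rightarrow> real) \<Rightarrow> (real \<Rightarrow> real) \<Rightarrow> real" where
  "L2_inner T f g = (\<integral>t. f t * g t \<partial>leb_on T)"

definition L2_norm :: "real set \<Rightarrow> (real \<Rightarrow> real) \<Rightarrow> real" where
  "L2_norm T f = sqrt (L2_inner T f f)"

definition L2_eq :: "real set \<Rightarrow> (real \<Rightarrow> real) \<Rightarrow> (real \<Rightarrow> real) \<Rightarrow> bool" where
  "L2_eq T f g \<longleftrightarrow> (AE t in leb_on T. f t = g t)"

text \<open>The Borel sigma-algebra of the norm topology of \<open>L\<^sup>2(T)\<close>.\<close>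

definition L2_borel :: "real set \<Rightarrow> (real \<Rightarrow> real) measure" where
  "L2_borel T = sigma (L2 T)
     {U. U \<subseteq> L2 T \<and>
         (\<forall>f\<in>U. \<exists>r>0. \<forall>g\<in>L2 T. L2_norm T (\<lambda>t. f t - g t) < r \<longrightarrow> g \<in> U)}"


section \<open>Operators on \<open>L\<^sup>2(T)\<close>\<close>

definition L2_operator :: "real set \<Rightarrow> ((real \<Rightarrow> real) \<Rightarrow> real \<Rightarrow> real) \<Rightarrow> bool" where
  "L2_operator T A \<longleftrightarrow>
     (\<forall>f\<in>L2 T. A f \<in> L2 T) \<and>
     (\<forall>f\<in>L2 T. \<forall>g\<in>L2 T. L2_eq T (A (\<lambda>t. f t + g t)) (\<lambda>t. A f t + A g t)) \<and>
     (\<forall>f\<in>L2 T. \<forall>a. L2_eq T (A (\<lambda>t. a * f t)) (\<lambda>t. a * A f t)) \<and>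
     (\<exists>B. \<forall>f\<in>L2 T. L2_norm T (A f) \<le> B * L2_norm T f)"

definition nonneg_operator :: "real set \<Rightarrow> ((real \<Rightarrow> real) \<Rightarrow> real \<Rightarrow> real) \<Rightarrow> bool" where
  "nonneg_operator T A \<longleftrightarrow>
     L2_operator T A \<and>
     (\<forall>f\<in>L2 T. \<forall>g\<in>L2 T. L2_inner T (A f) g = L2_inner T f (A g)) \<and>
     (\<forall>f\<in>L2 T. 0 \<le> L2_inner T (A f) f)"

text \<open>A nonnegative bounded operator has exactly one nonnegative square root modulo \<open>L2_eq\<close>; the
  following says that \<open>S\<close> is a representative of it.\<close>

definition is_nonneg_sqrt ::
  "real set \<Rightarrow> ((real \<Rightarrow> real) \<Rightarrow> real \<Rightarrow> real) \<Rightarrow> ((real \<Rightarrow> real) \<Rightarrow> real \<Rightarrow> real) \<Rightarrow> bool" where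
  "is_nonneg_sqrt T A S \<longleftrightarrow> nonneg_operator T S \<and> (\<forall>f\<in>L2 T. L2_eq T (S (S f)) (A f))"

definition op_norm :: "real set \<Rightarrow> ((real \<Rightarrow> real) \<Rightarrow> real \<Rightarrow> real) \<Rightarrow> real" where
  "op_norm T A = (SUP f\<in>{f\<in>L2 T. L2_norm T f \<le> 1}. L2_norm T (A f))"

definition kernel_op :: "real set \<Rightarrow> (real \<Rightarrow> real \<Rightarrow> real) \<Rightarrow> (real \<Rightarrow> real) \<Rightarrow> real \<Rightarrow> real" where
  "kernel_op T R f t = (\<integral>s. R s t * f s \<partial>leb_on T)"

definition op_inverse ::
  "real set \<Rightarrow> ((real \<Rightarrow> real) \<Rightarrow> real \<Rightarrow> real) \<Rightarrow> (real \<Rightarrow> real) \<Rightarrow> real \<Rightarrow> real" where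
  "op_inverse T A g = (SOME f. f \<in> L2 T \<and> L2_eq T (A f) g)"

definition orthonormal_basis :: "real set \<Rightarrow> (real \<Rightarrow> real) set \<Rightarrow> bool" where
  "orthonormal_basis T B \<longleftrightarrow>
     B \<subseteq> L2 T \<and>
     (\<forall>e\<in>B. L2_norm T e = 1) \<and>
     (\<forall>e\<in>B. \<forall>e'\<in>B. e \<noteq> e' \<longrightarrow> L2_inner T e e' = 0) \<and>
     (\<forall>f\<in>L2 T. (\<forall>e\<in>B. L2_inner T f e = 0) \<longrightarrow> L2_eq T f (\<lambda>_. 0))"

text \<open>The trace of a nonnegative operator, with values in \<open>[0, \<infinity>]\<close>. It does not depend on the basis.
  All diagonal entries are nonnegative, so truncation by \<^const>\<open>ennreal\<close> has no effect.\<close>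

definition op_trace :: "real set \<Rightarrow> ((real \<Rightarrow> real) \<Rightarrow> real \<Rightarrow> real) \<Rightarrow> ennreal" where
  "op_trace T A =
     (\<Sum>\<^sub>\<infinity>e\<in>(SOME B. orthonormal_basis T B). ennreal (L2_inner T (A e) e))"

definition effective_dim ::
  "real set \<Rightarrow> ((real \<Rightarrow> real) \<Rightarrow> real \<Rightarrow> real) \<Rightarrow> real \<Rightarrow> ennreal" where
  "effective_dim T A l = op_trace T (\<lambda>g. op_inverse T (\<lambda>f t. A f t + l * f t) (A g))"


section \<open>Kernels and the reproducing kernel Hilbert space\<close>

definition nonneg_kernel :: "real set \<Rightarrow> (real \<Rightarrow> real \<Rightarrow> real) \<Rightarrow> bool" where
  "nonneg_kernel T K \<longleftrightarrow>
     continuous_on (T \<times> T) (\<lambda>(s, t). K s t) \<and>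
     (\<forall>s\<in>T. \<forall>t\<in>T. K s t = K t s) \<and>
     (\<forall>F c. finite F \<longrightarrow> F \<subseteq> T \<longrightarrow> 0 \<le> (\<Sum>s\<in>F. \<Sum>t\<in>F. c s * c t * K s t))"

text \<open>Here \<open>S\<close> is the square root of the integral operator of the kernel.\<close>

definition RKHS :: "real set \<Rightarrow> ((real \<Rightarrow> real) \<Rightarrow> real \<Rightarrow> real) \<Rightarrow> (real \<Rightarrow> real) set" where
  "RKHS T S = {g \<in> L2 T. \<exists>f\<in>L2 T. L2_eq T g (S f)}"

definition L2_dense :: "real set \<Rightarrow> (real \<Rightarrow> real) set \<Rightarrow> bool" where
  "L2_dense T H \<longleftrightarrow> (\<forall>g\<in>L2 T. \<forall>r>0. \<exists>h\<in>H. L2_norm T (\<lambda>t. g t - h t) < r)"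

definition L2_injective :: "real set \<Rightarrow> ((real \<Rightarrow> real) \<Rightarrow> real \<Rightarrow> real) \<Rightarrow> bool" where
  "L2_injective T A \<longleftrightarrow> (\<forall>f\<in>L2 T. \<forall>g\<in>L2 T. L2_eq T (A f) (A g) \<longrightarrow> L2_eq T f g)"


section \<open>Matrices\<close>

definition pos_def_mat :: "real mat \<Rightarrow> bool" where
  "pos_def_mat A \<longleftrightarrow>
     square_mat A \<and> transpose_mat A = A \<and>
     (\<forall>v\<in>carrier_vec (dim_row A). v \<noteq> 0\<^sub>v (dim_row A) \<longrightarrow> 0 < scalar_prod v (A *\<^sub>v v))"

definition lambda_min :: "real mat \<Rightarrow> real" where
  "lambda_min A = Min (spectrum A)"

definition lambda_max :: "real mat \<Rightarrow> real" where
  "lambda_max A = Max (spectrum A)"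

text \<open>A vector of dimension \<open>p\<close> is a function on indices \<open>j < p\<close>, so that the dimension may vary with
  the sample size.\<close>

abbreviation vec_borel :: "nat \<Rightarrow> (nat \<Rightarrow> real) measure" where
  "vec_borel p \<equiv> \<Pi>\<^sub>M j\<in>{..<p}. (borel :: real measure)"

definition second_moment_mat :: "'a measure \<Rightarrow> nat \<Rightarrow> ('a \<Rightarrow> nat \<Rightarrow> real) \<Rightarrow> real mat" where
  "second_moment_mat P p X = mat p p (\<lambda>(j, k). \<integral>x. X x j * X x k \<partial>P)"

definition sample_moment_mat :: "nat \<Rightarrow> nat \<Rightarrow> (nat \<Rightarrow> nat \<Rightarrow> real) \<Rightarrow> real mat" where
  "sample_moment_mat n p xs = mat p p (\<lambda>(j, k). (1 / real n) * (\<Sum>i=1..n. xs i j * xs i k))"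


section \<open>Probability\<close>

text \<open>The product below is the double factorial \<open>(2k - 1)!!\<close>. The norm is infinite if some even moment is.\<close>

definition subgauss_norm :: "'a measure \<Rightarrow> ('a \<Rightarrow> real) \<Rightarrow> ennreal" where
  "subgauss_norm P W =
     (SUP k\<in>{1..}. if integrable P (\<lambda>x. W x ^ (2 * k))
       then ennreal (root (2 * k) ((\<integral>x. W x ^ (2 * k) \<partial>P) / (\<Prod>i<k. real (2 * i + 1))))
       else \<infinity>)"

definition generated_sigma :: "'a measure \<Rightarrow> 'c measure \<Rightarrow> ('a \<Rightarrow> 'c) \<Rightarrow> 'a measure" where
  "generated_sigma P N f = vimage_algebra (space P) f N"

text \<open>Convergence to zero in probability. For measurable \<open>V\<close> the outer measure is the probability of
  the event; in general the outer measure makes the notion meaningful (and not weaker) without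
  a measurability condition.\<close>

definition small_op_one :: "(nat \<Rightarrow> 'b measure) \<Rightarrow> (nat \<Rightarrow> 'b \<Rightarrow> real) \<Rightarrow> bool" where
  "small_op_one M V \<longleftrightarrow>
     (\<forall>r>0. (\<lambda>n. outer_measure_of (M n) {x \<in> space (M n). r < \<bar>V n x\<bar>}) \<longlonglongrightarrow> 0)"


section \<open>Partially functional linear model\<close>

definition pfl_predictor ::
  "real set \<Rightarrow> nat \<Rightarrow> (nat \<Rightarrow> real) \<Rightarrow> (real \<Rightarrow> real) \<Rightarrow> (nat \<Rightarrow> real) \<Rightarrow> (real \<Rightarrow> real) \<Rightarrow> real" where
  "pfl_predictor T p \<alpha> \<beta> x y = (\<Sum>j<p. x j * \<alpha> j) + L2_inner T y \<beta>"

definition penalized_loss ::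
  "real set \<Rightarrow> ((real \<Rightarrow> real) \<Rightarrow> real \<Rightarrow> real) \<Rightarrow> nat \<Rightarrow> nat \<Rightarrow> real \<Rightarrow>
   (nat \<Rightarrow> real) \<Rightarrow> (nat \<Rightarrow> nat \<Rightarrow> real) \<Rightarrow> (nat \<Rightarrow> real \<Rightarrow> real) \<Rightarrow>
   (nat \<Rightarrow> real) \<times> (real \<Rightarrow> real) \<Rightarrow> real" where
  "penalized_loss T S n p l zs xs ys = (\<lambda>(\<alpha>, f).
     (1 / real n) * (\<Sum>i=1..n. (zs i - (\<Sum>j<p. xs i j * \<alpha> j) - L2_inner T (ys i) (S f))\<^sup>2)
     + l * (L2_norm T f)\<^sup>2)"

text \<open>The risk of a fixed rule depends only on the law of the new observation, so it is computed
  from the population variables \<open>(Z, X, Y)\<close>, which live on their own space \<open>P\<close>.\<close>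

definition pred_risk ::
  "'a measure \<Rightarrow> ('a \<Rightarrow> real) \<Rightarrow> ('a \<Rightarrow> nat \<Rightarrow> real) \<Rightarrow> ('a \<Rightarrow> real \<Rightarrow> real) \<Rightarrow>
   ((nat \<Rightarrow> real) \<Rightarrow> (real \<Rightarrow> real) \<Rightarrow> real) \<Rightarrow> real" where
  "pred_risk P Z X Y \<eta> = (\<integral>x. (Z x - \<eta> (X x) (Y x))\<^sup>2 \<partial>P)"

abbreviation obs_space :: "real set \<Rightarrow> nat \<Rightarrow> (real \<times> (nat \<Rightarrow> real) \<times> (real \<Rightarrow> real)) measure" where
  "obs_space T p \<equiv> borel \<Otimes>\<^sub>M (vec_borel p \<Otimes>\<^sub>M L2_borel T)"

end

theory Submission
  imports Defs "HOL-Real_Asymp.Real_Asymp"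
begin

text \<open>
  Let \<open>u\<close> be the error of the estimated coefficient vector, \<open>h\<close> the difference between the
  estimated \<open>f\<close> and a preimage \<open>f0\<close> of the true slope under \<open>S\<close>, and \<open>g = S h\<close> the error of the
  slope. Since the noise is conditionally centred and the two covariates are independent with
  centred \<open>X\<close>, the excess risk is \<open>Q = E (X \<bullet> u)\<^sup>2 + E \<langle>Y, g\<rangle>\<^sup>2\<close> (\<open>excess_risk\<close>). Let \<open>Qn\<close> be the
  sample mean of \<open>(X\<^sub>i \<bullet> u + \<langle>Y\<^sub>i, g\<rangle>)\<^sup>2\<close>.

  Comparing the penalized loss at the minimizer with its value at the truth bounds
  \<open>Qn + l \<parallel>h\<parallel>\<^sup>2\<close> by \<open>2 l \<parallel>f0\<parallel> \<parallel>h\<parallel>\<close> plus linear noise terms in \<open>u\<close> and \<open>h\<close>. Replacing \<open>Qn\<close> by \<open>Q\<close>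
  costs quadratic terms whose coefficients are norms of sample covariances minus
  population covariances. The term in \<open>u\<close> is absorbed because \<open>Q\<close> dominates \<open>m' \<parallel>u\<parallel>\<^sup>2\<close>, where
  \<open>m'\<close> bounds the smallest eigenvalue of the second moment matrix of \<open>X\<close> from below. The term
  \<open>RY \<parallel>h\<parallel>\<^sup>2\<close> in the functional direction is not absorbed: \<open>RY\<close> has order \<open>n\<^bsup>-1/2\<^esup>\<close> and may exceed the
  penalty \<open>l\<close>. But the basic inequality itself shows that \<open>\<parallel>h\<parallel>\<^sup>2\<close> has order at most
  \<open>1 + 1 / (n l\<^sup>2)\<close>, up to a noise term in \<open>u\<close> that is absorbed as before, so the term has order \<open>n\<^bsup>-1/2\<^esup> + n\<^bsup>-3/2\<^esup> l\<^bsup>-2\<^esup>\<close>, which vanishes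
  because \<open>l\<close> is at least of order \<open>n\<^bsup>-5/7\<^esup>\<close>. The lemma \<open>ridge_error_bound\<close> is this computation for
  real numbers.

  All stochastic terms are Hilbert--Schmidt norms of averages of independent centred variables, so
  their second moments are \<open>1 / n\<close> times a second moment of one summand, and Markov's inequality
  suffices. The dimension enters through factors \<open>p\<close> and \<open>p\<^sup>2\<close>, which are harmless since
  \<open>p \<le> n\<^bsup>1/7\<^esup>\<close> eventually. To compute in coordinates with measurable real random variables only,
  \<open>L\<^sup>2(T)\<close> is approximated by its subspaces of dyadic step functions, whose coordinate
  forms converge to the inner product (\<open>dyadic_form_tendsto\<close>). Fatou's lemma carries the moment bounds
  over to the limit (\<open>deviation_event\<close>).
\<close>

section \<open>The geometry of \<open>L\<^sup>2(T)\<close>\<close>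

lemma quadratic_nonneg_discriminant:
  fixes a b c :: real
  assumes nonneg: "\<And>t. 0 \<le> a + 2 * t * b + t\<^sup>2 * c" and "0 \<le> c"
  shows "b\<^sup>2 \<le> a * c"
proof (cases "c = 0")
  case True
  have "b = 0"
  proof (rule ccontr)
    assume "b \<noteq> 0"
    then show False
      using nonneg[of "- (a + 1) / (2 * b)"] True by (simp add: field_simps)
  qed
  then show ?thesis using True by simp
next
  case False
  then have "0 < c" using assms(2) by simp
  then show ?thesis
    using nonneg[of "- b / c"] by (simp add: field_simps power2_eq_square)
qed

lemma integrable_mult_of_squares:
  fixes f g :: "'a \<Rightarrow> real"
  assumes [measurable]: "f \<in> borel_measurable M" "g \<in> borel_measurable M"
    and "integrable M (\<lambda>x. (f x)\<^sup>2)" "integrable M (\<lambda>x. (g x)\<^sup>2)"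
  shows "integrable M (\<lambda>x. f x * g x)"
proof (rule Bochner_Integration.integrable_bound)
  show "integrable M (\<lambda>x. (f x)\<^sup>2 + (g x)\<^sup>2)" using assms by simp
  have "\<bar>a * b\<bar> \<le> a\<^sup>2 + b\<^sup>2" for a b :: real
  proof -
    have "2 * \<bar>a\<bar> * \<bar>b\<bar> \<le> a\<^sup>2 + b\<^sup>2" "0 \<le> \<bar>a\<bar> * \<bar>b\<bar>"
      using sum_squares_bound[of "\<bar>a\<bar>" "\<bar>b\<bar>"] by simp_all
    then show ?thesis unfolding abs_mult by linarith
  qed
  then show "AE x in M. norm (f x * g x) \<le> norm ((f x)\<^sup>2 + (g x)\<^sup>2)" by simp
qed measurable

lemma L2_integrable_square: "f \<in> L2 T \<Longrightarrow> integrable (leb_on T) (\<lambda>t. (f t)\<^sup>2)"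
  by (simp add: L2_def)

lemma L2_integrable_mult:
  "f \<in> L2 T \<Longrightarrow> g \<in> L2 T \<Longrightarrow> integrable (leb_on T) (\<lambda>t. f t * g t)"
  by (intro integrable_mult_of_squares) (auto simp: L2_def)

lemma L2_scale: "f \<in> L2 T \<Longrightarrow> (\<lambda>t. a * f t) \<in> L2 T"
  by (auto simp: L2_def power_mult_distrib)

lemma L2_add:
  assumes f: "f \<in> L2 T" and g: "g \<in> L2 T"
  shows "(\<lambda>t. f t + g t) \<in> L2 T"
proof -
  have "integrable (leb_on T) (\<lambda>t. (f t)\<^sup>2 + (g t)\<^sup>2 + 2 * (f t * g t))"
    using L2_integrable_square[OF f] L2_integrable_square[OF g] L2_integrable_mult[OF f g] by auto
  then show ?thesis
    using f g by (auto simp: L2_def power2_sum mult.assoc)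
qed

lemma L2_diff: "f \<in> L2 T \<Longrightarrow> g \<in> L2 T \<Longrightarrow> (\<lambda>t. f t - g t) \<in> L2 T"
  using L2_add[OF _ L2_scale[of g T "-1"], of f] by simp

lemma L2_inner_commute: "L2_inner T f g = L2_inner T g f"
  by (simp add: L2_inner_def mult.commute)

lemma L2_inner_add_left:
  "\<lbrakk>f \<in> L2 T; g \<in> L2 T; h \<in> L2 T\<rbrakk> \<Longrightarrow>
    L2_inner T (\<lambda>t. f t + g t) h = L2_inner T f h + L2_inner T g h"
  by (simp add: L2_inner_def L2_integrable_mult distrib_right)

lemma L2_inner_add_right:
  "\<lbrakk>f \<in> L2 T; g \<in> L2 T; h \<in> L2 T\<rbrakk> \<Longrightarrow>
    L2_inner T h (\<lambda>t. f t + g t) = L2_inner T h f + L2_inner T h g"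
  by (simp add: L2_inner_def L2_integrable_mult distrib_left)

lemma L2_inner_diff_left:
  "\<lbrakk>f \<in> L2 T; g \<in> L2 T; h \<in> L2 T\<rbrakk> \<Longrightarrow>
    L2_inner T (\<lambda>t. f t - g t) h = L2_inner T f h - L2_inner T g h"
  by (simp add: L2_inner_def L2_integrable_mult left_diff_distrib)

lemma L2_inner_diff_right:
  "\<lbrakk>f \<in> L2 T; g \<in> L2 T; h \<in> L2 T\<rbrakk> \<Longrightarrow>
    L2_inner T h (\<lambda>t. f t - g t) = L2_inner T h f - L2_inner T h g"
  by (simp add: L2_inner_def L2_integrable_mult right_diff_distrib)

lemma L2_inner_scale_left: "L2_inner T (\<lambda>t. a * f t) g = a * L2_inner T f g"
  by (simp add: L2_inner_def mult.assoc)

lemma L2_inner_scale_right: "L2_inner T f (\<lambda>t. a * g t) = a * L2_inner T f g"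
  by (simp add: L2_inner_def mult.left_commute)

lemma L2_inner_self_nonneg: "0 \<le> L2_inner T f f"
  by (simp add: L2_inner_def)

lemma L2_norm_nonneg: "0 \<le> L2_norm T f"
  by (simp add: L2_norm_def L2_inner_self_nonneg)

lemma L2_norm_square: "(L2_norm T f)\<^sup>2 = L2_inner T f f"
  by (simp add: L2_norm_def L2_inner_self_nonneg)

lemma L2_inner_Cauchy_Schwarz:
  assumes f: "f \<in> L2 T" and g: "g \<in> L2 T"
  shows "(L2_inner T f g)\<^sup>2 \<le> L2_inner T f f * L2_inner T g g"
proof (rule quadratic_nonneg_discriminant)
  fix t
  have "0 \<le> L2_inner T (\<lambda>s. f s + t * g s) (\<lambda>s. f s + t * g s)"
    by (rule L2_inner_self_nonneg)
  also have "\<dots> = L2_inner T f f + 2 * t * L2_inner T f g + t\<^sup>2 * L2_inner T g g"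
    using f g by (simp add: L2_inner_add_left L2_inner_add_right L2_add L2_scale
        L2_inner_scale_left L2_inner_scale_right L2_inner_commute[of T g f] power2_eq_square distrib_left)
  finally show "0 \<le> L2_inner T f f + 2 * t * L2_inner T f g + t\<^sup>2 * L2_inner T g g" .
qed (rule L2_inner_self_nonneg)

lemma L2_inner_le_norms:
  assumes "f \<in> L2 T" "g \<in> L2 T"
  shows "\<bar>L2_inner T f g\<bar> \<le> L2_norm T f * L2_norm T g"
  using L2_inner_Cauchy_Schwarz[OF assms]
  by (simp flip: L2_norm_square power_mult_distrib)
     (metis L2_norm_nonneg abs_le_square_iff abs_of_nonneg mult_nonneg_nonneg)

lemma L2_inner_cong_AE_right:
  assumes "L2_eq T g h" "f \<in> L2 T" "g \<in> L2 T" "h \<in> L2 T"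
  shows "L2_inner T f g = L2_inner T f h"
  unfolding L2_inner_def
proof (rule integral_cong_AE)
  show "AE t in leb_on T. f t * g t = f t * h t"
    using assms(1) unfolding L2_eq_def by (auto elim!: eventually_mono)
qed (use assms in \<open>auto simp: L2_def\<close>)

lemma L2_norm_cong_AE:
  assumes "L2_eq T g h" "g \<in> L2 T" "h \<in> L2 T"
  shows "L2_norm T g = L2_norm T h"
  using L2_inner_cong_AE_right[OF assms(1) assms(2) assms(2,3)]
    L2_inner_cong_AE_right[OF assms(1) assms(3) assms(2,3)]
  by (simp add: L2_norm_def L2_inner_commute[of T g h])

lemma space_L2_borel [simp]: "space (L2_borel T) = L2 T"
  unfolding L2_borel_def by (rule space_measure_of) auto

text \<open>By the Cauchy--Schwarz inequality the functional is continuous for the norm, so preimages of open sets are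
among the sets that generate the sigma-algebra. The coordinate functionals are the only source of
measurability used for random functions below.\<close>

lemma L2_inner_borel_measurable:
  assumes g: "g \<in> L2 T"
  shows "(\<lambda>y. L2_inner T y g) \<in> borel_measurable (L2_borel T)"
proof (rule borel_measurableI)
  fix U :: "real set" assume U: "open U"
  let ?V = "{y \<in> L2 T. L2_inner T y g \<in> U}"
  have "\<exists>r>0. \<forall>h\<in>L2 T. L2_norm T (\<lambda>t. f t - h t) < r \<longrightarrow> h \<in> ?V" if f: "f \<in> ?V" for f
  proof -
    obtain d where d: "0 < d" "\<And>z. dist z (L2_inner T f g) < d \<Longrightarrow> z \<in> U"
      using U f by (auto simp: open_dist)
    have pos: "0 < 1 + L2_norm T g"
      using L2_norm_nonneg[of T g] by linarith
    show ?thesis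
    proof (intro exI[of _ "d / (1 + L2_norm T g)"] conjI ballI impI)
      show "0 < d / (1 + L2_norm T g)" using d pos by simp
      fix h assume h: "h \<in> L2 T" and close: "L2_norm T (\<lambda>t. f t - h t) < d / (1 + L2_norm T g)"
      have fL: "f \<in> L2 T" using f by simp
      have "\<bar>L2_inner T f g - L2_inner T h g\<bar> = \<bar>L2_inner T (\<lambda>t. f t - h t) g\<bar>"
        using fL h g by (simp add: L2_inner_diff_left)
      also have "\<dots> \<le> L2_norm T (\<lambda>t. f t - h t) * L2_norm T g"
        by (rule L2_inner_le_norms) (use fL h g in \<open>auto intro: L2_diff\<close>)
      also have "\<dots> \<le> L2_norm T (\<lambda>t. f t - h t) * (1 + L2_norm T g)"
        by (intro mult_left_mono L2_norm_nonneg) simp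
      also have "\<dots> < d"
        using close pos by (simp add: field_simps)
      finally have "L2_inner T h g \<in> U"
        by (intro d(2)) (simp add: dist_real_def abs_minus_commute)
      with h show "h \<in> ?V" by simp
    qed
  qed
  then have "?V \<in> sets (L2_borel T)"
    unfolding L2_borel_def by (subst sets_measure_of) (auto intro!: sigma_sets.Basic)
  moreover have "(\<lambda>y. L2_inner T y g) -` U \<inter> space (L2_borel T) = ?V" by auto
  ultimately show "(\<lambda>y. L2_inner T y g) -` U \<inter> space (L2_borel T) \<in> sets (L2_borel T)" by simp
qed

section \<open>Dyadic step functions exhaust \<open>L\<^sup>2(T)\<close>\<close>

lemma tendsto_zero_squeeze:
  fixes f g :: "nat \<Rightarrow> real"
  assumes "\<And>m. 0 \<le> f m" "\<And>m. f m \<le> g m" "g \<longlonglongrightarrow> 0"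
  shows "f \<longlonglongrightarrow> 0"
  using assms by (intro tendsto_sandwich[of "\<lambda>_. 0" f sequentially g 0] always_eventually allI tendsto_const)

definition dyadic_cell :: "real set \<Rightarrow> nat \<Rightarrow> int \<Rightarrow> real set" where
  "dyadic_cell T m k = {t \<in> T. \<lfloor>2 ^ m * t\<rfloor> = k}"

text \<open>The steps of one level form an orthonormal system, except that cells of measure zero contribute the
zero function because division by zero yields zero. Such cells therefore need no special treatment.\<close>

definition dyadic_step :: "real set \<Rightarrow> nat \<Rightarrow> int \<Rightarrow> real \<Rightarrow> real" where
  "dyadic_step T m k t = indicator (dyadic_cell T m k) t / sqrt (measure (leb_on T) (dyadic_cell T m k))"

definition dyadic_indices :: "real set \<Rightarrow> nat \<Rightarrow> int set" where
  "dyadic_indices T m = (\<lambda>t. \<lfloor>2 ^ m * t\<rfloor>) ` T"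

text \<open>The inner product of the orthogonal projections of the two functions onto the step functions of level \<open>m\<close>.\<close>

definition dyadic_form :: "real set \<Rightarrow> nat \<Rightarrow> (real \<Rightarrow> real) \<Rightarrow> (real \<Rightarrow> real) \<Rightarrow> real" where
  "dyadic_form T m f g =
     (\<Sum>k\<in>dyadic_indices T m. L2_inner T f (dyadic_step T m k) * L2_inner T g (dyadic_step T m k))"

text \<open>The squared distance of a function from the step functions of level \<open>m\<close>, in a form that does not mention
the projection. It is a nonnegative quadratic form, hence behaves like a squared seminorm.\<close>

definition dyadic_defect :: "real set \<Rightarrow> nat \<Rightarrow> (real \<Rightarrow> real) \<Rightarrow> real" where
  "dyadic_defect T m f = L2_inner T f f - dyadic_form T m f f"

lemma finite_dyadic_indices: "bounded T \<Longrightarrow> finite (dyadic_indices T m)"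
proof -
  assume "bounded T"
  then obtain a where a: "\<And>t. t \<in> T \<Longrightarrow> \<bar>t\<bar> \<le> a" by (auto simp: bounded_iff)
  have "dyadic_indices T m \<subseteq> {\<lfloor>- (2 ^ m * a)\<rfloor>..\<lfloor>2 ^ m * a\<rfloor>}"
  proof
    fix k assume "k \<in> dyadic_indices T m"
    then obtain t where t: "t \<in> T" "k = \<lfloor>2 ^ m * t\<rfloor>" by (auto simp: dyadic_indices_def)
    have "t \<le> a" "- a \<le> t" using a[OF t(1)] by auto
    then have "2 ^ m * t \<le> 2 ^ m * a" "2 ^ m * (- a) \<le> 2 ^ m * t"
      by (intro mult_left_mono; simp)+
    then show "k \<in> {\<lfloor>- (2 ^ m * a)\<rfloor>..\<lfloor>2 ^ m * a\<rfloor>}"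
      unfolding t(2) by (auto intro!: floor_mono)
  qed
  then show ?thesis using finite_subset by blast
qed

context
  fixes T :: "real set"
  assumes compact_T: "compact T"
begin

lemma sets_T [measurable, simp]: "T \<in> sets borel"
  using compact_T by (simp add: borel_compact)

lemma space_leb_on: "space (leb_on T) = T"
  by (simp add: space_restrict_space)

lemma measurable_leb_onI: "f \<in> borel_measurable borel \<Longrightarrow> f \<in> borel_measurable (leb_on T)"
  by (intro measurable_restrict_space1) simp

lemma sets_leb_onI: "A \<in> sets borel \<Longrightarrow> A \<subseteq> T \<Longrightarrow> A \<in> sets (leb_on T)"
  by (simp add: sets_restrict_space_iff)

lemma finite_measure_leb_on: "finite_measure (leb_on T)"
proof
  have "emeasure lborel T < \<infinity>"
    using compact_T by (intro emeasure_bounded_finite compact_imp_bounded)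
  then show "emeasure (leb_on T) (space (leb_on T)) \<noteq> \<infinity>"
    by (simp add: space_leb_on emeasure_restrict_space)
qed

interpretation leb: finite_measure "leb_on T"
  by (rule finite_measure_leb_on)

lemma sets_dyadic_cell: "dyadic_cell T m k \<in> sets (leb_on T)"
proof (rule sets_leb_onI)
  have "dyadic_cell T m k = T \<inter> {t. \<lfloor>2 ^ m * t\<rfloor> = k}" by (auto simp: dyadic_cell_def)
  also have "\<dots> \<in> sets borel" by (intro sets.Int sets_T) measurable
  finally show "dyadic_cell T m k \<in> sets borel" .
qed (auto simp: dyadic_cell_def)

lemma L2_indicator:
  assumes "A \<in> sets (leb_on T)" shows "(\<lambda>t. indicator A t) \<in> L2 T"
proof -
  have "integrable (leb_on T) (indicator A :: real \<Rightarrow> real)"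
    by (intro integrable_real_indicator assms) (metis leb.emeasure_finite less_top infinity_ennreal_def)
  then show ?thesis
    using assms by (simp add: L2_def power2_eq_square flip: indicator_inter_arith)
qed

lemma L2_inner_indicators:
  assumes "A \<in> sets (leb_on T)" "B \<in> sets (leb_on T)"
  shows "L2_inner T (\<lambda>t. indicator A t) (\<lambda>t. indicator B t) = measure (leb_on T) (A \<inter> B)"
  using sets.sets_into_space[OF assms(1)]
  by (simp add: L2_inner_def flip: indicator_inter_arith) (simp add: Int_absorb1 inf.coboundedI1 Int_commute)

lemma L2_dyadic_step: "dyadic_step T m k \<in> L2 T"
  using L2_scale[OF L2_indicator[OF sets_dyadic_cell, of m k],
      of "1 / sqrt (measure (leb_on T) (dyadic_cell T m k))"]
  by (simp add: dyadic_step_def[abs_def])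

lemma L2_inner_dyadic_step:
  "L2_inner T f (dyadic_step T m k) =
     L2_inner T f (\<lambda>t. indicator (dyadic_cell T m k) t) / sqrt (measure (leb_on T) (dyadic_cell T m k))"
  using L2_inner_scale_right[of T f "1 / sqrt (measure (leb_on T) (dyadic_cell T m k))"
      "\<lambda>t. indicator (dyadic_cell T m k) t"]
  by (simp add: dyadic_step_def[abs_def])

lemma sum_indicator_dyadic_cells:
  assumes "t \<in> T"
  shows "(\<Sum>k\<in>dyadic_indices T m. indicator (dyadic_cell T m k) t) = (1::real)"
proof -
  have fin: "finite (dyadic_indices T m)"
    using compact_T by (simp add: compact_imp_bounded finite_dyadic_indices)
  have "(\<Sum>k\<in>dyadic_indices T m. indicator (dyadic_cell T m k) t) =
      (\<Sum>k\<in>dyadic_indices T m. if k = \<lfloor>2 ^ m * t\<rfloor> then 1 else (0::real))"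
    using assms by (intro sum.cong) (auto simp: dyadic_cell_def indicator_def)
  also have "\<dots> = 1"
    using assms fin by (auto simp: dyadic_indices_def)
  finally show ?thesis .
qed

lemma integral_split_dyadic_cells:
  fixes f :: "real \<Rightarrow> real"
  assumes f: "integrable (leb_on T) f"
  shows "(\<integral>t. f t \<partial>leb_on T) =
    (\<Sum>k\<in>dyadic_indices T m. \<integral>t. f t * indicator (dyadic_cell T m k) t \<partial>leb_on T)"
proof -
  have "(\<integral>t. f t \<partial>leb_on T) =
      (\<integral>t. (\<Sum>k\<in>dyadic_indices T m. f t * indicator (dyadic_cell T m k) t) \<partial>leb_on T)"
  proof (intro Bochner_Integration.integral_cong refl)
    fix t assume "t \<in> space (leb_on T)"
    then have "f t * (\<Sum>k\<in>dyadic_indices T m. indicator (dyadic_cell T m k) t) = f t"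
      by (simp add: space_leb_on sum_indicator_dyadic_cells)
    then show "f t = (\<Sum>k\<in>dyadic_indices T m. f t * indicator (dyadic_cell T m k) t)"
      by (simp add: sum_distrib_left)
  qed
  also have "\<dots> = (\<Sum>k\<in>dyadic_indices T m. \<integral>t. f t * indicator (dyadic_cell T m k) t \<partial>leb_on T)"
    using f sets_dyadic_cell by (intro Bochner_Integration.integral_sum integrable_mult_indicator
      integrable_real_mult_indicator) auto
  finally show ?thesis .
qed

text \<open>Bessel's inequality. On each cell it is the Cauchy--Schwarz inequality for the restricted function and
the indicator of the cell, and the cells partition \<open>T\<close>.\<close>

lemma dyadic_form_le:
  assumes f: "f \<in> L2 T"
  shows "dyadic_form T m f f \<le> L2_inner T f f"
proof -
  have cell: "(L2_inner T f (dyadic_step T m k))\<^sup>2 \<le>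
      (\<integral>t. (f t)\<^sup>2 * indicator (dyadic_cell T m k) t \<partial>leb_on T)" for k
  proof -
    let ?I = "dyadic_cell T m k" and ?f = "\<lambda>t. f t * indicator (dyadic_cell T m k) t"
    let ?\<mu> = "measure (leb_on T) ?I"
    have fI: "?f \<in> L2 T"
    proof -
      have "integrable (leb_on T) (\<lambda>t. (f t)\<^sup>2 * indicator ?I t)"
        by (intro integrable_real_mult_indicator sets_dyadic_cell L2_integrable_square f)
      moreover have "(?f t)\<^sup>2 = (f t)\<^sup>2 * indicator ?I t" for t
        by (simp add: indicator_def)
      moreover have "?f \<in> borel_measurable (leb_on T)"
        using f sets_dyadic_cell[of m k] by (intro borel_measurable_times borel_measurable_indicator) (auto simp: L2_def)
      ultimately show ?thesis by (simp add: L2_def)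
    qed
    have eq: "L2_inner T f (\<lambda>t. indicator ?I t) = L2_inner T ?f (\<lambda>t. indicator ?I t)"
      by (simp add: L2_inner_def mult.assoc flip: indicator_inter_arith)
    have sq: "L2_inner T ?f ?f = (\<integral>t. (f t)\<^sup>2 * indicator ?I t \<partial>leb_on T)"
      unfolding L2_inner_def
      by (intro Bochner_Integration.integral_cong) (auto simp: power2_eq_square indicator_def)
    have CS: "(L2_inner T ?f (\<lambda>t. indicator ?I t))\<^sup>2 \<le> L2_inner T ?f ?f * ?\<mu>"
      using L2_inner_Cauchy_Schwarz[OF fI L2_indicator[OF sets_dyadic_cell, of m k]]
      by (simp add: L2_inner_indicators sets_dyadic_cell)
    show ?thesis
    proof (cases "?\<mu> = 0")
      case True
      then show ?thesis
        by (simp add: L2_inner_dyadic_step)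
    next
      case False
      then have "0 < ?\<mu>" using measure_nonneg[of "leb_on T" ?I] by linarith
      then show ?thesis
        using CS by (simp add: L2_inner_dyadic_step eq sq power_divide divide_le_eq)
    qed
  qed
  show ?thesis
    unfolding dyadic_form_def
    using integral_split_dyadic_cells[OF L2_integrable_square[OF f], of m] sum_mono[OF cell]
    by (simp add: L2_inner_def power2_eq_square)
qed

lemma dyadic_defect_nonneg: "f \<in> L2 T \<Longrightarrow> 0 \<le> dyadic_defect T m f"
  using dyadic_form_le[of f m] by (simp add: dyadic_defect_def)

lemma dyadic_defect_le: "dyadic_defect T m f \<le> L2_inner T f f"
  unfolding dyadic_defect_def dyadic_form_def by (simp add: sum_nonneg)

lemma dyadic_defect_combine:
  assumes f: "f \<in> L2 T" and g: "g \<in> L2 T"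
  shows "dyadic_defect T m (\<lambda>s. f s + t * g s) =
    dyadic_defect T m f + 2 * t * (L2_inner T f g - dyadic_form T m f g) + t\<^sup>2 * dyadic_defect T m g"
proof -
  have "dyadic_form T m (\<lambda>s. f s + t * g s) (\<lambda>s. f s + t * g s) =
      dyadic_form T m f f + 2 * t * dyadic_form T m f g + t\<^sup>2 * dyadic_form T m g g"
    using f g unfolding dyadic_form_def sum_distrib_left sum.distrib[symmetric]
    by (intro sum.cong)
       (simp_all add: L2_inner_add_left L2_scale L2_inner_scale_left L2_dyadic_step power2_eq_square algebra_simps)
  moreover have "L2_inner T (\<lambda>s. f s + t * g s) (\<lambda>s. f s + t * g s) =
      L2_inner T f f + 2 * t * L2_inner T f g + t\<^sup>2 * L2_inner T g g"
    using f g by (simp add: L2_inner_add_left L2_inner_add_right L2_add L2_scale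
        L2_inner_scale_left L2_inner_scale_right L2_inner_commute[of T g f] power2_eq_square distrib_left)
  ultimately show ?thesis
    unfolding dyadic_defect_def by (simp add: algebra_simps)
qed

text \<open>The left-hand side is the square of the bilinear form that belongs to the defect, so this is the
Cauchy--Schwarz inequality for that form. It reduces convergence of the forms to convergence of
the defects.\<close>

lemma dyadic_form_error:
  assumes f: "f \<in> L2 T" and g: "g \<in> L2 T"
  shows "(L2_inner T f g - dyadic_form T m f g)\<^sup>2 \<le> dyadic_defect T m f * dyadic_defect T m g"
proof (rule quadratic_nonneg_discriminant)
  show "0 \<le> dyadic_defect T m f + 2 * t * (L2_inner T f g - dyadic_form T m f g) + t\<^sup>2 * dyadic_defect T m g" for t
    using dyadic_defect_nonneg[OF L2_add[OF f L2_scale[OF g]], of m t]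
    by (simp add: dyadic_defect_combine[OF f g])
qed (rule dyadic_defect_nonneg[OF g])

lemma dyadic_defect_add:
  assumes f: "f \<in> L2 T" and g: "g \<in> L2 T"
  shows "dyadic_defect T m (\<lambda>s. f s + g s) \<le> 2 * dyadic_defect T m f + 2 * dyadic_defect T m g"
  using dyadic_defect_combine[OF f g, of m 1] dyadic_defect_combine[OF f g, of m "-1"]
    dyadic_defect_nonneg[OF L2_diff[OF f g], of m]
  by simp

lemma dyadic_defect_scale: "dyadic_defect T m (\<lambda>s. a * f s) = a\<^sup>2 * dyadic_defect T m f"
  unfolding dyadic_defect_def dyadic_form_def
  by (simp add: L2_inner_scale_left L2_inner_scale_right sum_distrib_left power2_eq_square algebra_simps)

text \<open>The functions that lie in the closure of the dyadic step functions. The lemmas below show that this class is closed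
under linear combinations and \<open>L\<^sup>2\<close>-limits and contains indicators of half-lines, then by a
Dynkin argument indicators of Borel sets, then everything.\<close>

definition resolved :: "(real \<Rightarrow> real) \<Rightarrow> bool" where
  "resolved f \<longleftrightarrow> f \<in> L2 T \<and> (\<lambda>m. dyadic_defect T m f) \<longlonglongrightarrow> 0"

lemma resolved_add: 
  assumes f: "resolved f" and g: "resolved g"
  shows "resolved (\<lambda>t. f t + g t)"
proof -
  have L: "f \<in> L2 T" "g \<in> L2 T" using assms by (auto simp: resolved_def)
  have "(\<lambda>m. 2 * dyadic_defect T m f + 2 * dyadic_defect T m g) \<longlonglongrightarrow> 2 * 0 + 2 * 0"
    using f g unfolding resolved_def by (intro tendsto_intros) auto
  then have "(\<lambda>m. dyadic_defect T m (\<lambda>t. f t + g t)) \<longlonglongrightarrow> 0"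
    by (intro tendsto_zero_squeeze[OF _ dyadic_defect_add[OF L]] dyadic_defect_nonneg L2_add L) simp
  then show ?thesis by (simp add: resolved_def L L2_add)
qed

lemma resolved_scale: "resolved f \<Longrightarrow> resolved (\<lambda>t. a * f t)"
  using tendsto_mult_right_zero[of "\<lambda>m. dyadic_defect T m f" sequentially "a\<^sup>2"]
  by (auto simp: resolved_def L2_scale dyadic_defect_scale)

lemma resolved_sum:
  "finite A \<Longrightarrow> (\<And>a. a \<in> A \<Longrightarrow> resolved (F a)) \<Longrightarrow> resolved (\<lambda>t. \<Sum>a\<in>A. F a t)"
proof (induction A rule: finite_induct)
  case empty
  have "dyadic_defect T m (\<lambda>t. 0) = 0" for m
    by (simp add: dyadic_defect_def dyadic_form_def L2_inner_def)
  then show ?case by (simp add: resolved_def L2_def)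
next
  case (insert a A)
  then show ?case using resolved_add[of "F a" "\<lambda>t. \<Sum>a\<in>A. F a t"] by simp
qed

text \<open>The defect of \<open>f\<close> is at most twice the defect of \<open>F j\<close> plus twice the squared distance of \<open>f\<close> and \<open>F j\<close>.\<close>

lemma resolved_limit:
  assumes F: "\<And>j::nat. resolved (F j)" and f: "f \<in> L2 T"
    and lim: "(\<lambda>j. L2_inner T (\<lambda>t. f t - F j t) (\<lambda>t. f t - F j t)) \<longlonglongrightarrow> 0"
  shows "resolved f"
  unfolding resolved_def
proof (intro conjI f LIMSEQ_I)
  fix r :: real assume "0 < r"
  have FL: "F j \<in> L2 T" for j using F by (auto simp: resolved_def)
  have "\<forall>\<^sub>F j in sequentially. L2_inner T (\<lambda>t. f t - F j t) (\<lambda>t. f t - F j t) < r / 4"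
    using \<open>0 < r\<close> by (intro order_tendstoD(2)[OF lim]) simp
  then obtain j where j: "L2_inner T (\<lambda>t. f t - F j t) (\<lambda>t. f t - F j t) < r / 4"
    by (auto simp: eventually_sequentially)
  have "(\<lambda>m. dyadic_defect T m (F j)) \<longlonglongrightarrow> 0" using F by (simp add: resolved_def)
  from order_tendstoD(2)[OF this, of "r / 4"] \<open>0 < r\<close> obtain m0
    where m0: "\<And>m. m0 \<le> m \<Longrightarrow> dyadic_defect T m (F j) < r / 4"
    by (auto simp: eventually_sequentially)
  show "\<exists>m0. \<forall>m\<ge>m0. norm (dyadic_defect T m f - 0) < r"
  proof (intro exI[of _ m0] allI impI)
    fix m assume "m0 \<le> m"
    have "dyadic_defect T m f \<le> 2 * dyadic_defect T m (\<lambda>t. f t - F j t) + 2 * dyadic_defect T m (F j)"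
      using dyadic_defect_add[OF L2_diff[OF f FL] FL, of m j j] by simp
    also have "\<dots> \<le> 2 * L2_inner T (\<lambda>t. f t - F j t) (\<lambda>t. f t - F j t) + 2 * dyadic_defect T m (F j)"
      using dyadic_defect_le[of m "\<lambda>t. f t - F j t"] by simp
    also have "\<dots> < r" using j m0[OF \<open>m0 \<le> m\<close>] by simp
    finally show "norm (dyadic_defect T m f - 0) < r"
      using dyadic_defect_nonneg[OF f] by simp
  qed
qed

text \<open>A half-line contains or misses every cell but the one around its endpoint, and only that cell contributes to
the defect, at most its length \<open>2\<^bsup>-m\<^esup>\<close>.\<close>

lemma resolved_atMost: "resolved (\<lambda>t. indicator (T \<inter> {..x}) t)"
proof -
  let ?A = "T \<inter> {..x}" and ?\<mu> = "measure (leb_on T)"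
  have A: "?A \<in> sets (leb_on T)" by (intro sets_leb_onI) auto
  have fin: "finite (dyadic_indices T m)" for m
    using compact_T by (simp add: compact_imp_bounded finite_dyadic_indices)
  have bound: "dyadic_defect T m (\<lambda>t. indicator ?A t) \<le> (1/2) ^ m" for m
  proof -
    let ?I = "dyadic_cell T m"
    define d where "d k = ?\<mu> (?A \<inter> ?I k) - (?\<mu> (?A \<inter> ?I k) / sqrt (?\<mu> (?I k)))\<^sup>2" for k
    have "L2_inner T (\<lambda>t. indicator ?A t) (\<lambda>t. indicator ?A t) =
        (\<Sum>k\<in>dyadic_indices T m. ?\<mu> (?A \<inter> ?I k))"
    proof -
      have "integrable (leb_on T) (\<lambda>t. indicator ?A t * indicator ?A t :: real)"
        by (intro L2_integrable_mult L2_indicator A)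
      from integral_split_dyadic_cells[OF this, of m] show ?thesis
        using L2_inner_indicators[OF A sets_dyadic_cell]
        unfolding L2_inner_def by (simp add: indicator_inter_arith[symmetric])
    qed
    then have "dyadic_defect T m (\<lambda>t. indicator ?A t) = (\<Sum>k\<in>dyadic_indices T m. d k)"
      unfolding dyadic_defect_def dyadic_form_def d_def
      by (simp add: sum_subtractf L2_inner_dyadic_step L2_inner_indicators A sets_dyadic_cell power2_eq_square)
    also have "\<dots> \<le> (\<Sum>k\<in>dyadic_indices T m. if k = \<lfloor>2 ^ m * x\<rfloor> then (1/2) ^ m else 0)"
    proof (rule sum_mono)
      fix k
      have floor_mono': "s \<le> t \<Longrightarrow> \<lfloor>2 ^ m * s\<rfloor> \<le> \<lfloor>2 ^ m * t\<rfloor>" for s t :: real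
        by (intro floor_mono mult_left_mono) auto
      consider "k < \<lfloor>2 ^ m * x\<rfloor>" | "k > \<lfloor>2 ^ m * x\<rfloor>" | "k = \<lfloor>2 ^ m * x\<rfloor>" by linarith
      then show "d k \<le> (if k = \<lfloor>2 ^ m * x\<rfloor> then (1/2) ^ m else 0)"
      proof cases
        case 1
        have "?I k \<subseteq> ?A"
        proof
          fix t assume t: "t \<in> ?I k"
          then have "\<not> x \<le> t" using 1 floor_mono'[of x t] by (auto simp: dyadic_cell_def)
          then show "t \<in> ?A" using t by (simp add: dyadic_cell_def)
        qed
        then have "?A \<inter> ?I k = ?I k" by blast
        then show ?thesis
          using 1 by (simp add: d_def power_divide power2_eq_square)
      next
        case 2
        have "?A \<inter> ?I k = {}"
        proof (rule equals0I)
          fix t assume "t \<in> ?A \<inter> ?I k"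
          then show False using 2 floor_mono'[of t x] by (auto simp: dyadic_cell_def)
        qed
        then show ?thesis using 2 by (simp add: d_def)
      next
        case 3
        have "d k \<le> ?\<mu> (?A \<inter> ?I k)" by (simp add: d_def)
        also have "\<dots> \<le> measure lborel {k / 2 ^ m..(k + 1) / 2 ^ m}"
        proof -
          have "?A \<inter> ?I k \<subseteq> {k / 2 ^ m..(k + 1) / 2 ^ m}"
          proof
            fix t assume "t \<in> ?A \<inter> ?I k"
            then have "of_int k \<le> 2 ^ m * t" "2 ^ m * t \<le> of_int k + 1"
              by (auto simp: dyadic_cell_def)
            then show "t \<in> {k / 2 ^ m..(k + 1) / 2 ^ m}"
              by (simp add: divide_le_eq le_divide_eq mult.commute)
          qed
          moreover have "?\<mu> (?A \<inter> ?I k) = measure lborel (?A \<inter> ?I k)"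
            by (intro measure_restrict_space) auto
          moreover have "?A \<inter> ?I k \<in> sets lborel"
            using sets.Int[OF A sets_dyadic_cell[of m k]] by (simp add: sets_restrict_space_iff)
          ultimately show ?thesis
            by (simp only:) (intro measure_mono_fmeasurable fmeasurableI, auto simp: emeasure_lborel_Icc_eq)
        qed
        also have "\<dots> = (1/2) ^ m"
          by (simp add: field_simps power_divide)
        finally show ?thesis using 3 by simp
      qed
    qed
    also have "\<dots> \<le> (1/2) ^ m" using fin by simp
    finally show ?thesis .
  qed
  have "(\<lambda>m. dyadic_defect T m (\<lambda>t. indicator ?A t)) \<longlonglongrightarrow> 0"
    by (rule tendsto_zero_squeeze[OF _ bound LIMSEQ_power_zero[of "1/2"]])
       (simp_all add: dyadic_defect_nonneg L2_indicator A)
  then show ?thesis by (simp add: resolved_def L2_indicator A)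
qed

lemma resolved_indicator:
  assumes "A \<in> sets borel"
  shows "resolved (\<lambda>t. indicator (T \<inter> A) t)"
proof -
  have T_sets: "T \<inter> B \<in> sets (leb_on T)" if "B \<in> sets borel" for B
    using that by (intro sets_leb_onI) auto
  have "Int_stable (range (atMost :: real \<Rightarrow> real set))"
    by (auto simp: Int_stable_def min_def intro!: image_eqI[where x="min _ _"])
  moreover have "range (atMost :: real \<Rightarrow> real set) \<subseteq> Pow UNIV" by simp
  moreover have "A \<in> sigma_sets UNIV (range atMost)"
    using assms by (simp add: borel_eq_atMost)
  ultimately show ?thesis
  proof (induction rule: sigma_sets_induct_disjoint)
    case (basic A)
    then show ?case using resolved_atMost by auto
  next
    case empty
    show ?case using resolved_sum[of "{}"] by simp
  next
    case (compl A)
    obtain a where a: "\<And>t. t \<in> T \<Longrightarrow> \<bar>t\<bar> \<le> a"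
      using compact_imp_bounded[OF compact_T] by (auto simp: bounded_iff)
    have "resolved (\<lambda>t. indicator (T \<inter> {..a}) t + (-1) * indicator (T \<inter> A) t)"
      by (intro resolved_add resolved_scale resolved_atMost compl)
    also have "(\<lambda>t. indicator (T \<inter> {..a}) t + (-1) * indicator (T \<inter> A) t) =
        (\<lambda>t. indicator (T \<inter> (UNIV - A)) t :: real)"
      using a by (force simp: indicator_def fun_eq_iff)
    finally show ?case .
  next
    case (union A)
    have [measurable]: "A i \<in> sets borel" for i
      using union(2) by (auto simp: borel_eq_atMost)
    show ?case
    proof (rule resolved_limit)
      show "resolved (\<lambda>t. \<Sum>i<j. indicator (T \<inter> A i) t)" for j
        by (intro resolved_sum union) simp
      show "(\<lambda>t. indicator (T \<inter> (\<Union>i. A i)) t) \<in> L2 T"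
        by (intro L2_indicator T_sets) measurable
      have sum_eq: "(\<Sum>i<j. indicator (T \<inter> A i) t) = (indicator (T \<inter> (\<Union>i<j. A i)) t :: real)" for j t
      proof -
        have "disjoint_family_on (\<lambda>i. T \<inter> A i) {..<j}"
          using union(1) by (auto simp: disjoint_family_on_def)
        from indicator_UN_disjoint[OF _ this, of t]
        have "indicator (\<Union>i<j. T \<inter> A i) t = (\<Sum>i<j. indicator (T \<inter> A i) t :: real)" by simp
        moreover have "(\<Union>i<j. T \<inter> A i) = T \<inter> (\<Union>i<j. A i)" by blast
        ultimately show ?thesis by (simp only:)
      qed
      have lim: "(\<lambda>j. \<integral>t. (indicator (T \<inter> (\<Union>i. A i)) t - indicator (T \<inter> (\<Union>i<j. A i)) t :: real)\<^sup>2 \<partial>leb_on T)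
          \<longlonglongrightarrow> (\<integral>t. 0 \<partial>leb_on T)"
      proof (rule integral_dominated_convergence[where w="\<lambda>_. 1"])
        have "(\<lambda>j. (indicator (T \<inter> (\<Union>i. A i)) t - indicator (T \<inter> (\<Union>i<j. A i)) t :: real)\<^sup>2) \<longlonglongrightarrow> 0" for t
        proof (rule tendsto_eventually)
          show "\<forall>\<^sub>F j in sequentially.
              (indicator (T \<inter> (\<Union>i. A i)) t - indicator (T \<inter> (\<Union>i<j. A i)) t :: real)\<^sup>2 = 0"
          proof (cases "t \<in> T \<and> (\<exists>i. t \<in> A i)")
            case True
            then obtain i where "t \<in> T" "t \<in> A i" by blast
            then show ?thesis
              by (intro eventually_sequentiallyI[of "Suc i"]) (auto simp: indicator_def)
          qed (auto simp: indicator_def)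
        qed
        then show "AE t in leb_on T. (\<lambda>j. (indicator (T \<inter> (\<Union>i. A i)) t - indicator (T \<inter> (\<Union>i<j. A i)) t :: real)\<^sup>2) \<longlonglongrightarrow> 0"
          by simp
        show "AE t in leb_on T. norm ((indicator (T \<inter> (\<Union>i. A i)) t - indicator (T \<inter> (\<Union>i<j. A i)) t :: real)\<^sup>2) \<le> 1" for j
          by (auto simp: indicator_def)
      qed (auto intro!: measurable_leb_onI)
      then show "(\<lambda>j. L2_inner T (\<lambda>t. indicator (T \<inter> (\<Union>i. A i)) t - (\<Sum>i<j. indicator (T \<inter> A i) t))
          (\<lambda>t. indicator (T \<inter> (\<Union>i. A i)) t - (\<Sum>i<j. indicator (T \<inter> A i) t))) \<longlonglongrightarrow> 0"
        by (simp add: L2_inner_def sum_eq power2_eq_square)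
    qed
  qed
qed

lemma resolved_cong:
  assumes eq: "\<And>t. t \<in> T \<Longrightarrow> f' t = f t" and f: "resolved f'"
  shows "resolved f"
proof -
  have inner: "L2_inner T f' g = L2_inner T f g" for g
    unfolding L2_inner_def by (intro Bochner_Integration.integral_cong) (auto simp: space_leb_on eq)
  have "L2_inner T f' f' = L2_inner T f f"
    using inner[of f'] inner[of f] by (simp add: L2_inner_commute[of T f f'])
  then have "dyadic_defect T m f' = dyadic_defect T m f" for m
    by (simp add: dyadic_defect_def dyadic_form_def inner)
  moreover have "f' \<in> borel_measurable (leb_on T) \<longleftrightarrow> f \<in> borel_measurable (leb_on T)"
    by (intro measurable_cong) (simp add: space_leb_on eq)
  moreover have "integrable (leb_on T) (\<lambda>t. (f' t)\<^sup>2) \<longleftrightarrow> integrable (leb_on T) (\<lambda>t. (f t)\<^sup>2)"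
    by (intro Bochner_Integration.integrable_cong) (simp_all add: space_leb_on eq)
  ultimately show ?thesis
    using f by (simp add: resolved_def L2_def)
qed

lemma resolved_simple:
  fixes s :: "real \<Rightarrow> real"
  assumes s: "simple_function (leb_on T) s"
  shows "resolved s"
proof -
  have fin: "finite (s ` T)"
    using simple_functionD(1)[OF s] by (simp add: space_leb_on)
  have pre: "s -` {y} \<inter> T \<in> sets (leb_on T)" for y
    using simple_functionD(2)[OF s, of "{y}"] by (simp add: space_leb_on)
  have "resolved (\<lambda>t. \<Sum>y\<in>s ` T. y * indicator (T \<inter> (s -` {y} \<inter> T)) t)"
    using pre by (intro resolved_sum fin resolved_scale resolved_indicator) (simp add: sets_restrict_space_iff)
  moreover have eq: "(\<Sum>y\<in>s ` T. y * indicator (T \<inter> (s -` {y} \<inter> T)) t) = s t" if "t \<in> T" for t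
  proof -
    have "(\<Sum>y\<in>s ` T. y * indicator (T \<inter> (s -` {y} \<inter> T)) t) = (\<Sum>y\<in>s ` T. if y = s t then y else 0)"
      using that by (intro sum.cong) (auto simp: indicator_def)
    also have "\<dots> = s t" using that fin by simp
    finally show ?thesis .
  qed
  ultimately show ?thesis
    by (rule resolved_cong[rotated])
qed

lemma resolved_L2:
  assumes f: "f \<in> L2 T"
  shows "resolved f"
proof -
  have fm: "f \<in> borel_measurable (leb_on T)" using f by (simp add: L2_def)
  from borel_measurable_implies_sequence_metric[OF fm, of 0]
  obtain F where F: "\<And>i. simple_function (leb_on T) (F i)"
    and lim: "\<And>t. t \<in> T \<Longrightarrow> (\<lambda>i. F i t) \<longlonglongrightarrow> f t"
    and dom: "\<And>i t. t \<in> T \<Longrightarrow> \<bar>F i t\<bar> \<le> 2 * \<bar>f t\<bar>"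
    unfolding space_leb_on dist_real_def diff_0_right by blast
  have Fm: "F i \<in> borel_measurable (leb_on T)" for i
    using F by (rule borel_measurable_simple_function)
  show ?thesis
  proof (rule resolved_limit[OF resolved_simple[OF F] f])
    have "(\<lambda>i. \<integral>t. (f t - F i t)\<^sup>2 \<partial>leb_on T) \<longlonglongrightarrow> (\<integral>t. 0 \<partial>leb_on T)"
    proof (rule integral_dominated_convergence[where w="\<lambda>t. 9 * (f t)\<^sup>2"])
      show "AE t in leb_on T. (\<lambda>i. (f t - F i t)\<^sup>2) \<longlonglongrightarrow> 0"
      proof (rule AE_I2)
        fix t assume "t \<in> space (leb_on T)"
        then have "(\<lambda>i. (f t - F i t)\<^sup>2) \<longlonglongrightarrow> (f t - f t)\<^sup>2"
          by (intro tendsto_intros lim) (simp add: space_leb_on)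
        then show "(\<lambda>i. (f t - F i t)\<^sup>2) \<longlonglongrightarrow> 0" by simp
      qed
      show "AE t in leb_on T. norm ((f t - F i t)\<^sup>2) \<le> 9 * (f t)\<^sup>2" for i
      proof (rule AE_I2)
        fix t assume "t \<in> space (leb_on T)"
        then have "\<bar>f t - F i t\<bar> \<le> 3 * \<bar>f t\<bar>"
          using dom[of t i] by (simp add: space_leb_on)
        then have "(f t - F i t)\<^sup>2 \<le> (3 * \<bar>f t\<bar>)\<^sup>2"
          by (intro abs_le_square_iff[THEN iffD1]) simp
        then show "norm ((f t - F i t)\<^sup>2) \<le> 9 * (f t)\<^sup>2" by (simp add: power_mult_distrib)
      qed
    qed (use fm Fm L2_integrable_square[OF f] in auto)
    then show "(\<lambda>i. L2_inner T (\<lambda>t. f t - F i t) (\<lambda>t. f t - F i t)) \<longlonglongrightarrow> 0"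
      by (simp add: L2_inner_def power2_eq_square)
  qed
qed

lemma dyadic_form_tendsto:
  assumes f: "f \<in> L2 T" and g: "g \<in> L2 T"
  shows "(\<lambda>m. dyadic_form T m f g) \<longlonglongrightarrow> L2_inner T f g"
proof -
  have "(\<lambda>m. dyadic_defect T m f * dyadic_defect T m g) \<longlonglongrightarrow> 0 * 0"
    using resolved_L2[OF f] resolved_L2[OF g] unfolding resolved_def by (intro tendsto_mult) auto
  then have "(\<lambda>m. (L2_inner T f g - dyadic_form T m f g)\<^sup>2) \<longlonglongrightarrow> 0"
    by (intro tendsto_zero_squeeze[OF _ dyadic_form_error[OF f g]]) simp_all
  then have "(\<lambda>m. L2_inner T f g - dyadic_form T m f g) \<longlonglongrightarrow> 0"
    by simp
  then have "(\<lambda>m. L2_inner T f g - (L2_inner T f g - dyadic_form T m f g)) \<longlonglongrightarrow> L2_inner T f g - 0"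
    by (intro tendsto_intros)
  then show ?thesis by simp
qed

end

section \<open>Averages of independent observations\<close>

definition sample_mean :: "nat \<Rightarrow> (nat \<Rightarrow> real) \<Rightarrow> real" where
  "sample_mean n g = (1 / real n) * (\<Sum>i=1..n. g i)"

lemma sample_mean_add: "sample_mean n (\<lambda>i. g i + h i) = sample_mean n g + sample_mean n h"
  by (simp add: sample_mean_def sum.distrib add_divide_distrib)

lemma sample_mean_diff: "sample_mean n (\<lambda>i. g i - h i) = sample_mean n g - sample_mean n h"
  by (simp add: sample_mean_def sum_subtractf diff_divide_distrib)

lemma sample_mean_mult_left: "sample_mean n (\<lambda>i. a * g i) = a * sample_mean n g"
  by (simp add: sample_mean_def sum_distrib_left)

lemma sample_mean_sum: "sample_mean n (\<lambda>i. \<Sum>j\<in>J. g j i) = (\<Sum>j\<in>J. sample_mean n (g j))"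
  unfolding sample_mean_def sum_distrib_left by (rule sum.swap)

lemma sample_mean_nonneg: "(\<And>i. 0 \<le> g i) \<Longrightarrow> 0 \<le> sample_mean n g"
  by (simp add: sample_mean_def sum_nonneg)

lemma sample_mean_tendsto:
  assumes "\<And>i. i \<in> {1..n} \<Longrightarrow> (\<lambda>m. g m i) \<longlonglongrightarrow> h i"
  shows "(\<lambda>m. sample_mean n (g m)) \<longlonglongrightarrow> sample_mean n h"
  unfolding sample_mean_def by (intro tendsto_intros assms)

lemma (in prob_space) integrable_of_square:
  fixes f :: "'a \<Rightarrow> real"
  assumes "f \<in> borel_measurable M" "integrable M (\<lambda>x. (f x)\<^sup>2)"
  shows "integrable M f"
  using integrable_mult_of_squares[OF assms(1) _ assms(2), of "\<lambda>_. 1"] by simp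

text \<open>The mixed terms of the squared sum of centred summands vanish by independence, and the variance of a
summand is at most its second moment.\<close>

lemma (in prob_space) sample_mean_square_deviation:
  fixes W :: "nat \<Rightarrow> 'a \<Rightarrow> 'c" and \<phi> :: "'c \<Rightarrow> real"
  assumes n: "1 \<le> n"
    and indep: "indep_vars (\<lambda>_. N) W {1..n}"
    and law: "\<And>i. i \<in> {1..n} \<Longrightarrow> distr M N (W i) = R"
    and \<phi> [measurable]: "\<phi> \<in> borel_measurable N"
    and sq: "integrable R (\<lambda>w. (\<phi> w)\<^sup>2)"
  shows "(\<integral>\<^sup>+x. ennreal ((sample_mean n (\<lambda>i. \<phi> (W i x)) - (\<integral>w. \<phi> w \<partial>R))\<^sup>2) \<partial>M)
    \<le> ennreal ((\<integral>w. (\<phi> w)\<^sup>2 \<partial>R) / real n)"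
proof -
  define \<mu> where "\<mu> = (\<integral>w. \<phi> w \<partial>R)"
  define s where "s = (\<integral>w. (\<phi> w)\<^sup>2 \<partial>R)"
  define \<xi> where "\<xi> i x = \<phi> (W i x) - \<mu>" for i x
  have W [measurable]: "i \<in> {1..n} \<Longrightarrow> W i \<in> measurable M N" for i
    using indep by (auto simp: indep_vars_def2)
  have \<phi>W: "integrable M (\<lambda>x. (\<phi> (W i x))\<^sup>2)" "(\<integral>x. (\<phi> (W i x))\<^sup>2 \<partial>M) = s"
    "(\<integral>x. \<phi> (W i x) \<partial>M) = \<mu>" if i: "i \<in> {1..n}" for i
  proof -
    show "integrable M (\<lambda>x. (\<phi> (W i x))\<^sup>2)"
      using sq unfolding law[OF i, symmetric] using W[OF i] by (subst (asm) integrable_distr_eq) auto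
    show "(\<integral>x. (\<phi> (W i x))\<^sup>2 \<partial>M) = s"
      unfolding s_def law[OF i, symmetric] using W[OF i] by (subst integral_distr) auto
    show "(\<integral>x. \<phi> (W i x) \<partial>M) = \<mu>"
      unfolding \<mu>_def law[OF i, symmetric] using W[OF i] by (subst integral_distr) auto
  qed
  have \<phi>W_int: "integrable M (\<lambda>x. \<phi> (W i x))" if i: "i \<in> {1..n}" for i
    by (rule integrable_of_square[OF _ \<phi>W(1)[OF i]]) (use W[OF i] in measurable)
  have \<xi>_meas: "\<xi> i \<in> borel_measurable M" if i: "i \<in> {1..n}" for i
    unfolding \<xi>_def using W[OF i] by measurable
  have \<xi>_sq: "integrable M (\<lambda>x. (\<xi> i x)\<^sup>2)" and \<xi>_sq_le: "(\<integral>x. (\<xi> i x)\<^sup>2 \<partial>M) \<le> s"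
    if i: "i \<in> {1..n}" for i
  proof -
    have eq: "(\<xi> i x)\<^sup>2 = (\<phi> (W i x))\<^sup>2 - 2 * \<mu> * \<phi> (W i x) + \<mu>\<^sup>2" for x
      by (simp add: \<xi>_def power2_diff algebra_simps)
    show "integrable M (\<lambda>x. (\<xi> i x)\<^sup>2)"
      unfolding eq using \<phi>W(1)[OF i] \<phi>W_int[OF i] by simp
    have "(\<integral>x. (\<xi> i x)\<^sup>2 \<partial>M) = s - 2 * \<mu> * \<mu> + \<mu>\<^sup>2"
      unfolding eq using \<phi>W(1)[OF i] \<phi>W_int[OF i] by (simp add: \<phi>W[OF i] prob_space)
    also have "\<dots> \<le> s" by (simp add: power2_eq_square)
    finally show "(\<integral>x. (\<xi> i x)\<^sup>2 \<partial>M) \<le> s" .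
  qed
  have \<xi>_prod: "integrable M (\<lambda>x. \<xi> i x * \<xi> j x)" if "i \<in> {1..n}" "j \<in> {1..n}" for i j
    using that by (intro integrable_mult_of_squares \<xi>_meas \<xi>_sq)
  have cross: "(\<integral>x. \<xi> i x * \<xi> j x \<partial>M) = 0" if ij: "i \<in> {1..n}" "j \<in> {1..n}" "i \<noteq> j" for i j
  proof -
    have "indep_vars (\<lambda>_. borel) (\<lambda>i x. \<phi> (W i x) - \<mu>) {i, j}"
      by (rule indep_vars_compose2[where Y="\<lambda>_ w. \<phi> w - \<mu>", OF indep_vars_subset[OF indep]])
         (use ij in auto)
    then have "indep_vars (\<lambda>_. borel) \<xi> {i, j}"
      by (simp add: \<xi>_def[abs_def])
    moreover have "integrable M (\<xi> k)" "(\<integral>x. \<xi> k x \<partial>M) = 0" if "k \<in> {i, j}" for k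
      using that ij \<phi>W_int[of k] \<phi>W(3)[of k] by (auto simp: \<xi>_def[abs_def] prob_space)
    ultimately have "(\<integral>x. (\<Prod>k\<in>{i, j}. \<xi> k x) \<partial>M) = (\<Prod>k\<in>{i, j}. \<integral>x. \<xi> k x \<partial>M)"
      by (intro indep_vars_lebesgue_integral) auto
    then show ?thesis
      using ij \<open>\<And>k. k \<in> {i, j} \<Longrightarrow> (\<integral>x. \<xi> k x \<partial>M) = 0\<close> by simp
  qed
  have dev: "sample_mean n (\<lambda>i. \<phi> (W i x)) - \<mu> = sample_mean n (\<lambda>i. \<xi> i x)" for x
    using n by (simp add: \<xi>_def sample_mean_def sum_subtractf diff_divide_distrib)
  have sq_eq: "(sample_mean n (\<lambda>i. \<xi> i x))\<^sup>2 = (\<Sum>i=1..n. \<Sum>j=1..n. \<xi> i x * \<xi> j x) / (real n)\<^sup>2" for x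
    by (simp add: sample_mean_def power_divide power2_eq_square sum_product)
  have int: "integrable M (\<lambda>x. (sample_mean n (\<lambda>i. \<xi> i x))\<^sup>2)"
    unfolding sq_eq by (intro integrable_divide Bochner_Integration.integrable_sum \<xi>_prod) auto
  have "(\<integral>x. (sample_mean n (\<lambda>i. \<xi> i x))\<^sup>2 \<partial>M) =
      (\<Sum>i=1..n. \<Sum>j=1..n. \<integral>x. \<xi> i x * \<xi> j x \<partial>M) / (real n)\<^sup>2"
  proof -
    have "(\<integral>x. (\<Sum>i=1..n. \<Sum>j=1..n. \<xi> i x * \<xi> j x) \<partial>M) =
        (\<Sum>i=1..n. \<integral>x. (\<Sum>j=1..n. \<xi> i x * \<xi> j x) \<partial>M)"
      by (intro Bochner_Integration.integral_sum Bochner_Integration.integrable_sum \<xi>_prod)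
    also have "\<dots> = (\<Sum>i=1..n. \<Sum>j=1..n. \<integral>x. \<xi> i x * \<xi> j x \<partial>M)"
      by (intro sum.cong refl Bochner_Integration.integral_sum \<xi>_prod)
    finally show ?thesis unfolding sq_eq by simp
  qed
  also have "(\<Sum>i=1..n. \<Sum>j=1..n. \<integral>x. \<xi> i x * \<xi> j x \<partial>M) =
      (\<Sum>i=1..n. \<Sum>j=1..n. if j = i then \<integral>x. (\<xi> i x)\<^sup>2 \<partial>M else 0)"
    by (intro sum.cong refl) (use cross in \<open>auto simp: power2_eq_square\<close>)
  also have "\<dots> = (\<Sum>i=1..n. \<integral>x. (\<xi> i x)\<^sup>2 \<partial>M)" by (intro sum.cong refl) simp
  also have "\<dots> / (real n)\<^sup>2 \<le> (\<Sum>i=1..n. s) / (real n)\<^sup>2"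
    by (intro divide_right_mono sum_mono \<xi>_sq_le) auto
  also have "\<dots> = s / real n" using n by (simp add: power2_eq_square)
  finally have "(\<integral>x. (sample_mean n (\<lambda>i. \<xi> i x))\<^sup>2 \<partial>M) \<le> s / real n" .
  then show ?thesis
    unfolding dev[unfolded \<mu>_def] s_def[symmetric]
    using int by (simp add: nn_integral_eq_integral ennreal_leI)
qed

text \<open>Each family \<open>\<phi> m\<close> consists of the coordinates of a vector, and the sum of squared deviations is the squared norm of
its deviation from the mean. Its expectation is at most \<open>b / n\<close> uniformly in \<open>m\<close>, hence so is that of
its lower limit by Fatou's lemma, and Markov's inequality applies to the lower limit. Off the
exceptional event the bound by \<open>t\<close> holds for infinitely many \<open>m\<close>, which is enough to pass to limits in \<open>m\<close>.\<close>

lemma (in prob_space) deviation_event: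
  fixes W :: "nat \<Rightarrow> 'a \<Rightarrow> 'c" and \<phi> :: "nat \<Rightarrow> 'j \<Rightarrow> 'c \<Rightarrow> real"
  assumes n: "1 \<le> n"
    and indep: "indep_vars (\<lambda>_. N) W {1..n}"
    and law: "\<And>i. i \<in> {1..n} \<Longrightarrow> distr M N (W i) = R"
    and J: "\<And>m. finite (J m)"
    and \<phi>: "\<And>m j. j \<in> J m \<Longrightarrow> \<phi> m j \<in> borel_measurable N"
    and sq: "\<And>m j. j \<in> J m \<Longrightarrow> integrable R (\<lambda>w. (\<phi> m j w)\<^sup>2)"
    and bound: "\<And>m. (\<Sum>j\<in>J m. \<integral>w. (\<phi> m j w)\<^sup>2 \<partial>R) \<le> b"
    and t: "0 < t"
  obtains A where "A \<in> events" "emeasure M A \<le> ennreal (b / (real n * t))"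
    "\<And>x. x \<in> space M - A \<Longrightarrow>
      \<exists>\<^sub>F m in sequentially. (\<Sum>j\<in>J m. (sample_mean n (\<lambda>i. \<phi> m j (W i x)) - (\<integral>w. \<phi> m j w \<partial>R))\<^sup>2) < t"
proof -
  define D where "D m x = (\<Sum>j\<in>J m. (sample_mean n (\<lambda>i. \<phi> m j (W i x)) - (\<integral>w. \<phi> m j w \<partial>R))\<^sup>2)" for m x
  have W: "i \<in> {1..n} \<Longrightarrow> W i \<in> measurable M N" for i
    using indep by (auto simp: indep_vars_def2)
  have dev_meas: "(\<lambda>x. (sample_mean n (\<lambda>i. \<phi> m j (W i x)) - (\<integral>w. \<phi> m j w \<partial>R))\<^sup>2) \<in> borel_measurable M"
    if j: "j \<in> J m" for m j
  proof -
    have "(\<lambda>x. \<phi> m j (W i x)) \<in> borel_measurable M" if "i \<in> {1..n}" for i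
      using measurable_compose[OF W[OF that] \<phi>[OF j]] .
    then have "(\<lambda>x. \<Sum>i=1..n. \<phi> m j (W i x)) \<in> borel_measurable M"
      by (intro borel_measurable_sum)
    then show ?thesis unfolding sample_mean_def by measurable
  qed
  have D_meas [measurable]: "D m \<in> borel_measurable M" for m
    unfolding D_def[abs_def] by (intro borel_measurable_sum dev_meas)
  have b: "0 \<le> b" using bound[of 0] sum_nonneg[of "J 0" "\<lambda>j. \<integral>w. (\<phi> 0 j w)\<^sup>2 \<partial>R"] by force
  have D_int: "(\<integral>\<^sup>+x. ennreal (D m x) \<partial>M) \<le> ennreal (b / real n)" for m
  proof -
    have "(\<integral>\<^sup>+x. ennreal (D m x) \<partial>M) = (\<integral>\<^sup>+x. (\<Sum>j\<in>J m.
        ennreal ((sample_mean n (\<lambda>i. \<phi> m j (W i x)) - (\<integral>w. \<phi> m j w \<partial>R))\<^sup>2)) \<partial>M)"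
      unfolding D_def by (simp add: sum_ennreal)
    also have "\<dots> = (\<Sum>j\<in>J m. \<integral>\<^sup>+x.
        ennreal ((sample_mean n (\<lambda>i. \<phi> m j (W i x)) - (\<integral>w. \<phi> m j w \<partial>R))\<^sup>2) \<partial>M)"
      using dev_meas by (intro nn_integral_sum) auto
    also have "\<dots> \<le> (\<Sum>j\<in>J m. ennreal ((\<integral>w. (\<phi> m j w)\<^sup>2 \<partial>R) / real n))"
      by (intro sum_mono sample_mean_square_deviation[OF n indep law] \<phi> sq) auto
    also have "\<dots> = ennreal ((\<Sum>j\<in>J m. \<integral>w. (\<phi> m j w)\<^sup>2 \<partial>R) / real n)"
      by (simp add: sum_ennreal sum_divide_distrib)
    also have "\<dots> \<le> ennreal (b / real n)"
      using bound by (intro ennreal_leI divide_right_mono) auto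
    finally show ?thesis .
  qed
  define V where "V x = liminf (\<lambda>m. ennreal (D m x))" for x
  have V_meas [measurable]: "V \<in> borel_measurable M" unfolding V_def by measurable
  have "(\<integral>\<^sup>+x. V x \<partial>M) \<le> liminf (\<lambda>m. \<integral>\<^sup>+x. ennreal (D m x) \<partial>M)"
    unfolding V_def by (intro nn_integral_liminf) measurable
  also have "\<dots> \<le> limsup (\<lambda>m. \<integral>\<^sup>+x. ennreal (D m x) \<partial>M)"
    by (intro Liminf_le_Limsup) simp
  also have "\<dots> \<le> ennreal (b / real n)"
    by (intro Limsup_bounded always_eventually allI D_int)
  finally have V_int: "(\<integral>\<^sup>+x. V x \<partial>M) \<le> ennreal (b / real n)" .
  define A where "A = {x \<in> space M. 1 \<le> ennreal (1 / t) * V x}"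
  show ?thesis
  proof (rule that)
    show "A \<in> events" unfolding A_def by measurable
    have "emeasure M A \<le> ennreal (1 / t) * (\<integral>\<^sup>+x. V x * indicator (space M) x \<partial>M)"
      unfolding A_def by (rule nn_integral_Markov_inequality) auto
    also have "(\<integral>\<^sup>+x. V x * indicator (space M) x \<partial>M) = (\<integral>\<^sup>+x. V x \<partial>M)"
      by (intro nn_integral_cong) simp
    also have "ennreal (1 / t) * \<dots> \<le> ennreal (1 / t) * ennreal (b / real n)"
      by (intro mult_left_mono V_int) simp
    also have "\<dots> = ennreal (b / (real n * t))"
      using t b by (simp add: ennreal_mult[symmetric] mult.commute)
    finally show "emeasure M A \<le> ennreal (b / (real n * t))" .
    fix x assume x: "x \<in> space M - A"
    have "\<exists>\<^sub>F m in sequentially. D m x < t"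
    proof (rule ccontr)
      assume "\<not> (\<exists>\<^sub>F m in sequentially. D m x < t)"
      then have "\<forall>\<^sub>F m in sequentially. ennreal t \<le> ennreal (D m x)"
        by (simp add: not_frequently not_less eventually_mono ennreal_leI)
      then have "ennreal t \<le> V x" unfolding V_def by (rule Liminf_bounded)
      then have "ennreal (1 / t) * ennreal t \<le> ennreal (1 / t) * V x"
        by (intro mult_left_mono) auto
      moreover have "ennreal (1 / t) * ennreal t = 1"
        using t by (simp add: ennreal_mult[symmetric])
      ultimately show False using x by (simp add: A_def)
    qed
    then show "\<exists>\<^sub>F m in sequentially.
        (\<Sum>j\<in>J m. (sample_mean n (\<lambda>i. \<phi> m j (W i x)) - (\<integral>w. \<phi> m j w \<partial>R))\<^sup>2) < t"
      by (simp add: D_def)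
  qed
qed

section \<open>The smallest eigenvalue of a symmetric matrix\<close>

text \<open>The unit sphere of \<open>\<real>\<^sup>p\<close>, embedded in sequences by padding with zeros, lies in a product of compact
intervals. This makes compactness available although the dimension is a number and not a type.\<close>

lemma compact_coordinate_sphere:
  "compact {u :: nat \<Rightarrow> real. (\<forall>j\<ge>p. u j = 0) \<and> (\<Sum>j<p. (u j)\<^sup>2) = 1}" (is "compact ?S")
proof -
  let ?B = "\<lambda>j. if j < p then {-1..1} else {0::real}"
  have "compactin (product_topology (\<lambda>_. euclidean) UNIV) (PiE UNIV ?B)"
    by (subst compactin_PiE) auto
  then have box: "compact (PiE UNIV ?B)"
    by (simp add: euclidean_product_topology)
  have cont: "continuous_on UNIV (\<lambda>u :: nat \<Rightarrow> real. u j)" for j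
    by (rule continuous_on_product_coordinates)
  have "?S = (\<Inter>j\<in>{p..}. {u. u j = 0}) \<inter> {u. (\<Sum>j<p. (u j)\<^sup>2) = 1}" by auto
  also have "closed \<dots>"
    by (intro closed_Int closed_INT ballI closed_Collect_eq continuous_intros cont)
  finally have "closed ?S" .
  moreover have "?S \<subseteq> PiE UNIV ?B"
  proof
    fix u assume u: "u \<in> ?S"
    have "u j \<in> {-1..1}" if "j < p" for j
    proof -
      have "(u j)\<^sup>2 \<le> (\<Sum>j<p. (u j)\<^sup>2)" using that by (intro member_le_sum) auto
      then have "\<bar>u j\<bar> \<le> 1" using u abs_le_square_iff[of "u j" 1] by simp
      then show ?thesis by auto
    qed
    then show "u \<in> PiE UNIV ?B" using u by auto
  qed
  ultimately show ?thesis using compact_Int_closed[OF box, of ?S] by (simp only: Int_absorb1)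
qed

text \<open>The quadratic form attains its minimum on the unit sphere at some \<open>w\<close>. The first variation vanishes there,
which says that \<open>w\<close> is an eigenvector whose eigenvalue is the minimum.\<close>

lemma lambda_min_le_quadratic_form:
  fixes A :: "real mat"
  assumes A: "A \<in> carrier_mat p p" and sym: "\<And>j k. j < p \<Longrightarrow> k < p \<Longrightarrow> A $$ (j, k) = A $$ (k, j)"
  shows "lambda_min A * (\<Sum>j<p. (u j)\<^sup>2) \<le> (\<Sum>j<p. \<Sum>k<p. A $$ (j, k) * u j * u k)"
proof (cases "(\<Sum>j<p. (u j)\<^sup>2) = 0")
  case True
  then have "u j = 0" if "j < p" for j
    using that by (simp add: sum_nonneg_eq_0_iff)
  then show ?thesis by simp
next
  case False
  define form where "form u v = (\<Sum>j<p. \<Sum>k<p. A $$ (j, k) * u j * v k)" for u v :: "nat \<Rightarrow> real"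
  define dot where "dot u v = (\<Sum>j<p. u j * v j)" for u v :: "nat \<Rightarrow> real"
  define S where "S = {u :: nat \<Rightarrow> real. (\<forall>j\<ge>p. u j = 0) \<and> (\<Sum>j<p. (u j)\<^sup>2) = 1}"
  have dot_sq: "dot v v = (\<Sum>j<p. (v j)\<^sup>2)" for v by (simp add: dot_def power2_eq_square)
  have dot_nonneg: "0 \<le> dot v v" for v by (simp add: dot_sq sum_nonneg)
  have form_scale: "form (\<lambda>j. a * v j) (\<lambda>j. a * w j) = a\<^sup>2 * form v w" for a v w
    by (simp add: form_def sum_distrib_left power2_eq_square mult_ac)
  define proj where "proj v j = (if j < p then v j / sqrt (dot v v) else 0)" for v :: "nat \<Rightarrow> real" and j
  have proj_S: "proj v \<in> S" if "dot v v \<noteq> 0" for v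
  proof -
    have "(\<Sum>j<p. (proj v j)\<^sup>2) = (\<Sum>j<p. (v j)\<^sup>2 / dot v v)"
      using dot_nonneg[of v] by (intro sum.cong) (auto simp: proj_def power_divide)
    also have "\<dots> = 1" using that by (simp add: sum_divide_distrib[symmetric] dot_sq)
    finally show ?thesis by (simp add: S_def proj_def)
  qed
  have form_proj: "form (proj v) (proj v) * dot v v = form v v" if "dot v v \<noteq> 0" for v
  proof -
    have "form (proj v) (proj v) = form (\<lambda>j. (1 / sqrt (dot v v)) * v j) (\<lambda>j. (1 / sqrt (dot v v)) * v j)"
      unfolding form_def by (intro sum.cong) (auto simp: proj_def)
    then show ?thesis
      unfolding form_scale using that dot_nonneg[of v] by (simp add: power_divide)
  qed
  have "S \<noteq> {}" using proj_S[of u] False by (auto simp: dot_sq)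
  moreover have "continuous_on S (\<lambda>u. form u u)"
    unfolding form_def
    by (intro continuous_intros continuous_on_subset[OF continuous_on_product_coordinates subset_UNIV])
  ultimately obtain w where w: "w \<in> S" and min: "\<And>v. v \<in> S \<Longrightarrow> form w w \<le> form v v"
    using continuous_attains_inf[of S "\<lambda>u. form u u"] compact_coordinate_sphere[of p]
    unfolding S_def[symmetric] by blast
  have w1: "dot w w = 1" using w by (simp add: S_def dot_sq)
  have ge: "form w w * dot v v \<le> form v v" for v
  proof (cases "dot v v = 0")
    case True
    then have "v j = 0" if "j < p" for j
      using that by (simp add: sum_nonneg_eq_0_iff dot_sq)
    then show ?thesis by (simp add: form_def dot_def)
  next
    case False
    then show ?thesis
      using mult_right_mono[OF min[OF proj_S[OF False]] dot_nonneg[of v]] by (simp add: form_proj)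
  qed
  have form_comm: "form v y = form y v" for v y
    unfolding form_def by (subst sum.swap) (intro sum.cong refl, simp add: sym mult_ac)
  \<comment> \<open>Along \<open>w + t y\<close> the nonnegative difference in \<open>ge\<close> is a quadratic polynomial in \<open>t\<close> without constant
    term, so its linear coefficient vanishes.\<close>
  have critical: "form w y = form w w * dot w y" for y
  proof -
    have "0 \<le> 0 + 2 * t * (form w y - form w w * dot w y) + t\<^sup>2 * (form y y - form w w * dot y y)" for t
    proof -
      have "form (\<lambda>j. w j + t * y j) (\<lambda>j. w j + t * y j) = form w w + t * form w y + t * form y w + t\<^sup>2 * form y y"
        unfolding form_def sum_distrib_left sum.distrib[symmetric]
        by (intro sum.cong refl) (simp add: algebra_simps power2_eq_square)
      moreover have "dot (\<lambda>j. w j + t * y j) (\<lambda>j. w j + t * y j) = dot w w + 2 * t * dot w y + t\<^sup>2 * dot y y"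
        unfolding dot_def sum_distrib_left sum.distrib[symmetric]
        by (intro sum.cong refl) (simp add: algebra_simps power2_eq_square)
      ultimately show ?thesis
        using ge[of "\<lambda>j. w j + t * y j"] by (simp add: w1 form_comm[of y w] algebra_simps)
    qed
    from quadratic_nonneg_discriminant[OF this] ge[of y] show ?thesis by simp
  qed
  have "A *\<^sub>v vec p w = form w w \<cdot>\<^sub>v vec p w"
  proof (rule eq_vecI)
    fix j assume "j < dim_vec (form w w \<cdot>\<^sub>v vec p w)"
    then have j: "j < p" by simp
    let ?e = "\<lambda>k. if k = j then 1 else 0 :: real"
    have "(A *\<^sub>v vec p w) $ j = (\<Sum>k<p. A $$ (j, k) * w k)"
      using A j by (simp add: scalar_prod_def atLeast0LessThan)
    also have "\<dots> = form ?e w"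
    proof -
      have "form ?e w = (\<Sum>i<p. if i = j then \<Sum>k<p. A $$ (j, k) * w k else 0)"
        unfolding form_def by (intro sum.cong) auto
      then show ?thesis using j by simp
    qed
    also have "\<dots> = form w w * dot w ?e" using critical[of ?e] form_comm[of ?e w] by simp
    also have "dot w ?e = w j" using j by (simp add: dot_def if_distrib[of "(*) _"] cong: if_cong)
    finally show "(A *\<^sub>v vec p w) $ j = (form w w \<cdot>\<^sub>v vec p w) $ j" using j by simp
  qed (use A in simp)
  moreover have "vec p w \<noteq> 0\<^sub>v p"
  proof
    assume "vec p w = 0\<^sub>v p"
    then have "w j = 0" if "j < p" for j using that by (metis index_vec index_zero_vec(1))
    then show False using w1 by (simp add: dot_def)
  qed
  ultimately have "form w w \<in> spectrum A"
    using A by (auto simp: spectrum_def eigenvalue_def eigenvector_def intro!: exI[of _ "vec p w"])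
  then have "lambda_min A \<le> form w w"
    unfolding lambda_min_def using card_finite_spectrum(1)[OF A] by (intro Min_le)
  then have "lambda_min A * dot u u \<le> form w w * dot u u"
    by (intro mult_right_mono dot_nonneg)
  also have "\<dots> \<le> form u u" by (rule ge)
  finally show ?thesis by (simp add: dot_sq form_def)
qed

section \<open>The deterministic error bound\<close>

text \<open>Here \<open>a\<close> and \<open>b\<close> are the norms of the errors in the two directions, \<open>Q\<close> and \<open>Qn\<close> the population and
  sample quadratic forms, \<open>F\<close> bounds the norm of the true parameter, \<open>NX\<close> and \<open>NY\<close> are noise levels, and
  \<open>RX\<close>, \<open>RXY\<close>, \<open>RY\<close> bound the differences between sample and population covariances. All terms with \<open>a\<^sup>2\<close> together
  are absorbed by half of \<open>Q\<close>. The remaining multiple \<open>G b\<^sup>2\<close> is estimated by means of the basic inequality once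
  more, which controls \<open>l b\<^sup>2\<close>. This is where the amplification factor \<open>L\<close> comes from.\<close>

lemma ridge_error_bound:
  fixes Q Qn a b l F NX NY RX RXY RY m :: real
  assumes pos: "0 < l" "0 < m" "0 \<le> Qn"  "0 \<le> RY"
    and basic: "Qn + l * b\<^sup>2 \<le> 2 * l * F * b + 2 * NX * a + 2 * NY * b"
    and coercive: "m * a\<^sup>2 \<le> Q"
    and compare: "Q \<le> Qn + RX * a\<^sup>2 + 2 * RXY * a * b + RY * b\<^sup>2"
    and RX: "RX \<le> m / 4"
    and G: "G = 8 * RXY\<^sup>2 / m + RY" and A: "A = 2 * (l * F + NY)\<^sup>2 / l" and L: "L = 1 + 2 * G / l"
  shows "Q \<le> 2 * L * A + 16 * L\<^sup>2 * NX\<^sup>2 / m"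
proof -
  have young: "2 * x * y \<le> c * y\<^sup>2 + x\<^sup>2 / c" if "0 < c" for x y c :: real
  proof -
    have "0 \<le> (c * y - x)\<^sup>2 / c" using that by simp
    also have "\<dots> = c * y\<^sup>2 + x\<^sup>2 / c - 2 * x * y"
      using that by (simp add: power2_eq_square field_simps)
    finally show ?thesis by simp
  qed
  have G0: "0 \<le> G" using pos by (simp add: G)
  have L1: "1 \<le> L" using pos G0 by (simp add: L)
  have "2 * (l * F + NY) * b \<le> l / 2 * b\<^sup>2 + A"
    using young[of "l / 2" "l * F + NY" b] pos by (simp add: A mult.commute)
  then have penalized: "Qn + l / 2 * b\<^sup>2 \<le> A + 2 * NX * a"
    using basic by (simp add: algebra_simps)
  have nonneg: "0 \<le> l / 2 * b\<^sup>2" using pos by simp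
  have b: "b\<^sup>2 \<le> 2 / l * (A + 2 * NX * a)"
    using penalized pos by (simp add: field_simps)
  have "2 * RXY * a * b \<le> m / 8 * a\<^sup>2 + 8 * RXY\<^sup>2 / m * b\<^sup>2"
    using young[of "m / 8" "RXY * b" a] pos by (simp add: power_mult_distrib mult_ac)
  moreover have "RX * a\<^sup>2 \<le> m / 4 * a\<^sup>2" by (intro mult_right_mono RX) simp
  ultimately have "Q \<le> Qn + (m / 4 * a\<^sup>2 + m / 8 * a\<^sup>2) + G * b\<^sup>2"
    using compare by (simp add: G distrib_right)
  also have "\<dots> \<le> (A + 2 * NX * a) + (m / 4 * a\<^sup>2 + m / 8 * a\<^sup>2) + G * (2 / l * (A + 2 * NX * a))"
    using penalized nonneg mult_left_mono[OF b G0] by linarith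
  also have "\<dots> = L * A + 2 * (L * NX) * a + 3 / 8 * (m * a\<^sup>2)"
    by (simp add: L algebra_simps)
  also have "2 * (L * NX) * a \<le> m / 8 * a\<^sup>2 + 8 * L\<^sup>2 * NX\<^sup>2 / m"
    using young[of "m / 8" "L * NX" a] pos by (simp add: power_mult_distrib mult_ac)
  also have "L * A + (m / 8 * a\<^sup>2 + 8 * L\<^sup>2 * NX\<^sup>2 / m) + 3 / 8 * (m * a\<^sup>2) =
      L * A + 8 * L\<^sup>2 * NX\<^sup>2 / m + (m * a\<^sup>2) / 2" by simp
  also have "\<dots> \<le> L * A + 8 * L\<^sup>2 * NX\<^sup>2 / m + Q / 2"
    using coercive by simp
  finally show ?thesis by simp
qed

section \<open>Moments in the population\<close>

locale pfl_population = prob_space P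
  for P :: "'a measure" +
  fixes T :: "real set" and p :: nat and X :: "'a \<Rightarrow> nat \<Rightarrow> real" and Y :: "'a \<Rightarrow> real \<Rightarrow> real"
    and \<epsilon> Z :: "'a \<Rightarrow> real" and \<alpha>0 :: "nat \<Rightarrow> real" and \<beta>0 :: "real \<Rightarrow> real"
    and M1 v M2 \<sigma> :: real
  assumes T_compact: "compact T"
    and \<beta>0: "\<beta>0 \<in> L2 T"
    and X_rv: "X \<in> P \<rightarrow>\<^sub>M vec_borel p"
    and Y_rv: "Y \<in> P \<rightarrow>\<^sub>M L2_borel T"
    and \<epsilon>_rv: "\<epsilon> \<in> borel_measurable P"
    and XY_indep: "indep_set (sets (generated_sigma P (vec_borel p) X))
        (sets (generated_sigma P (L2_borel T) Y))"
    and X_mean: "\<And>j. j < p \<Longrightarrow> (\<integral>x. X x j \<partial>P) = 0"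
    and model: "\<And>x. x \<in> space P \<Longrightarrow> Z x = (\<Sum>j<p. X x j * \<alpha>0 j) + L2_inner T (Y x) \<beta>0 + \<epsilon> x"
    and subgauss: "\<And>j. j < p \<Longrightarrow> subgauss_norm P (\<lambda>x. X x j) \<le> ennreal M1"
    and X_moment: "\<And>j. j < p \<Longrightarrow> (\<integral>x. \<bar>X x j\<bar>\<^sup>2 \<partial>P) \<le> v\<^sup>2"
    and Y_bound: "AE x in P. L2_norm T (Y x) \<le> M2"
    and \<epsilon>_mean: "AE x in P. real_cond_exp P
        (generated_sigma P (vec_borel p \<Otimes>\<^sub>M L2_borel T) (\<lambda>x. (X x, Y x))) \<epsilon> x = 0"
    and \<epsilon>_var: "AE x in P. nn_cond_exp P
        (generated_sigma P (vec_borel p \<Otimes>\<^sub>M L2_borel T) (\<lambda>x. (X x, Y x)))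
        (\<lambda>x. ennreal ((\<epsilon> x)\<^sup>2)) x < ennreal (\<sigma>\<^sup>2)"
begin

lemma X_component [measurable]: "j < p \<Longrightarrow> (\<lambda>x. X x j) \<in> borel_measurable P"
  using measurable_compose[OF X_rv measurable_component_singleton] by simp

lemma Y_L2: "x \<in> space P \<Longrightarrow> Y x \<in> L2 T"
  using measurable_space[OF Y_rv] by simp

lemma Y_functional [measurable]: "g \<in> L2 T \<Longrightarrow> (\<lambda>x. L2_inner T (Y x) g) \<in> borel_measurable P"
  by (rule measurable_compose[OF Y_rv L2_inner_borel_measurable])

text \<open>The term \<open>k = 2\<close> of the sub-Gaussian norm, since \<open>3!! = 3\<close>.\<close>

lemma X_fourth_moment:
  assumes j: "j < p"
  shows "integrable P (\<lambda>x. X x j ^ 4)" and "(\<integral>x. X x j ^ 4 \<partial>P) \<le> 3 * M1 ^ 4"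
proof -
  let ?r = "root 4 ((\<integral>x. X x j ^ 4 \<partial>P) / 3)"
  have "(if integrable P (\<lambda>x. X x j ^ (2 * 2))
       then ennreal (root (2 * 2) ((\<integral>x. X x j ^ (2 * 2) \<partial>P) / (\<Prod>i<2. real (2 * i + 1))))
       else \<infinity>) \<le> subgauss_norm P (\<lambda>x. X x j)"
    unfolding subgauss_norm_def by (rule SUP_upper) simp
  also have "\<dots> \<le> ennreal M1" by (rule subgauss[OF j])
  also have "(\<Prod>i<2. real (2 * i + 1)) = 3" by (simp add: numeral_2_eq_2)
  also have "2 * 2 = (4 :: nat)" by simp
  finally have le: "(if integrable P (\<lambda>x. X x j ^ 4) then ennreal ?r else \<infinity>) \<le> ennreal M1" .
  then show int: "integrable P (\<lambda>x. X x j ^ 4)"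
    by (auto split: if_splits simp: top_unique)
  have nonneg: "0 \<le> (\<integral>x. X x j ^ 4 \<partial>P) / 3" by (simp add: zero_le_even_power)
  then have r: "?r ^ 4 = (\<integral>x. X x j ^ 4 \<partial>P) / 3" "0 \<le> ?r" by simp_all
  \<comment> \<open>The hypothesis bounds the norm by the truncation of \<open>M1\<close> at zero, so a negative \<open>M1\<close> acts as zero.\<close>
  have "?r \<le> max M1 0"
  proof -
    have "ennreal ?r \<le> ennreal M1" using le int by simp
    also have "ennreal M1 \<le> ennreal (max M1 0)" by (intro ennreal_leI) simp
    finally show ?thesis by (simp only: ennreal_le_iff[OF max.cobounded2])
  qed
  then have "?r ^ 4 \<le> (max M1 0) ^ 4" using r(2) by (intro power_mono)
  also have "\<dots> \<le> M1 ^ 4" by (simp add: max_def zero_le_even_power)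
  finally show "(\<integral>x. X x j ^ 4 \<partial>P) \<le> 3 * M1 ^ 4" using r(1) by simp
qed

lemma X_products:
  assumes j: "j < p" and k: "k < p"
  shows "integrable P (\<lambda>x. (X x j * X x k)\<^sup>2)" and "(\<integral>x. (X x j * X x k)\<^sup>2 \<partial>P) \<le> 3 * M1 ^ 4"
proof -
  have sq: "(a * b)\<^sup>2 \<le> a ^ 4 / 2 + b ^ 4 / 2" for a b :: real
    using sum_squares_bound[of "a\<^sup>2" "b\<^sup>2"] by (simp add: power_mult_distrib)
  have int: "integrable P (\<lambda>x. X x j ^ 4 / 2 + X x k ^ 4 / 2)"
    using X_fourth_moment(1) j k by simp
  show int2: "integrable P (\<lambda>x. (X x j * X x k)\<^sup>2)"
    by (rule Bochner_Integration.integrable_bound[OF int])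
       (use j k sq in \<open>auto simp: abs_of_nonneg zero_le_even_power\<close>)
  have "(\<integral>x. (X x j * X x k)\<^sup>2 \<partial>P) \<le> (\<integral>x. X x j ^ 4 / 2 + X x k ^ 4 / 2 \<partial>P)"
    by (intro integral_mono int int2 sq)
  also have "\<dots> = (\<integral>x. X x j ^ 4 \<partial>P) / 2 + (\<integral>x. X x k ^ 4 \<partial>P) / 2"
    using X_fourth_moment(1) j k by simp
  also have "\<dots> \<le> 3 * M1 ^ 4" using X_fourth_moment(2)[OF j] X_fourth_moment(2)[OF k] by simp
  finally show "(\<integral>x. (X x j * X x k)\<^sup>2 \<partial>P) \<le> 3 * M1 ^ 4" .
qed

lemma X_square: "j < p \<Longrightarrow> integrable P (\<lambda>x. (X x j)\<^sup>2)" "j < p \<Longrightarrow> (\<integral>x. (X x j)\<^sup>2 \<partial>P) \<le> v\<^sup>2"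
  using integrable_of_square[OF _ X_products(1), of j j] X_moment[of j]
  by (simp_all add: power2_eq_square)

lemma Y_functional_bound:
  "AE x in P. \<forall>g\<in>L2 T. (L2_inner T (Y x) g)\<^sup>2 \<le> M2\<^sup>2 * L2_inner T g g"
  using Y_bound AE_space
proof (eventually_elim, intro ballI)
  fix x g
  assume le: "L2_norm T (Y x) \<le> M2" and x: "x \<in> space P" and g: "g \<in> L2 T"
  have "(L2_inner T (Y x) g)\<^sup>2 \<le> (L2_norm T (Y x))\<^sup>2 * L2_inner T g g"
    using L2_inner_Cauchy_Schwarz[OF Y_L2[OF x] g] by (simp add: L2_norm_square)
  also have "\<dots> \<le> M2\<^sup>2 * L2_inner T g g"
    using le by (intro mult_right_mono power_mono L2_norm_nonneg L2_inner_self_nonneg)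
  finally show "(L2_inner T (Y x) g)\<^sup>2 \<le> M2\<^sup>2 * L2_inner T g g" .
qed

lemma Y_frame_bound:
  "AE x in P. (\<Sum>k\<in>dyadic_indices T m. (L2_inner T (Y x) (dyadic_step T m k))\<^sup>2) \<le> M2\<^sup>2"
  using Y_bound AE_space
proof eventually_elim
  fix x assume le: "L2_norm T (Y x) \<le> M2" and x: "x \<in> space P"
  have "(\<Sum>k\<in>dyadic_indices T m. (L2_inner T (Y x) (dyadic_step T m k))\<^sup>2) \<le> (L2_norm T (Y x))\<^sup>2"
    using dyadic_form_le[OF T_compact Y_L2[OF x], of m]
    by (simp add: dyadic_form_def power2_eq_square flip: L2_norm_square)
  also have "\<dots> \<le> M2\<^sup>2" using le by (intro power_mono L2_norm_nonneg)
  finally show "(\<Sum>k\<in>dyadic_indices T m. (L2_inner T (Y x) (dyadic_step T m k))\<^sup>2) \<le> M2\<^sup>2" .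
qed

lemma integrable_times_functional:
  assumes h [measurable]: "h \<in> borel_measurable P" and sq: "integrable P (\<lambda>x. (h x)\<^sup>2)" and g: "g \<in> L2 T"
  shows "integrable P (\<lambda>x. (h x * L2_inner T (Y x) g)\<^sup>2)"
proof (rule Bochner_Integration.integrable_bound)
  show "integrable P (\<lambda>x. (M2\<^sup>2 * L2_inner T g g) * (h x)\<^sup>2)" using sq by simp
  show "AE x in P. norm ((h x * L2_inner T (Y x) g)\<^sup>2) \<le> norm ((M2\<^sup>2 * L2_inner T g g) * (h x)\<^sup>2)"
    using Y_functional_bound
  proof eventually_elim
    case (elim x)
    then have "(h x)\<^sup>2 * (L2_inner T (Y x) g)\<^sup>2 \<le> (h x)\<^sup>2 * (M2\<^sup>2 * L2_inner T g g)"
      using g by (intro mult_left_mono) auto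
    then show ?case by (simp add: power_mult_distrib L2_inner_self_nonneg mult.commute)
  qed
qed (use g in measurable)

lemma functional_square_integrable:
  "g \<in> L2 T \<Longrightarrow> integrable P (\<lambda>x. (L2_inner T (Y x) g)\<^sup>2)"
  using integrable_times_functional[of "\<lambda>_. 1" g] by simp

text \<open>The bound does not depend on the level \<open>m\<close>, since the squared coordinates of \<open>Y\<close> add up to at most
\<open>M2\<^sup>2\<close> by Bessel's inequality. With \<open>h\<close> equal to \<open>1\<close>, the noise, a component of \<open>X\<close> or
another coordinate of \<open>Y\<close>, this yields all moment bounds in the functional direction.\<close>

lemma frame_second_moments:
  assumes h [measurable]: "h \<in> borel_measurable P" and sq: "integrable P (\<lambda>x. (h x)\<^sup>2)"
  shows "(\<Sum>k\<in>dyadic_indices T m. \<integral>x. (h x * L2_inner T (Y x) (dyadic_step T m k))\<^sup>2 \<partial>P)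
    \<le> M2\<^sup>2 * (\<integral>x. (h x)\<^sup>2 \<partial>P)"
proof -
  have int: "integrable P (\<lambda>x. (h x * L2_inner T (Y x) (dyadic_step T m k))\<^sup>2)" for k
    by (intro integrable_times_functional h sq L2_dyadic_step T_compact)
  have "(\<Sum>k\<in>dyadic_indices T m. \<integral>x. (h x * L2_inner T (Y x) (dyadic_step T m k))\<^sup>2 \<partial>P) =
      (\<integral>x. (\<Sum>k\<in>dyadic_indices T m. (h x * L2_inner T (Y x) (dyadic_step T m k))\<^sup>2) \<partial>P)"
    by (intro Bochner_Integration.integral_sum[symmetric] int)
  also have "\<dots> \<le> (\<integral>x. M2\<^sup>2 * (h x)\<^sup>2 \<partial>P)"
  proof (rule integral_mono_AE)
    show "AE x in P. (\<Sum>k\<in>dyadic_indices T m. (h x * L2_inner T (Y x) (dyadic_step T m k))\<^sup>2) \<le> M2\<^sup>2 * (h x)\<^sup>2"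
      using Y_frame_bound[of m]
    proof eventually_elim
      case (elim x)
      from mult_left_mono[OF this, of "(h x)\<^sup>2"] show ?case
        by (simp add: power_mult_distrib sum_distrib_left mult.commute)
    qed
  qed (use sq int in auto)
  also have "\<dots> = M2\<^sup>2 * (\<integral>x. (h x)\<^sup>2 \<partial>P)" by simp
  finally show ?thesis .
qed

abbreviation XY_sigma :: "'a measure" where
  "XY_sigma \<equiv> generated_sigma P (vec_borel p \<Otimes>\<^sub>M L2_borel T) (\<lambda>x. (X x, Y x))"

lemma generated_sigma_measurable:
  assumes "f \<in> P \<rightarrow>\<^sub>M N" shows "f \<in> generated_sigma P N f \<rightarrow>\<^sub>M N"
  unfolding generated_sigma_def
  using measurable_space[OF assms] by (intro measurable_vimage_algebra1) auto

lemma generated_sigma_subalgebra: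
  assumes "f \<in> P \<rightarrow>\<^sub>M N" shows "subalgebra P (generated_sigma P N f)"
proof -
  have "sigma_sets (space P) {f -` A \<inter> space P | A. A \<in> sets N} \<subseteq> sets P"
    using measurable_sets[OF assms] by (intro sets.sigma_sets_subset) auto
  then show ?thesis
    by (simp add: subalgebra_def generated_sigma_def sets_vimage_algebra)
qed

lemma XY_measurable: "(\<lambda>x. (X x, Y x)) \<in> P \<rightarrow>\<^sub>M vec_borel p \<Otimes>\<^sub>M L2_borel T"
  using X_rv Y_rv by measurable

sublocale XY: finite_measure_subalgebra P XY_sigma
  by unfold_locales (rule generated_sigma_subalgebra[OF XY_measurable])

lemma X_component_XY: "j < p \<Longrightarrow> (\<lambda>x. X x j) \<in> borel_measurable XY_sigma"
  using measurable_compose[OF measurable_compose[OF generated_sigma_measurable[OF XY_measurable] measurable_fst]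
      measurable_component_singleton[of j "{..<p}" "\<lambda>_. borel"]] by simp

lemma Y_functional_XY: "g \<in> L2 T \<Longrightarrow> (\<lambda>x. L2_inner T (Y x) g) \<in> borel_measurable XY_sigma"
  using measurable_compose[OF measurable_compose[OF generated_sigma_measurable[OF XY_measurable] measurable_snd]
      L2_inner_borel_measurable] by simp

text \<open>Conditioning on \<open>(X, Y)\<close> replaces the squared noise by its conditional variance, which is below \<open>\<sigma>\<^sup>2\<close>.\<close>

lemma noise_second_moment:
  assumes h: "h \<in> borel_measurable XY_sigma" and sq: "integrable P (\<lambda>x. (h x)\<^sup>2)"
  shows "integrable P (\<lambda>x. (\<epsilon> x * h x)\<^sup>2)" and "(\<integral>x. (\<epsilon> x * h x)\<^sup>2 \<partial>P) \<le> \<sigma>\<^sup>2 * (\<integral>x. (h x)\<^sup>2 \<partial>P)"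
proof -
  have hP [measurable]: "h \<in> borel_measurable P"
    using h generated_sigma_subalgebra[OF XY_measurable] by (rule measurable_from_subalg[rotated])
  note \<epsilon>_rv [measurable]
  have "(\<integral>\<^sup>+x. ennreal ((\<epsilon> x * h x)\<^sup>2) \<partial>P) = (\<integral>\<^sup>+x. ennreal ((h x)\<^sup>2) * ennreal ((\<epsilon> x)\<^sup>2) \<partial>P)"
    by (intro nn_integral_cong) (simp add: power_mult_distrib ennreal_mult[symmetric] mult.commute)
  also have "\<dots> = (\<integral>\<^sup>+x. ennreal ((h x)\<^sup>2) * nn_cond_exp P XY_sigma (\<lambda>x. ennreal ((\<epsilon> x)\<^sup>2)) x \<partial>P)"
    using h by (intro XY.nn_cond_exp_intg[symmetric]) auto
  also have "\<dots> \<le> (\<integral>\<^sup>+x. ennreal ((h x)\<^sup>2) * ennreal (\<sigma>\<^sup>2) \<partial>P)"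
    by (rule nn_integral_mono_AE) (use \<epsilon>_var in \<open>eventually_elim, auto intro: mult_left_mono less_imp_le\<close>)
  also have "\<dots> = ennreal (\<sigma>\<^sup>2 * (\<integral>x. (h x)\<^sup>2 \<partial>P))"
    using sq by (simp add: nn_integral_multc nn_integral_eq_integral ennreal_mult[symmetric] mult.commute)
  finally have le: "(\<integral>\<^sup>+x. ennreal ((\<epsilon> x * h x)\<^sup>2) \<partial>P) \<le> ennreal (\<sigma>\<^sup>2 * (\<integral>x. (h x)\<^sup>2 \<partial>P))" .
  then show int: "integrable P (\<lambda>x. (\<epsilon> x * h x)\<^sup>2)"
    by (intro integrableI_bounded) (auto simp: le_less_trans)
  show "(\<integral>x. (\<epsilon> x * h x)\<^sup>2 \<partial>P) \<le> \<sigma>\<^sup>2 * (\<integral>x. (h x)\<^sup>2 \<partial>P)"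
    using le int by (simp add: nn_integral_eq_integral)
qed

lemma noise_square_integrable: "integrable P (\<lambda>x. (\<epsilon> x)\<^sup>2)" and noise_variance: "(\<integral>x. (\<epsilon> x)\<^sup>2 \<partial>P) \<le> \<sigma>\<^sup>2"
  using noise_second_moment[of "\<lambda>_. 1"] by (simp_all add: prob_space)

lemma noise_orthogonal:
  assumes h: "h \<in> borel_measurable XY_sigma" and sq: "integrable P (\<lambda>x. (h x)\<^sup>2)"
  shows "integrable P (\<lambda>x. \<epsilon> x * h x)" and "(\<integral>x. \<epsilon> x * h x \<partial>P) = 0"
proof -
  have hP: "h \<in> borel_measurable P"
    using h generated_sigma_subalgebra[OF XY_measurable] by (rule measurable_from_subalg[rotated])
  show int: "integrable P (\<lambda>x. \<epsilon> x * h x)"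
    by (intro integrable_mult_of_squares \<epsilon>_rv hP sq noise_square_integrable)
  then have "integrable P (\<lambda>x. h x * \<epsilon> x)" by (simp add: mult.commute)
  from XY.real_cond_exp_intg(2)[OF this h \<epsilon>_rv]
  have "(\<integral>x. \<epsilon> x * h x \<partial>P) = (\<integral>x. h x * real_cond_exp P XY_sigma \<epsilon> x \<partial>P)"
    by (simp add: mult.commute)
  also have "\<dots> = (\<integral>x. 0 \<partial>P)"
  proof (rule integral_cong_AE)
    show "AE x in P. h x * real_cond_exp P XY_sigma \<epsilon> x = 0"
      using \<epsilon>_mean by eventually_elim simp
  qed (use hP in measurable)
  finally show "(\<integral>x. \<epsilon> x * h x \<partial>P) = 0" by simp
qed

text \<open>Independence factorizes the expectation, and one factor vanishes as \<open>X\<close> is centred.\<close>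

lemma covariates_uncorrelated:
  assumes j: "j < p" and g: "g \<in> L2 T"
  shows "integrable P (\<lambda>x. X x j * L2_inner T (Y x) g)" and "(\<integral>x. X x j * L2_inner T (Y x) g \<partial>P) = 0"
proof -
  let ?U = "\<lambda>x. L2_inner T (Y x) g"
  let ?FX = "generated_sigma P (vec_borel p) X" and ?FY = "generated_sigma P (L2_borel T) Y"
  have X: "(\<lambda>x. X x j) \<in> borel_measurable ?FX"
    using measurable_compose[OF generated_sigma_measurable[OF X_rv] measurable_component_singleton] j by simp
  have U: "?U \<in> borel_measurable ?FY"
    by (rule measurable_compose[OF generated_sigma_measurable[OF Y_rv] L2_inner_borel_measurable[OF g]])
  have sub: "sigma_sets (space P) {f -` A \<inter> space P | A. A \<in> sets borel} \<subseteq> sets (generated_sigma P N W)"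
    if "f \<in> borel_measurable (generated_sigma P N W)" for f :: "'a \<Rightarrow> real" and N :: "'c measure" and W
  proof -
    have sp: "space (generated_sigma P N W) = space P" by (simp add: generated_sigma_def)
    show ?thesis
      using measurable_sets[OF that] unfolding sp[symmetric]
      by (intro sets.sigma_sets_subset) (auto simp: sp)
  qed
  have ind: "indep_var borel (\<lambda>x. X x j) borel ?U"
    unfolding indep_var_eq
  proof (intro conjI X_component Y_functional j g)
    show "indep_set (sigma_sets (space P) {(\<lambda>x. X x j) -` A \<inter> space P |A. A \<in> sets borel})
        (sigma_sets (space P) {?U -` A \<inter> space P |A. A \<in> sets borel})"
      using XY_indep sub[OF X] sub[OF U] unfolding indep_sets2_eq by blast
  qed
  have intX: "integrable P (\<lambda>x. X x j)"
    by (rule integrable_of_square[OF X_component X_square(1)]) (use j in auto)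
  have intU: "integrable P ?U"
    by (rule integrable_of_square[OF Y_functional functional_square_integrable]) (use g in auto)
  show "integrable P (\<lambda>x. X x j * ?U x)"
    by (rule indep_var_integrable[OF ind intX intU])
  show "(\<integral>x. X x j * ?U x \<partial>P) = 0"
    using indep_var_lebesgue_integral[OF ind intX intU] X_mean[OF j] by simp
qed

text \<open>The difference of two prediction rules whose parameters differ by \<open>u\<close> and \<open>g\<close>, at the population covariates.\<close>

definition contrast :: "(nat \<Rightarrow> real) \<Rightarrow> (real \<Rightarrow> real) \<Rightarrow> 'a \<Rightarrow> real" where
  "contrast u g x = (\<Sum>j<p. X x j * u j) + L2_inner T (Y x) g"

lemma linear_form_measurable: "(\<lambda>x. \<Sum>j<p. X x j * u j) \<in> borel_measurable XY_sigma"
  by (intro borel_measurable_sum borel_measurable_times X_component_XY) auto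

lemma linear_form_square:
  shows "integrable P (\<lambda>x. (\<Sum>j<p. X x j * u j)\<^sup>2)"
    and "(\<integral>x. (\<Sum>j<p. X x j * u j)\<^sup>2 \<partial>P) =
      (\<Sum>j<p. \<Sum>k<p. (\<integral>x. X x j * X x k \<partial>P) * u j * u k)"
proof -
  have eq: "(\<Sum>j<p. X x j * u j)\<^sup>2 = (\<Sum>j<p. \<Sum>k<p. X x j * X x k * (u j * u k))" for x
    by (simp add: power2_eq_square sum_product mult_ac)
  have int: "integrable P (\<lambda>x. X x j * X x k)" if "j < p" "k < p" for j k
    by (rule integrable_of_square[OF _ X_products(1)]) (use that in auto)
  show "integrable P (\<lambda>x. (\<Sum>j<p. X x j * u j)\<^sup>2)"
    unfolding eq by (intro Bochner_Integration.integrable_sum integrable_mult_left int) auto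
  have "(\<integral>x. (\<Sum>j<p. X x j * u j)\<^sup>2 \<partial>P) = (\<Sum>j<p. \<integral>x. (\<Sum>k<p. X x j * X x k * (u j * u k)) \<partial>P)"
    unfolding eq
    by (intro Bochner_Integration.integral_sum Bochner_Integration.integrable_sum integrable_mult_left int) auto
  also have "\<dots> = (\<Sum>j<p. \<Sum>k<p. \<integral>x. X x j * X x k * (u j * u k) \<partial>P)"
    by (intro sum.cong refl Bochner_Integration.integral_sum integrable_mult_left int) auto
  finally show "(\<integral>x. (\<Sum>j<p. X x j * u j)\<^sup>2 \<partial>P) =
      (\<Sum>j<p. \<Sum>k<p. (\<integral>x. X x j * X x k \<partial>P) * u j * u k)"
    by (simp add: mult.assoc[of "integral\<^sup>L P _"])
qed

lemma contrast_measurable: "g \<in> L2 T \<Longrightarrow> contrast u g \<in> borel_measurable XY_sigma"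
  unfolding contrast_def[abs_def]
  by (intro borel_measurable_add linear_form_measurable Y_functional_XY)

lemma contrast_square:
  assumes g: "g \<in> L2 T"
  shows "integrable P (\<lambda>x. (contrast u g x)\<^sup>2)"
    and "(\<integral>x. (contrast u g x)\<^sup>2 \<partial>P) =
      (\<integral>x. (\<Sum>j<p. X x j * u j)\<^sup>2 \<partial>P) + (\<integral>x. (L2_inner T (Y x) g)\<^sup>2 \<partial>P)"
proof -
  have eq: "(contrast u g x)\<^sup>2 = (\<Sum>j<p. X x j * u j)\<^sup>2 +
      (2 * (\<Sum>j<p. u j * (X x j * L2_inner T (Y x) g)) + (L2_inner T (Y x) g)\<^sup>2)" for x
    by (simp add: contrast_def power2_sum sum_distrib_left sum_distrib_right mult_ac)
  have int: "integrable P (\<lambda>x. 2 * (\<Sum>j<p. u j * (X x j * L2_inner T (Y x) g)))"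
    using covariates_uncorrelated(1)[OF _ g] by (intro integrable_mult_right Bochner_Integration.integrable_sum) auto
  have zero: "(\<integral>x. 2 * (\<Sum>j<p. u j * (X x j * L2_inner T (Y x) g)) \<partial>P) = 0"
  proof -
    have "(\<integral>x. (\<Sum>j<p. u j * (X x j * L2_inner T (Y x) g)) \<partial>P) =
        (\<Sum>j<p. \<integral>x. u j * (X x j * L2_inner T (Y x) g) \<partial>P)"
      using covariates_uncorrelated(1)[OF _ g] by (intro Bochner_Integration.integral_sum integrable_mult_right) auto
    then show ?thesis using covariates_uncorrelated(2)[OF _ g] by simp
  qed
  note ints = linear_form_square(1)[of u] int functional_square_integrable[OF g]
  show "integrable P (\<lambda>x. (contrast u g x)\<^sup>2)"
    unfolding eq by (intro Bochner_Integration.integrable_add ints)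
  show "(\<integral>x. (contrast u g x)\<^sup>2 \<partial>P) =
      (\<integral>x. (\<Sum>j<p. X x j * u j)\<^sup>2 \<partial>P) + (\<integral>x. (L2_inner T (Y x) g)\<^sup>2 \<partial>P)"
    unfolding eq
    using Bochner_Integration.integral_add[OF ints(1) Bochner_Integration.integrable_add[OF ints(2,3)]]
      Bochner_Integration.integral_add[OF ints(2,3)] zero by linarith
qed

text \<open>The residual of the rule is the noise minus the contrast. The mixed term vanishes because the noise has
conditional mean zero, and the square of the contrast splits because the covariates are uncorrelated.\<close>

lemma excess_risk:
  assumes g: "g \<in> L2 T" and \<beta>: "\<beta> \<in> L2 T" and eq: "\<And>t. g t = \<beta> t - \<beta>0 t" and u: "\<And>j. u j = \<alpha> j - \<alpha>0 j"
  shows "pred_risk P Z X Y (pfl_predictor T p \<alpha> \<beta>) - pred_risk P Z X Y (pfl_predictor T p \<alpha>0 \<beta>0) =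
    (\<integral>x. (\<Sum>j<p. X x j * u j)\<^sup>2 \<partial>P) + (\<integral>x. (L2_inner T (Y x) g)\<^sup>2 \<partial>P)"
proof -
  have g_eq: "g = (\<lambda>t. \<beta> t - \<beta>0 t)" by (rule ext) (rule eq)
  have residual: "Z x - pfl_predictor T p \<alpha> \<beta> (X x) (Y x) = \<epsilon> x - contrast u g x"
    "Z x - pfl_predictor T p \<alpha>0 \<beta>0 (X x) (Y x) = \<epsilon> x" if x: "x \<in> space P" for x
  proof -
    have "L2_inner T (Y x) g = L2_inner T (Y x) \<beta> - L2_inner T (Y x) \<beta>0"
      using L2_inner_diff_right[OF \<beta> \<beta>0 Y_L2[OF x]] by (simp add: g_eq)
    then show "Z x - pfl_predictor T p \<alpha> \<beta> (X x) (Y x) = \<epsilon> x - contrast u g x"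
      by (simp add: model[OF x] pfl_predictor_def contrast_def u right_diff_distrib sum_subtractf)
    show "Z x - pfl_predictor T p \<alpha>0 \<beta>0 (X x) (Y x) = \<epsilon> x"
      by (simp add: model[OF x] pfl_predictor_def)
  qed
  have sq: "(\<epsilon> x - contrast u g x)\<^sup>2 = (\<epsilon> x)\<^sup>2 - 2 * (\<epsilon> x * contrast u g x) + (contrast u g x)\<^sup>2" for x
    by (simp add: power2_diff mult.assoc)
  note orth = noise_orthogonal[OF contrast_measurable[OF g, of u] contrast_square(1)[OF g]]
  have "pred_risk P Z X Y (pfl_predictor T p \<alpha> \<beta>) = (\<integral>x. (\<epsilon> x - contrast u g x)\<^sup>2 \<partial>P)"
    unfolding pred_risk_def by (intro Bochner_Integration.integral_cong) (simp_all add: residual)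
  also have "\<dots> = (\<integral>x. (\<epsilon> x)\<^sup>2 \<partial>P) + (\<integral>x. (contrast u g x)\<^sup>2 \<partial>P)"
    unfolding sq using orth noise_square_integrable contrast_square(1)[OF g, of u] by simp
  finally have "pred_risk P Z X Y (pfl_predictor T p \<alpha> \<beta>) =
    (\<integral>x. (\<epsilon> x)\<^sup>2 \<partial>P) + (\<integral>x. (contrast u g x)\<^sup>2 \<partial>P)" .
  moreover have "pred_risk P Z X Y (pfl_predictor T p \<alpha>0 \<beta>0) = (\<integral>x. (\<epsilon> x)\<^sup>2 \<partial>P)"
    unfolding pred_risk_def by (intro Bochner_Integration.integral_cong) (simp_all add: residual)
  ultimately show ?thesis by (simp add: contrast_square(2)[OF g])
qed

lemma coercive:
  assumes m: "m \<le> lambda_min (second_moment_mat P p X)"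
  shows "m * (\<Sum>j<p. (u j)\<^sup>2) \<le> (\<integral>x. (\<Sum>j<p. X x j * u j)\<^sup>2 \<partial>P)"
proof -
  let ?D = "second_moment_mat P p X"
  have "m * (\<Sum>j<p. (u j)\<^sup>2) \<le> lambda_min ?D * (\<Sum>j<p. (u j)\<^sup>2)"
    by (intro mult_right_mono m sum_nonneg) auto
  also have "\<dots> \<le> (\<Sum>j<p. \<Sum>k<p. ?D $$ (j, k) * u j * u k)"
    by (rule lambda_min_le_quadratic_form) (auto simp: second_moment_mat_def mult.commute)
  also have "\<dots> = (\<integral>x. (\<Sum>j<p. X x j * u j)\<^sup>2 \<partial>P)"
    by (simp add: linear_form_square(2) second_moment_mat_def)
  finally show ?thesis .
qed

end

section \<open>Deviations of the sample\<close>

lemma abs_le_of_frequently: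
  fixes f :: "nat \<Rightarrow> real"
  assumes lim: "f \<longlonglongrightarrow> l" and freq: "\<exists>\<^sub>F m in sequentially. \<bar>f m\<bar> \<le> K"
  shows "\<bar>l\<bar> \<le> K"
proof (rule ccontr)
  assume "\<not> \<bar>l\<bar> \<le> K"
  then have "\<forall>\<^sub>F m in sequentially. K < \<bar>f m\<bar>"
    by (intro order_tendstoD(1)[OF tendsto_rabs[OF lim]]) simp
  then have "\<forall>\<^sub>F m in sequentially. \<not> \<bar>f m\<bar> \<le> K" by eventually_elim simp
  with freq show False by (simp add: frequently_def)
qed

lemma abs_sum_mult_le_sqrt:
  fixes a b :: "'j \<Rightarrow> real"
  assumes "(\<Sum>j\<in>J. (a j)\<^sup>2) \<le> A\<^sup>2" "(\<Sum>j\<in>J. (b j)\<^sup>2) \<le> t" "0 \<le> A"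
  shows "\<bar>\<Sum>j\<in>J. a j * b j\<bar> \<le> sqrt t * A"
proof -
  have "(\<Sum>j\<in>J. a j * b j)\<^sup>2 \<le> (\<Sum>j\<in>J. (a j)\<^sup>2) * (\<Sum>j\<in>J. (b j)\<^sup>2)"
    by (rule Cauchy_Schwarz_ineq_sum)
  also have "\<dots> \<le> A\<^sup>2 * t"
    using assms by (intro mult_mono) (auto intro: sum_nonneg)
  finally have "sqrt ((\<Sum>j\<in>J. a j * b j)\<^sup>2) \<le> sqrt (A\<^sup>2 * t)"
    by (rule real_sqrt_le_mono)
  then show ?thesis
    using assms(3) by (simp add: real_sqrt_mult mult.commute)
qed

locale pfl_sample = pfl_population P T p X Y \<epsilon> Z \<alpha>0 \<beta>0 M1 v M2 \<sigma> + data: prob_space M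
  for P :: "'a measure" and T p X Y \<epsilon> Z \<alpha>0 \<beta>0 M1 v M2 \<sigma> and M :: "'b measure" +
  fixes n :: nat and Zs :: "nat \<Rightarrow> 'b \<Rightarrow> real" and Xs :: "nat \<Rightarrow> 'b \<Rightarrow> nat \<Rightarrow> real"
    and Ys :: "nat \<Rightarrow> 'b \<Rightarrow> real \<Rightarrow> real"
  assumes n: "1 \<le> n"
    and data_indep: "data.indep_vars (\<lambda>_. obs_space T p) (\<lambda>i x. (Zs i x, Xs i x, Ys i x)) {1..n}"
    and data_law: "\<And>i. i \<in> {1..n} \<Longrightarrow>
      distr M (obs_space T p) (\<lambda>x. (Zs i x, Xs i x, Ys i x)) = distr P (obs_space T p) (\<lambda>x. (Z x, X x, Y x))"
begin

text \<open>The noise of an observation as a function of the observed triple. It lets the law of the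
data, which is known for triples only, be used for the noise.\<close>

definition residual :: "real \<times> (nat \<Rightarrow> real) \<times> (real \<Rightarrow> real) \<Rightarrow> real" where
  "residual = (\<lambda>(z, x, y). z - (\<Sum>j<p. x j * \<alpha>0 j) - L2_inner T y \<beta>0)"

abbreviation sample_noise :: "nat \<Rightarrow> 'b \<Rightarrow> real" where
  "sample_noise i x \<equiv> residual (Zs i x, Xs i x, Ys i x)"

lemma obs_component: "j < p \<Longrightarrow> (\<lambda>w. fst (snd w) j) \<in> borel_measurable (obs_space T p)"
  using measurable_compose[OF measurable_compose[OF measurable_snd measurable_fst]
    measurable_component_singleton[of j "{..<p}" "\<lambda>_. borel"]] by simp

lemma obs_functional: "g \<in> L2 T \<Longrightarrow> (\<lambda>w. L2_inner T (snd (snd w)) g) \<in> borel_measurable (obs_space T p)"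
  by (rule measurable_compose[OF measurable_compose[OF measurable_snd measurable_snd] L2_inner_borel_measurable])

lemma residual_measurable: "residual \<in> borel_measurable (obs_space T p)"
proof -
  have "residual = (\<lambda>w. fst w - (\<Sum>j<p. fst (snd w) j * \<alpha>0 j) - L2_inner T (snd (snd w)) \<beta>0)"
    by (simp add: residual_def fun_eq_iff split_beta)
  then show ?thesis
    using obs_component obs_functional[OF \<beta>0]
    by (auto intro!: borel_measurable_diff borel_measurable_sum borel_measurable_times measurable_fst)
qed

lemma Z_rv: "Z \<in> borel_measurable P"
proof -
  have "(\<lambda>x. (\<Sum>j<p. X x j * \<alpha>0 j) + L2_inner T (Y x) \<beta>0 + \<epsilon> x) \<in> borel_measurable P"
    by (intro borel_measurable_add borel_measurable_sum borel_measurable_times X_component Y_functional \<beta>0 \<epsilon>_rv) auto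
  then show ?thesis by (subst measurable_cong[OF model])
qed

lemma obs_rv: "(\<lambda>x. (Z x, X x, Y x)) \<in> P \<rightarrow>\<^sub>M obs_space T p"
  using Z_rv X_rv Y_rv by measurable

lemma residual_population: "x \<in> space P \<Longrightarrow> residual (Z x, X x, Y x) = \<epsilon> x"
  by (simp add: residual_def model)

lemma Ys_L2: "i \<in> {1..n} \<Longrightarrow> x \<in> space M \<Longrightarrow> Ys i x \<in> L2 T"
proof -
  assume i: "i \<in> {1..n}" and x: "x \<in> space M"
  have "(\<lambda>x. (Zs i x, Xs i x, Ys i x)) \<in> M \<rightarrow>\<^sub>M obs_space T p"
    using data_indep i by (auto simp: data.indep_vars_def2)
  from measurable_space[OF this x] show ?thesis by (simp add: space_pair_measure)
qed

text \<open>The deviation bound with all moments expressed in terms of the population variables, to which the law of a single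
observation is transported.\<close>

lemma population_deviation_event:
  fixes \<phi> :: "nat \<Rightarrow> 'j \<Rightarrow> real \<times> (nat \<Rightarrow> real) \<times> (real \<Rightarrow> real) \<Rightarrow> real"
  assumes J: "\<And>m. finite (J m)"
    and meas: "\<And>m j. j \<in> J m \<Longrightarrow> \<phi> m j \<in> borel_measurable (obs_space T p)"
    and eq: "\<And>m j x. j \<in> J m \<Longrightarrow> x \<in> space P \<Longrightarrow> \<phi> m j (Z x, X x, Y x) = \<psi> m j x"
    and sq: "\<And>m j. j \<in> J m \<Longrightarrow> integrable P (\<lambda>x. (\<psi> m j x)\<^sup>2)"
    and bound: "\<And>m. (\<Sum>j\<in>J m. \<integral>x. (\<psi> m j x)\<^sup>2 \<partial>P) \<le> b"
    and t: "0 < t"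
  obtains A where "A \<in> data.events" "emeasure M A \<le> ennreal (b / (real n * t))"
    "\<And>x. x \<in> space M - A \<Longrightarrow> \<exists>\<^sub>F m in sequentially.
      (\<Sum>j\<in>J m. (sample_mean n (\<lambda>i. \<phi> m j (Zs i x, Xs i x, Ys i x)) - (\<integral>x. \<psi> m j x \<partial>P))\<^sup>2) < t"
proof -
  let ?R = "distr P (obs_space T p) (\<lambda>x. (Z x, X x, Y x))"
  have mean: "(\<integral>w. \<phi> m j w \<partial>?R) = (\<integral>x. \<psi> m j x \<partial>P)"
    and second: "(\<integral>w. (\<phi> m j w)\<^sup>2 \<partial>?R) = (\<integral>x. (\<psi> m j x)\<^sup>2 \<partial>P)"
    and int: "integrable ?R (\<lambda>w. (\<phi> m j w)\<^sup>2)" if j: "j \<in> J m" for m j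
  proof -
    have "(\<integral>w. \<phi> m j w \<partial>?R) = (\<integral>x. \<phi> m j (Z x, X x, Y x) \<partial>P)"
      by (intro integral_distr obs_rv meas j)
    also have "\<dots> = (\<integral>x. \<psi> m j x \<partial>P)"
      by (intro Bochner_Integration.integral_cong refl eq j)
    finally show "(\<integral>w. \<phi> m j w \<partial>?R) = (\<integral>x. \<psi> m j x \<partial>P)" .
    have m2: "(\<lambda>w. (\<phi> m j w)\<^sup>2) \<in> borel_measurable (obs_space T p)"
      using meas[OF j] by simp
    have "(\<integral>w. (\<phi> m j w)\<^sup>2 \<partial>?R) = (\<integral>x. (\<phi> m j (Z x, X x, Y x))\<^sup>2 \<partial>P)"
      by (intro integral_distr obs_rv m2)
    also have "\<dots> = (\<integral>x. (\<psi> m j x)\<^sup>2 \<partial>P)"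
      by (intro Bochner_Integration.integral_cong refl) (simp add: eq j)
    finally show "(\<integral>w. (\<phi> m j w)\<^sup>2 \<partial>?R) = (\<integral>x. (\<psi> m j x)\<^sup>2 \<partial>P)" .
    have "integrable P (\<lambda>x. (\<phi> m j (Z x, X x, Y x))\<^sup>2) \<longleftrightarrow> integrable P (\<lambda>x. (\<psi> m j x)\<^sup>2)"
      by (intro Bochner_Integration.integrable_cong refl) (simp add: eq j)
    then show "integrable ?R (\<lambda>w. (\<phi> m j w)\<^sup>2)"
      using sq[OF j] integrable_distr_eq[OF obs_rv m2] by simp
  qed
  have bound': "(\<Sum>j\<in>J m. \<integral>w. (\<phi> m j w)\<^sup>2 \<partial>?R) \<le> b" for m
    using bound[of m] by (simp add: second)
  show ?thesis
  proof (rule data.deviation_event[OF n data_indep data_law J meas int bound' t])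
    fix A assume A: "A \<in> data.events" "emeasure M A \<le> ennreal (b / (real n * t))"
      and good: "\<And>x. x \<in> space M - A \<Longrightarrow> \<exists>\<^sub>F m in sequentially.
        (\<Sum>j\<in>J m. (sample_mean n (\<lambda>i. \<phi> m j (Zs i x, Xs i x, Ys i x)) - (\<integral>w. \<phi> m j w \<partial>?R))\<^sup>2) < t"
    show thesis
    proof (rule that[OF A])
      fix x assume "x \<in> space M - A"
      from good[OF this] show "\<exists>\<^sub>F m in sequentially.
        (\<Sum>j\<in>J m. (sample_mean n (\<lambda>i. \<phi> m j (Zs i x, Xs i x, Ys i x)) - (\<integral>x. \<psi> m j x \<partial>P))\<^sup>2) < t"
        by (simp add: mean cong: sum.cong)
    qed
  qed
qed

lemma frame_coefficients_le:
  "g \<in> L2 T \<Longrightarrow> (\<Sum>k\<in>dyadic_indices T m. (L2_inner T g (dyadic_step T m k))\<^sup>2) \<le> (L2_norm T g)\<^sup>2"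
  using dyadic_form_le[OF T_compact, of g m]
  by (simp add: dyadic_form_def power2_eq_square[of "L2_inner T g (dyadic_step T m _)"] L2_norm_square)

lemma finite_indices: "finite (dyadic_indices T m)"
  using T_compact by (simp add: compact_imp_bounded finite_dyadic_indices)

lemma frame_functional: "(\<lambda>w. L2_inner T (snd (snd w)) (dyadic_step T m k)) \<in> borel_measurable (obs_space T p)"
  by (intro obs_functional L2_dyadic_step T_compact)

text \<open>The five deviation events from \<open>noise_covariate_event\<close> to \<open>function_second_moment_event\<close> control the stochastic
terms uniformly in \<open>u\<close> and \<open>g\<close>. The sample mean is linear, bilinear or quadratic in these arguments, so by the
Cauchy--Schwarz inequality it suffices to bound the norm of its coefficients. Here the
coefficient vector is finite-dimensional, and the families are constant in \<open>m\<close>.\<close>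

lemma noise_covariate_event:
  assumes t: "0 < t"
  obtains A where "A \<in> data.events" "emeasure M A \<le> ennreal (\<sigma>\<^sup>2 * v\<^sup>2 * real p / (real n * t))"
    "\<And>x u. x \<in> space M - A \<Longrightarrow>
      \<bar>sample_mean n (\<lambda>i. sample_noise i x * (\<Sum>j<p. Xs i x j * u j))\<bar> \<le> sqrt t * L2_set u {..<p}"
proof -
  have second: "integrable P (\<lambda>x. (\<epsilon> x * X x j)\<^sup>2)" "(\<integral>x. (\<epsilon> x * X x j)\<^sup>2 \<partial>P) \<le> \<sigma>\<^sup>2 * v\<^sup>2"
    "(\<integral>x. \<epsilon> x * X x j \<partial>P) = 0" if j: "j < p" for j
  proof -
    note h = X_component_XY[OF j] X_square(1)[OF j]
    show "integrable P (\<lambda>x. (\<epsilon> x * X x j)\<^sup>2)" "(\<integral>x. \<epsilon> x * X x j \<partial>P) = 0"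
      using noise_second_moment(1)[OF h] noise_orthogonal(2)[OF h] .
    have "(\<integral>x. (\<epsilon> x * X x j)\<^sup>2 \<partial>P) \<le> \<sigma>\<^sup>2 * (\<integral>x. (X x j)\<^sup>2 \<partial>P)"
      by (rule noise_second_moment(2)[OF h])
    also have "\<dots> \<le> \<sigma>\<^sup>2 * v\<^sup>2" by (intro mult_left_mono X_square(2) j) simp
    finally show "(\<integral>x. (\<epsilon> x * X x j)\<^sup>2 \<partial>P) \<le> \<sigma>\<^sup>2 * v\<^sup>2" .
  qed
  have bound: "(\<Sum>j<p. \<integral>x. (\<epsilon> x * X x j)\<^sup>2 \<partial>P) \<le> \<sigma>\<^sup>2 * v\<^sup>2 * real p"
    using sum_mono[of "{..<p}" "\<lambda>j. \<integral>x. (\<epsilon> x * X x j)\<^sup>2 \<partial>P" "\<lambda>_. \<sigma>\<^sup>2 * v\<^sup>2"] second(2)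
    by (simp add: mult.commute)
  show ?thesis
  proof (rule population_deviation_event[where J="\<lambda>_. {..<p}"
        and \<phi>="\<lambda>_ j w. residual w * fst (snd w) j" and \<psi>="\<lambda>_ j x. \<epsilon> x * X x j"])
    fix A assume A: "A \<in> data.events" "emeasure M A \<le> ennreal (\<sigma>\<^sup>2 * v\<^sup>2 * real p / (real n * t))"
      and good: "\<And>x. x \<in> space M - A \<Longrightarrow> \<exists>\<^sub>F m in sequentially. (\<Sum>j<p. (sample_mean n
        (\<lambda>i. sample_noise i x * fst (snd (Zs i x, Xs i x, Ys i x)) j) - (\<integral>x. \<epsilon> x * X x j \<partial>P))\<^sup>2) < t"
    show thesis
    proof (rule that[OF A])
      fix x and u :: "nat \<Rightarrow> real" assume x: "x \<in> space M - A"
      have le: "(\<Sum>j<p. (sample_mean n (\<lambda>i. sample_noise i x * Xs i x j))\<^sup>2) \<le> t"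
        using good[OF x] by (simp add: second(3))
      have "sample_mean n (\<lambda>i. sample_noise i x * (\<Sum>j<p. Xs i x j * u j)) =
          (\<Sum>j<p. u j * sample_mean n (\<lambda>i. sample_noise i x * Xs i x j))"
        by (simp add: sum_distrib_left sample_mean_sum flip: sample_mean_mult_left) (simp add: mult_ac)
      also have "\<bar>\<dots>\<bar> \<le> sqrt t * L2_set u {..<p}"
        by (rule abs_sum_mult_le_sqrt[OF _ le]) (simp_all add: L2_set_def sum_nonneg)
      finally show "\<bar>sample_mean n (\<lambda>i. sample_noise i x * (\<Sum>j<p. Xs i x j * u j))\<bar> \<le> sqrt t * L2_set u {..<p}" .
    qed
  qed (use t bound second obs_component residual_measurable residual_population in auto)
qed

text \<open>The bound is first obtained for the projection of the data to level \<open>m\<close>, for infinitely many \<open>m\<close> with the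
same constant, and passes to the limit by convergence of the dyadic forms.\<close>

lemma noise_function_event:
  assumes t: "0 < t"
  obtains A where "A \<in> data.events" "emeasure M A \<le> ennreal (\<sigma>\<^sup>2 * M2\<^sup>2 / (real n * t))"
    "\<And>x g. x \<in> space M - A \<Longrightarrow> g \<in> L2 T \<Longrightarrow>
      \<bar>sample_mean n (\<lambda>i. sample_noise i x * L2_inner T (Ys i x) g)\<bar> \<le> sqrt t * L2_norm T g"
proof -
  let ?e = "dyadic_step T" and ?K = "dyadic_indices T"
  have e: "?e m k \<in> L2 T" for m k by (rule L2_dyadic_step[OF T_compact])
  have second: "integrable P (\<lambda>x. (\<epsilon> x * L2_inner T (Y x) (?e m k))\<^sup>2)"
    "(\<integral>x. \<epsilon> x * L2_inner T (Y x) (?e m k) \<partial>P) = 0" for m k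
    using integrable_times_functional[OF \<epsilon>_rv noise_square_integrable e]
      noise_orthogonal(2)[OF Y_functional_XY[OF e] functional_square_integrable[OF e]] .
  have bound: "(\<Sum>k\<in>?K m. \<integral>x. (\<epsilon> x * L2_inner T (Y x) (?e m k))\<^sup>2 \<partial>P) \<le> \<sigma>\<^sup>2 * M2\<^sup>2" for m
    using frame_second_moments[OF \<epsilon>_rv noise_square_integrable, of m]
      mult_left_mono[OF noise_variance, of "M2\<^sup>2"] by (simp add: mult.commute)
  show ?thesis
  proof (rule population_deviation_event[where J="?K"
        and \<phi>="\<lambda>m k w. residual w * L2_inner T (snd (snd w)) (?e m k)"
        and \<psi>="\<lambda>m k x. \<epsilon> x * L2_inner T (Y x) (?e m k)"])
    fix A assume A: "A \<in> data.events" "emeasure M A \<le> ennreal (\<sigma>\<^sup>2 * M2\<^sup>2 / (real n * t))"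
      and good: "\<And>x. x \<in> space M - A \<Longrightarrow> \<exists>\<^sub>F m in sequentially. (\<Sum>k\<in>?K m. (sample_mean n
        (\<lambda>i. sample_noise i x * L2_inner T (snd (snd (Zs i x, Xs i x, Ys i x))) (?e m k)) -
          (\<integral>x. \<epsilon> x * L2_inner T (Y x) (?e m k) \<partial>P))\<^sup>2) < t"
    show thesis
    proof (rule that[OF A])
      fix x g assume x: "x \<in> space M - A" and g: "g \<in> L2 T"
      let ?c = "\<lambda>m k. sample_mean n (\<lambda>i. sample_noise i x * L2_inner T (Ys i x) (?e m k))"
      have "(\<lambda>m. sample_mean n (\<lambda>i. sample_noise i x * dyadic_form T m (Ys i x) g)) \<longlonglongrightarrow>
          sample_mean n (\<lambda>i. sample_noise i x * L2_inner T (Ys i x) g)"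
        using x by (intro sample_mean_tendsto tendsto_mult tendsto_const dyadic_form_tendsto[OF T_compact] Ys_L2 g) auto
      moreover have "sample_mean n (\<lambda>i. sample_noise i x * dyadic_form T m (Ys i x) g) =
          (\<Sum>k\<in>?K m. L2_inner T g (?e m k) * ?c m k)" for m
        by (simp add: dyadic_form_def sum_distrib_left sample_mean_sum flip: sample_mean_mult_left)
           (simp add: mult_ac)
      ultimately have lim: "(\<lambda>m. \<Sum>k\<in>?K m. L2_inner T g (?e m k) * ?c m k) \<longlonglongrightarrow>
          sample_mean n (\<lambda>i. sample_noise i x * L2_inner T (Ys i x) g)"
        by (simp only:)
      have "\<exists>\<^sub>F m in sequentially. \<bar>\<Sum>k\<in>?K m. L2_inner T g (?e m k) * ?c m k\<bar> \<le> sqrt t * L2_norm T g"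
        using good[OF x]
      proof (rule frequently_elim1)
        fix m
        assume "(\<Sum>k\<in>?K m. (sample_mean n
          (\<lambda>i. sample_noise i x * L2_inner T (snd (snd (Zs i x, Xs i x, Ys i x))) (?e m k)) -
            (\<integral>x. \<epsilon> x * L2_inner T (Y x) (?e m k) \<partial>P))\<^sup>2) < t"
        then have "(\<Sum>k\<in>?K m. (?c m k)\<^sup>2) \<le> t" by (simp add: second(2))
        then show "\<bar>\<Sum>k\<in>?K m. L2_inner T g (?e m k) * ?c m k\<bar> \<le> sqrt t * L2_norm T g"
          by (intro abs_sum_mult_le_sqrt frame_coefficients_le g L2_norm_nonneg)
      qed
      then show "\<bar>sample_mean n (\<lambda>i. sample_noise i x * L2_inner T (Ys i x) g)\<bar> \<le> sqrt t * L2_norm T g"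
        by (rule abs_le_of_frequently[OF lim])
    qed
  qed (use t bound second frame_functional residual_measurable residual_population finite_indices in auto)
qed

lemma covariate_second_moment_event:
  assumes t: "0 < t"
  obtains A where "A \<in> data.events" "emeasure M A \<le> ennreal (3 * M1 ^ 4 * (real p)\<^sup>2 / (real n * t))"
    "\<And>x u. x \<in> space M - A \<Longrightarrow>
      \<bar>sample_mean n (\<lambda>i. (\<Sum>j<p. Xs i x j * u j)\<^sup>2) - (\<integral>x. (\<Sum>j<p. X x j * u j)\<^sup>2 \<partial>P)\<bar>
        \<le> sqrt t * (L2_set u {..<p})\<^sup>2"
proof -
  let ?J = "{..<p} \<times> {..<p}"
  have bound: "(\<Sum>q\<in>?J. \<integral>x. (X x (fst q) * X x (snd q))\<^sup>2 \<partial>P) \<le> 3 * M1 ^ 4 * (real p)\<^sup>2"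
  proof -
    have "(\<Sum>q\<in>?J. \<integral>x. (X x (fst q) * X x (snd q))\<^sup>2 \<partial>P) \<le> (\<Sum>q\<in>?J. 3 * M1 ^ 4)"
      by (intro sum_mono X_products(2)) auto
    then show ?thesis by (simp add: power2_eq_square mult_ac)
  qed
  show ?thesis
  proof (rule population_deviation_event[where J="\<lambda>_. ?J"
        and \<phi>="\<lambda>_ q w. fst (snd w) (fst q) * fst (snd w) (snd q)" and \<psi>="\<lambda>_ q x. X x (fst q) * X x (snd q)"])
    fix A assume A: "A \<in> data.events" "emeasure M A \<le> ennreal (3 * M1 ^ 4 * (real p)\<^sup>2 / (real n * t))"
      and good: "\<And>x. x \<in> space M - A \<Longrightarrow> \<exists>\<^sub>F m in sequentially. (\<Sum>q\<in>?J. (sample_mean n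
        (\<lambda>i. fst (snd (Zs i x, Xs i x, Ys i x)) (fst q) * fst (snd (Zs i x, Xs i x, Ys i x)) (snd q)) -
          (\<integral>x. X x (fst q) * X x (snd q) \<partial>P))\<^sup>2) < t"
    show thesis
    proof (rule that[OF A])
      fix x and u :: "nat \<Rightarrow> real" assume x: "x \<in> space M - A"
      let ?d = "\<lambda>q. sample_mean n (\<lambda>i. Xs i x (fst q) * Xs i x (snd q)) - (\<integral>x. X x (fst q) * X x (snd q) \<partial>P)"
      let ?a = "\<lambda>q. u (fst q) * u (snd q)"
      have le: "(\<Sum>q\<in>?J. (?d q)\<^sup>2) \<le> t" using good[OF x] by simp
      have "sample_mean n (\<lambda>i. (\<Sum>j<p. Xs i x j * u j)\<^sup>2) =
          (\<Sum>j<p. \<Sum>k<p. (u j * u k) * sample_mean n (\<lambda>i. Xs i x j * Xs i x k))"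
        unfolding power2_eq_square sum_product sample_mean_sum sample_mean_mult_left[symmetric]
        by (simp add: mult_ac)
      moreover have "(\<integral>x. (\<Sum>j<p. X x j * u j)\<^sup>2 \<partial>P) =
          (\<Sum>j<p. \<Sum>k<p. (u j * u k) * (\<integral>x. X x j * X x k \<partial>P))"
        unfolding linear_form_square(2) by (simp add: mult_ac)
      ultimately have "sample_mean n (\<lambda>i. (\<Sum>j<p. Xs i x j * u j)\<^sup>2) - (\<integral>x. (\<Sum>j<p. X x j * u j)\<^sup>2 \<partial>P) =
          (\<Sum>q\<in>?J. ?a q * ?d q)"
        by (simp add: sum.cartesian_product' right_diff_distrib sum_subtractf)
      also have "\<bar>\<dots>\<bar> \<le> sqrt t * (L2_set u {..<p})\<^sup>2"
      proof (rule abs_sum_mult_le_sqrt[OF _ le])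
        have "(\<Sum>q\<in>?J. (?a q)\<^sup>2) = (\<Sum>j<p. (u j)\<^sup>2) * (\<Sum>j<p. (u j)\<^sup>2)"
          by (simp add: sum.cartesian_product' power_mult_distrib sum_product)
        then show "(\<Sum>q\<in>?J. (?a q)\<^sup>2) \<le> ((L2_set u {..<p})\<^sup>2)\<^sup>2"
          by (simp add: L2_set_def sum_nonneg power2_eq_square[of "\<Sum>j<p. (u j)\<^sup>2"])
      qed simp
      finally show "\<bar>sample_mean n (\<lambda>i. (\<Sum>j<p. Xs i x j * u j)\<^sup>2) - (\<integral>x. (\<Sum>j<p. X x j * u j)\<^sup>2 \<partial>P)\<bar>
        \<le> sqrt t * (L2_set u {..<p})\<^sup>2" .
    qed
  qed (use t bound X_products(1) obs_component in auto)
qed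

lemma cross_moment_event:
  assumes t: "0 < t"
  obtains A where "A \<in> data.events" "emeasure M A \<le> ennreal (v\<^sup>2 * M2\<^sup>2 * real p / (real n * t))"
    "\<And>x u g. x \<in> space M - A \<Longrightarrow> g \<in> L2 T \<Longrightarrow>
      \<bar>sample_mean n (\<lambda>i. (\<Sum>j<p. Xs i x j * u j) * L2_inner T (Ys i x) g)\<bar>
        \<le> sqrt t * (L2_set u {..<p} * L2_norm T g)"
proof -
  let ?e = "dyadic_step T" and ?K = "dyadic_indices T"
  let ?J = "\<lambda>m. {..<p} \<times> ?K m"
  have e: "?e m k \<in> L2 T" for m k by (rule L2_dyadic_step[OF T_compact])
  have second: "integrable P (\<lambda>x. (X x j * L2_inner T (Y x) (?e m k))\<^sup>2)"
    "(\<integral>x. X x j * L2_inner T (Y x) (?e m k) \<partial>P) = 0" if "j < p" for j m k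
    using integrable_times_functional[OF X_component X_square(1) e] covariates_uncorrelated(2)[OF _ e] that by auto
  have bound: "(\<Sum>q\<in>?J m. \<integral>x. (X x (fst q) * L2_inner T (Y x) (?e m (snd q)))\<^sup>2 \<partial>P)
      \<le> v\<^sup>2 * M2\<^sup>2 * real p" for m
  proof -
    have "(\<Sum>k\<in>?K m. \<integral>x. (X x j * L2_inner T (Y x) (?e m k))\<^sup>2 \<partial>P) \<le> v\<^sup>2 * M2\<^sup>2" if j: "j < p" for j
      using frame_second_moments[OF X_component X_square(1), OF j j, of m]
        mult_left_mono[OF X_square(2)[OF j], of "M2\<^sup>2"] by (simp add: mult.commute)
    then have "(\<Sum>j<p. \<Sum>k\<in>?K m. \<integral>x. (X x j * L2_inner T (Y x) (?e m k))\<^sup>2 \<partial>P) \<le> (\<Sum>j<p. v\<^sup>2 * M2\<^sup>2)"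
      by (intro sum_mono) simp
    then show ?thesis by (simp add: sum.cartesian_product' mult.commute)
  qed
  have meas: "(\<lambda>w. fst (snd w) (fst q) * L2_inner T (snd (snd w)) (?e m (snd q))) \<in> borel_measurable (obs_space T p)"
    if "q \<in> ?J m" for m q
    using that by (intro borel_measurable_times obs_component frame_functional) auto
  show ?thesis
  proof (rule population_deviation_event[where J="?J"
        and \<phi>="\<lambda>m q w. fst (snd w) (fst q) * L2_inner T (snd (snd w)) (?e m (snd q))"
        and \<psi>="\<lambda>m q x. X x (fst q) * L2_inner T (Y x) (?e m (snd q))", OF _ meas _ _ bound t])
    fix A assume A: "A \<in> data.events" "emeasure M A \<le> ennreal (v\<^sup>2 * M2\<^sup>2 * real p / (real n * t))"
      and good: "\<And>x. x \<in> space M - A \<Longrightarrow> \<exists>\<^sub>F m in sequentially. (\<Sum>q\<in>?J m. (sample_mean n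
        (\<lambda>i. fst (snd (Zs i x, Xs i x, Ys i x)) (fst q) *
          L2_inner T (snd (snd (Zs i x, Xs i x, Ys i x))) (?e m (snd q))) -
          (\<integral>x. X x (fst q) * L2_inner T (Y x) (?e m (snd q)) \<partial>P))\<^sup>2) < t"
    show thesis
    proof (rule that[OF A])
      fix x and u :: "nat \<Rightarrow> real" and g assume x: "x \<in> space M - A" and g: "g \<in> L2 T"
      let ?c = "\<lambda>m q. sample_mean n (\<lambda>i. Xs i x (fst q) * L2_inner T (Ys i x) (?e m (snd q)))"
      let ?a = "\<lambda>m q. u (fst q) * L2_inner T g (?e m (snd q))"
      have "(\<lambda>m. sample_mean n (\<lambda>i. (\<Sum>j<p. Xs i x j * u j) * dyadic_form T m (Ys i x) g)) \<longlonglongrightarrow>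
          sample_mean n (\<lambda>i. (\<Sum>j<p. Xs i x j * u j) * L2_inner T (Ys i x) g)"
        using x by (intro sample_mean_tendsto tendsto_mult tendsto_const dyadic_form_tendsto[OF T_compact] Ys_L2 g) auto
      moreover have "sample_mean n (\<lambda>i. (\<Sum>j<p. Xs i x j * u j) * dyadic_form T m (Ys i x) g) =
          (\<Sum>q\<in>?J m. ?a m q * ?c m q)" for m
        unfolding dyadic_form_def sum_product sample_mean_sum sum.cartesian_product' sample_mean_mult_left[symmetric]
        by (simp add: mult_ac)
      ultimately have lim: "(\<lambda>m. \<Sum>q\<in>?J m. ?a m q * ?c m q) \<longlonglongrightarrow>
          sample_mean n (\<lambda>i. (\<Sum>j<p. Xs i x j * u j) * L2_inner T (Ys i x) g)"
        by (simp only:)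
      have "\<exists>\<^sub>F m in sequentially. \<bar>\<Sum>q\<in>?J m. ?a m q * ?c m q\<bar> \<le> sqrt t * (L2_set u {..<p} * L2_norm T g)"
        using good[OF x]
      proof (rule frequently_elim1)
        fix m
        assume less: "(\<Sum>q\<in>?J m. (sample_mean n
          (\<lambda>i. fst (snd (Zs i x, Xs i x, Ys i x)) (fst q) *
            L2_inner T (snd (snd (Zs i x, Xs i x, Ys i x))) (?e m (snd q))) -
            (\<integral>x. X x (fst q) * L2_inner T (Y x) (?e m (snd q)) \<partial>P))\<^sup>2) < t"
        have "(\<Sum>q\<in>?J m. (?c m q)\<^sup>2) = (\<Sum>q\<in>?J m. (sample_mean n
          (\<lambda>i. fst (snd (Zs i x, Xs i x, Ys i x)) (fst q) *
            L2_inner T (snd (snd (Zs i x, Xs i x, Ys i x))) (?e m (snd q))) -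
            (\<integral>x. X x (fst q) * L2_inner T (Y x) (?e m (snd q)) \<partial>P))\<^sup>2)"
          by (intro sum.cong refl) (auto simp: second(2))
        then have le: "(\<Sum>q\<in>?J m. (?c m q)\<^sup>2) \<le> t" using less by (simp only: less_imp_le)
        have "(\<Sum>q\<in>?J m. (?a m q)\<^sup>2) =
            (\<Sum>j<p. (u j)\<^sup>2) * (\<Sum>k\<in>?K m. (L2_inner T g (?e m k))\<^sup>2)"
          by (simp add: sum.cartesian_product' power_mult_distrib sum_product)
        also have "\<dots> \<le> (\<Sum>j<p. (u j)\<^sup>2) * (L2_norm T g)\<^sup>2"
          by (intro mult_left_mono frame_coefficients_le g sum_nonneg) auto
        finally have "(\<Sum>q\<in>?J m. (?a m q)\<^sup>2) \<le> (L2_set u {..<p} * L2_norm T g)\<^sup>2"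
          by (simp add: L2_set_def sum_nonneg power_mult_distrib)
        then show "\<bar>\<Sum>q\<in>?J m. ?a m q * ?c m q\<bar> \<le> sqrt t * (L2_set u {..<p} * L2_norm T g)"
          by (rule abs_sum_mult_le_sqrt[OF _ le]) (simp add: L2_norm_nonneg)
      qed
      then show "\<bar>sample_mean n (\<lambda>i. (\<Sum>j<p. Xs i x j * u j) * L2_inner T (Ys i x) g)\<bar>
          \<le> sqrt t * (L2_set u {..<p} * L2_norm T g)"
        by (rule abs_le_of_frequently[OF lim])
    qed
  qed (use second finite_indices in auto)
qed

text \<open>Dominated convergence: the forms are bounded by \<open>M2 \<parallel>g\<parallel>\<close> almost surely.\<close>

lemma form_second_moment_tendsto:
  assumes g: "g \<in> L2 T"
  shows "(\<lambda>m. \<integral>x. (dyadic_form T m (Y x) g)\<^sup>2 \<partial>P) \<longlonglongrightarrow> (\<integral>x. (L2_inner T (Y x) g)\<^sup>2 \<partial>P)"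
proof (rule integral_dominated_convergence[where w="\<lambda>_. M2\<^sup>2 * (L2_norm T g)\<^sup>2"])
  show "AE x in P. (\<lambda>m. (dyadic_form T m (Y x) g)\<^sup>2) \<longlonglongrightarrow> (L2_inner T (Y x) g)\<^sup>2"
    using AE_space by eventually_elim (intro tendsto_power dyadic_form_tendsto[OF T_compact] Y_L2 g)
  show "AE x in P. norm ((dyadic_form T m (Y x) g)\<^sup>2) \<le> M2\<^sup>2 * (L2_norm T g)\<^sup>2" for m
    using Y_frame_bound[of m]
  proof eventually_elim
    case (elim x)
    have "(dyadic_form T m (Y x) g)\<^sup>2 \<le>
        (\<Sum>k\<in>dyadic_indices T m. (L2_inner T (Y x) (dyadic_step T m k))\<^sup>2) *
        (\<Sum>k\<in>dyadic_indices T m. (L2_inner T g (dyadic_step T m k))\<^sup>2)"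
      unfolding dyadic_form_def by (rule Cauchy_Schwarz_ineq_sum)
    also have "\<dots> \<le> M2\<^sup>2 * (L2_norm T g)\<^sup>2"
      by (intro mult_mono elim frame_coefficients_le g sum_nonneg) auto
    finally show ?case by simp
  qed
  show "(\<lambda>x. (dyadic_form T m (Y x) g)\<^sup>2) \<in> borel_measurable P" for m
    unfolding dyadic_form_def
    by (intro borel_measurable_power borel_measurable_sum borel_measurable_times Y_functional
        L2_dyadic_step T_compact borel_measurable_const)
qed (use g in simp_all)

lemma function_second_moment_event:
  assumes t: "0 < t"
  obtains A where "A \<in> data.events" "emeasure M A \<le> ennreal (M2\<^sup>2 * M2\<^sup>2 / (real n * t))"
    "\<And>x g. x \<in> space M - A \<Longrightarrow> g \<in> L2 T \<Longrightarrow>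
      \<bar>sample_mean n (\<lambda>i. (L2_inner T (Ys i x) g)\<^sup>2) - (\<integral>x. (L2_inner T (Y x) g)\<^sup>2 \<partial>P)\<bar>
        \<le> sqrt t * (L2_norm T g)\<^sup>2"
proof -
  let ?e = "dyadic_step T" and ?K = "dyadic_indices T"
  let ?J = "\<lambda>m. ?K m \<times> ?K m"
  have e: "?e m k \<in> L2 T" for m k by (rule L2_dyadic_step[OF T_compact])
  note sq = functional_square_integrable[OF e]
  have int: "integrable P (\<lambda>x. (L2_inner T (Y x) (?e m k) * L2_inner T (Y x) (?e m l))\<^sup>2)" for m k l
    by (rule integrable_times_functional[OF Y_functional[OF e] sq e])
  have int1: "integrable P (\<lambda>x. L2_inner T (Y x) (?e m k) * L2_inner T (Y x) (?e m l))" for m k l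
    by (rule integrable_of_square[OF _ int]) (intro borel_measurable_times Y_functional e)
  have bound: "(\<Sum>q\<in>?J m. \<integral>x. (L2_inner T (Y x) (?e m (fst q)) * L2_inner T (Y x) (?e m (snd q)))\<^sup>2 \<partial>P)
      \<le> M2\<^sup>2 * M2\<^sup>2" for m
  proof -
    have "(\<Sum>k\<in>?K m. \<Sum>l\<in>?K m. \<integral>x. (L2_inner T (Y x) (?e m k) * L2_inner T (Y x) (?e m l))\<^sup>2 \<partial>P)
        \<le> (\<Sum>k\<in>?K m. M2\<^sup>2 * (\<integral>x. (L2_inner T (Y x) (?e m k))\<^sup>2 \<partial>P))"
      by (intro sum_mono frame_second_moments Y_functional e sq)
    also have "\<dots> \<le> M2\<^sup>2 * M2\<^sup>2"
    proof -
      have "(\<Sum>k\<in>?K m. \<integral>x. (L2_inner T (Y x) (?e m k))\<^sup>2 \<partial>P) \<le> M2\<^sup>2"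
        using frame_second_moments[of "\<lambda>_. 1" m] by (simp add: prob_space)
      then show ?thesis
        unfolding sum_distrib_left[symmetric] by (intro mult_left_mono) auto
    qed
    finally show ?thesis by (simp add: sum.cartesian_product')
  qed
  have meas: "(\<lambda>w. L2_inner T (snd (snd w)) (?e m (fst q)) * L2_inner T (snd (snd w)) (?e m (snd q)))
      \<in> borel_measurable (obs_space T p)" for m q
    by (intro borel_measurable_times frame_functional)
  show ?thesis
  proof (rule population_deviation_event[where J="?J"
        and \<phi>="\<lambda>m q w. L2_inner T (snd (snd w)) (?e m (fst q)) * L2_inner T (snd (snd w)) (?e m (snd q))"
        and \<psi>="\<lambda>m q x. L2_inner T (Y x) (?e m (fst q)) * L2_inner T (Y x) (?e m (snd q))", OF _ meas _ int bound t])
    fix A assume A: "A \<in> data.events" "emeasure M A \<le> ennreal (M2\<^sup>2 * M2\<^sup>2 / (real n * t))"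
      and good: "\<And>x. x \<in> space M - A \<Longrightarrow> \<exists>\<^sub>F m in sequentially. (\<Sum>q\<in>?J m. (sample_mean n
        (\<lambda>i. L2_inner T (snd (snd (Zs i x, Xs i x, Ys i x))) (?e m (fst q)) *
          L2_inner T (snd (snd (Zs i x, Xs i x, Ys i x))) (?e m (snd q))) -
          (\<integral>x. L2_inner T (Y x) (?e m (fst q)) * L2_inner T (Y x) (?e m (snd q)) \<partial>P))\<^sup>2) < t"
    show thesis
    proof (rule that[OF A])
      fix x g assume x: "x \<in> space M - A" and g: "g \<in> L2 T"
      let ?d = "\<lambda>m q. sample_mean n (\<lambda>i. L2_inner T (Ys i x) (?e m (fst q)) * L2_inner T (Ys i x) (?e m (snd q)))
        - (\<integral>x. L2_inner T (Y x) (?e m (fst q)) * L2_inner T (Y x) (?e m (snd q)) \<partial>P)"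
      let ?a = "\<lambda>m q. L2_inner T g (?e m (fst q)) * L2_inner T g (?e m (snd q))"
      have "(\<lambda>m. sample_mean n (\<lambda>i. (dyadic_form T m (Ys i x) g)\<^sup>2) - (\<integral>x. (dyadic_form T m (Y x) g)\<^sup>2 \<partial>P)) \<longlonglongrightarrow>
          sample_mean n (\<lambda>i. (L2_inner T (Ys i x) g)\<^sup>2) - (\<integral>x. (L2_inner T (Y x) g)\<^sup>2 \<partial>P)"
        using x by (intro tendsto_diff form_second_moment_tendsto sample_mean_tendsto tendsto_power
            dyadic_form_tendsto[OF T_compact] Ys_L2 g) auto
      moreover have "sample_mean n (\<lambda>i. (dyadic_form T m (Ys i x) g)\<^sup>2) - (\<integral>x. (dyadic_form T m (Y x) g)\<^sup>2 \<partial>P) =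
          (\<Sum>q\<in>?J m. ?a m q * ?d m q)" for m
      proof -
        have sq_eq: "(dyadic_form T m y g)\<^sup>2 = (\<Sum>k\<in>?K m. \<Sum>l\<in>?K m.
            (L2_inner T g (?e m k) * L2_inner T g (?e m l)) * (L2_inner T y (?e m k) * L2_inner T y (?e m l)))" for y
          by (simp add: dyadic_form_def power2_eq_square sum_product mult_ac)
        have "(\<integral>x. (dyadic_form T m (Y x) g)\<^sup>2 \<partial>P) = (\<Sum>k\<in>?K m. \<integral>x. (\<Sum>l\<in>?K m.
            (L2_inner T g (?e m k) * L2_inner T g (?e m l)) * (L2_inner T (Y x) (?e m k) * L2_inner T (Y x) (?e m l))) \<partial>P)"
          unfolding sq_eq
          by (intro Bochner_Integration.integral_sum Bochner_Integration.integrable_sum integrable_mult_right int1)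
        also have "\<dots> = (\<Sum>k\<in>?K m. \<Sum>l\<in>?K m. \<integral>x. 
            (L2_inner T g (?e m k) * L2_inner T g (?e m l)) * (L2_inner T (Y x) (?e m k) * L2_inner T (Y x) (?e m l)) \<partial>P)"
          by (intro sum.cong refl Bochner_Integration.integral_sum integrable_mult_right int1)
        also have "\<dots> = (\<Sum>k\<in>?K m. \<Sum>l\<in>?K m. (L2_inner T g (?e m k) * L2_inner T g (?e m l)) *
            (\<integral>x. L2_inner T (Y x) (?e m k) * L2_inner T (Y x) (?e m l) \<partial>P))"
          by simp
        finally have population: "(\<integral>x. (dyadic_form T m (Y x) g)\<^sup>2 \<partial>P) =
          (\<Sum>k\<in>?K m. \<Sum>l\<in>?K m. (L2_inner T g (?e m k) * L2_inner T g (?e m l)) *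
            (\<integral>x. L2_inner T (Y x) (?e m k) * L2_inner T (Y x) (?e m l) \<partial>P))" .
        have sample: "sample_mean n (\<lambda>i. (dyadic_form T m (Ys i x) g)\<^sup>2) =
          (\<Sum>k\<in>?K m. \<Sum>l\<in>?K m. (L2_inner T g (?e m k) * L2_inner T g (?e m l)) *
            sample_mean n (\<lambda>i. L2_inner T (Ys i x) (?e m k) * L2_inner T (Ys i x) (?e m l)))"
          unfolding sq_eq sample_mean_sum sample_mean_mult_left ..
        show ?thesis
          unfolding population sample sum.cartesian_product' sum_subtractf[symmetric]
          by (simp add: right_diff_distrib)
      qed
      ultimately have lim: "(\<lambda>m. \<Sum>q\<in>?J m. ?a m q * ?d m q) \<longlonglongrightarrow>
          sample_mean n (\<lambda>i. (L2_inner T (Ys i x) g)\<^sup>2) - (\<integral>x. (L2_inner T (Y x) g)\<^sup>2 \<partial>P)"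
        by (simp only:)
      have "\<exists>\<^sub>F m in sequentially. \<bar>\<Sum>q\<in>?J m. ?a m q * ?d m q\<bar> \<le> sqrt t * (L2_norm T g)\<^sup>2"
        using good[OF x]
      proof (rule frequently_elim1)
        fix m
        assume "(\<Sum>q\<in>?J m. (sample_mean n
          (\<lambda>i. L2_inner T (snd (snd (Zs i x, Xs i x, Ys i x))) (?e m (fst q)) *
            L2_inner T (snd (snd (Zs i x, Xs i x, Ys i x))) (?e m (snd q))) -
            (\<integral>x. L2_inner T (Y x) (?e m (fst q)) * L2_inner T (Y x) (?e m (snd q)) \<partial>P))\<^sup>2) < t"
        then have le: "(\<Sum>q\<in>?J m. (?d m q)\<^sup>2) \<le> t" unfolding snd_conv by (rule less_imp_le)
        have "(\<Sum>q\<in>?J m. (?a m q)\<^sup>2) =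
            (\<Sum>k\<in>?K m. (L2_inner T g (?e m k))\<^sup>2) * (\<Sum>k\<in>?K m. (L2_inner T g (?e m k))\<^sup>2)"
          by (simp add: sum.cartesian_product' power_mult_distrib sum_product)
        also have "\<dots> \<le> (L2_norm T g)\<^sup>2 * (L2_norm T g)\<^sup>2"
          by (intro mult_mono frame_coefficients_le g sum_nonneg) auto
        finally have "(\<Sum>q\<in>?J m. (?a m q)\<^sup>2) \<le> ((L2_norm T g)\<^sup>2)\<^sup>2"
          by (simp only: power2_eq_square[of "(L2_norm T g)\<^sup>2"])
        then show "\<bar>\<Sum>q\<in>?J m. ?a m q * ?d m q\<bar> \<le> sqrt t * (L2_norm T g)\<^sup>2"
          by (rule abs_sum_mult_le_sqrt[OF _ le]) simp
      qed
      then show "\<bar>sample_mean n (\<lambda>i. (L2_inner T (Ys i x) g)\<^sup>2) - (\<integral>x. (L2_inner T (Y x) g)\<^sup>2 \<partial>P)\<bar>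
          \<le> sqrt t * (L2_norm T g)\<^sup>2"
        by (rule abs_le_of_frequently[OF lim])
    qed
  qed (use finite_indices in auto)
qed

end

section \<open>Consistency\<close>

text \<open>The right-hand side of \<open>ridge_error_bound\<close> with its abbreviations expanded.\<close>

definition risk_bound :: "real \<Rightarrow> real \<Rightarrow> real \<Rightarrow> real \<Rightarrow> real \<Rightarrow> real \<Rightarrow> real \<Rightarrow> real" where
  "risk_bound l m F NX NY RXY RY =
    2 * (1 + 2 * (8 * RXY\<^sup>2 / m + RY) / l) * (2 * (l * F + NY)\<^sup>2 / l) +
    16 * (1 + 2 * (8 * RXY\<^sup>2 / m + RY) / l)\<^sup>2 * NX\<^sup>2 / m"

context pfl_sample
begin

text \<open>The estimates \<open>c1\<close> to \<open>c5\<close> are what the five deviation events guarantee for one fixed sample. Norms of the slope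
error \<open>g = S h\<close> are at most \<open>B\<close> times norms of \<open>h\<close>, which puts the factors \<open>B\<close> into the bound.\<close>

lemma excess_risk_le_risk_bound:
  assumes S: "L2_operator T S" and B: "\<And>f. f \<in> L2 T \<Longrightarrow> L2_norm T (S f) \<le> B * L2_norm T f" "0 \<le> B"
    and f0: "f0 \<in> L2 T" "L2_eq T \<beta>0 (S f0)" "L2_norm T f0 \<le> F"
    and l: "0 < l" and m: "0 < m" "m \<le> lambda_min (second_moment_mat P p X)"
    and t3: "sqrt t3 \<le> m / 4" and t5: "0 < t5"
    and x: "x \<in> space M"
    and min: "is_arg_min (penalized_loss T S n p l (\<lambda>i. Zs i x) (\<lambda>i. Xs i x) (\<lambda>i. Ys i x))
      (\<lambda>(\<alpha>, f). f \<in> L2 T) (\<alpha>h, fh)"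
    and c1: "\<And>u. \<bar>sample_mean n (\<lambda>i. sample_noise i x * (\<Sum>j<p. Xs i x j * u j))\<bar> \<le> sqrt t1 * L2_set u {..<p}"
    and c2: "\<And>g. g \<in> L2 T \<Longrightarrow>
      \<bar>sample_mean n (\<lambda>i. sample_noise i x * L2_inner T (Ys i x) g)\<bar> \<le> sqrt t2 * L2_norm T g"
    and c3: "\<And>u. \<bar>sample_mean n (\<lambda>i. (\<Sum>j<p. Xs i x j * u j)\<^sup>2) - (\<integral>x. (\<Sum>j<p. X x j * u j)\<^sup>2 \<partial>P)\<bar>
        \<le> sqrt t3 * (L2_set u {..<p})\<^sup>2"
    and c4: "\<And>u g. g \<in> L2 T \<Longrightarrow>
      \<bar>sample_mean n (\<lambda>i. (\<Sum>j<p. Xs i x j * u j) * L2_inner T (Ys i x) g)\<bar>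
        \<le> sqrt t4 * (L2_set u {..<p} * L2_norm T g)"
    and c5: "\<And>g. g \<in> L2 T \<Longrightarrow>
      \<bar>sample_mean n (\<lambda>i. (L2_inner T (Ys i x) g)\<^sup>2) - (\<integral>x. (L2_inner T (Y x) g)\<^sup>2 \<partial>P)\<bar>
        \<le> sqrt t5 * (L2_norm T g)\<^sup>2"
    and t: "0 \<le> t2" "0 \<le> t4"
  shows "\<bar>pred_risk P Z X Y (pfl_predictor T p \<alpha>h (S fh)) - pred_risk P Z X Y (pfl_predictor T p \<alpha>0 \<beta>0)\<bar>
    \<le> risk_bound l m F (sqrt t1) (B * sqrt t2) (B * sqrt t4) (B\<^sup>2 * sqrt t5)"
proof -
  have fh: "fh \<in> L2 T"
    and le: "penalized_loss T S n p l (\<lambda>i. Zs i x) (\<lambda>i. Xs i x) (\<lambda>i. Ys i x) (\<alpha>h, fh)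
      \<le> penalized_loss T S n p l (\<lambda>i. Zs i x) (\<lambda>i. Xs i x) (\<lambda>i. Ys i x) (\<alpha>0, f0)"
    using min f0(1) unfolding is_arg_min_linorder by auto
  have SL2: "f \<in> L2 T \<Longrightarrow> S f \<in> L2 T" for f using S by (simp add: L2_operator_def)
  define u where "u j = \<alpha>h j - \<alpha>0 j" for j
  define g where "g t = S fh t - \<beta>0 t" for t
  define h where "h t = fh t - f0 t" for t
  define \<eta> where "\<eta> i = (\<Sum>j<p. Xs i x j * u j)" for i
  define \<gamma> where "\<gamma> i = L2_inner T (Ys i x) g" for i
  define e where "e i = sample_noise i x" for i
  define a where "a = L2_set u {..<p}"
  define b where "b = L2_norm T h"
  define Q where "Q = (\<integral>x. (\<Sum>j<p. X x j * u j)\<^sup>2 \<partial>P) + (\<integral>x. (L2_inner T (Y x) g)\<^sup>2 \<partial>P)"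
  define Qn where "Qn = sample_mean n (\<lambda>i. (\<eta> i + \<gamma> i)\<^sup>2)"
  have gL2: "g \<in> L2 T" unfolding g_def by (intro L2_diff SL2 fh \<beta>0)
  have hL2: "h \<in> L2 T" unfolding h_def by (intro L2_diff fh f0)
  have a0: "0 \<le> a" by (simp add: a_def)
  have b0: "0 \<le> b" by (simp add: b_def L2_norm_nonneg)
  \<comment> \<open>Linearity of \<open>S\<close> holds almost everywhere only, so \<open>g\<close> is \<open>S h\<close> up to a null set.\<close>
  have g_norm: "L2_norm T g \<le> B * b"
  proof -
    have "L2_eq T g (S h)"
    proof -
      have "L2_eq T (S (\<lambda>t. h t + f0 t)) (\<lambda>t. S h t + S f0 t)"
        using S hL2 f0(1) by (simp add: L2_operator_def)
      then have "AE t in leb_on T. S fh t = S h t + S f0 t" by (simp add: L2_eq_def h_def)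
      then show ?thesis
        using f0(2) unfolding L2_eq_def by eventually_elim (simp add: g_def)
    qed
    then have "L2_norm T g = L2_norm T (S h)" by (intro L2_norm_cong_AE gL2 SL2 hL2)
    then show ?thesis using B(1)[OF hL2] by (simp add: b_def)
  qed
  have residuals: "Zs i x - (\<Sum>j<p. Xs i x j * \<alpha>h j) - L2_inner T (Ys i x) (S fh) = e i - (\<eta> i + \<gamma> i)"
    "Zs i x - (\<Sum>j<p. Xs i x j * \<alpha>0 j) - L2_inner T (Ys i x) (S f0) = e i" if i: "i \<in> {1..n}" for i
  proof -
    have y: "Ys i x \<in> L2 T" by (rule Ys_L2[OF i x])
    have "\<gamma> i = L2_inner T (Ys i x) (S fh) - L2_inner T (Ys i x) \<beta>0"
      unfolding \<gamma>_def g_def by (rule L2_inner_diff_right[OF SL2[OF fh] \<beta>0 y])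
    then show "Zs i x - (\<Sum>j<p. Xs i x j * \<alpha>h j) - L2_inner T (Ys i x) (S fh) = e i - (\<eta> i + \<gamma> i)"
      by (simp add: e_def residual_def \<eta>_def u_def right_diff_distrib sum_subtractf)
    have "L2_inner T (Ys i x) (S f0) = L2_inner T (Ys i x) \<beta>0"
      by (rule L2_inner_cong_AE_right[OF f0(2) y \<beta>0 SL2[OF f0(1)], symmetric])
    then show "Zs i x - (\<Sum>j<p. Xs i x j * \<alpha>0 j) - L2_inner T (Ys i x) (S f0) = e i"
      by (simp add: e_def residual_def)
  qed
  have "sample_mean n (\<lambda>i. (e i - (\<eta> i + \<gamma> i))\<^sup>2) + l * (L2_norm T fh)\<^sup>2
      \<le> sample_mean n (\<lambda>i. (e i)\<^sup>2) + l * (L2_norm T f0)\<^sup>2"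
    using le by (simp add: penalized_loss_def sample_mean_def residuals)
  moreover have "sample_mean n (\<lambda>i. (e i - (\<eta> i + \<gamma> i))\<^sup>2) =
      sample_mean n (\<lambda>i. (e i)\<^sup>2) - 2 * (sample_mean n (\<lambda>i. e i * \<eta> i) + sample_mean n (\<lambda>i. e i * \<gamma> i)) + Qn"
    unfolding Qn_def sample_mean_add[symmetric] sample_mean_diff[symmetric] sample_mean_mult_left[symmetric]
    by (intro arg_cong[where f="sample_mean n"]) (simp add: fun_eq_iff power2_eq_square algebra_simps)
  moreover have "(L2_norm T fh)\<^sup>2 = (L2_norm T f0)\<^sup>2 + 2 * L2_inner T h f0 + b\<^sup>2"
  proof -
    have "fh = (\<lambda>t. h t + f0 t)" by (simp add: h_def)
    then have "L2_inner T fh fh = L2_inner T h h + 2 * L2_inner T h f0 + L2_inner T f0 f0"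
      using hL2 f0(1)
      by (simp add: L2_inner_add_left L2_inner_add_right L2_add L2_inner_commute[of T f0 h])
    then show ?thesis by (simp add: L2_norm_square b_def)
  qed
  ultimately have "Qn + l * b\<^sup>2 \<le>
      - 2 * l * L2_inner T h f0 + 2 * sample_mean n (\<lambda>i. e i * \<eta> i) + 2 * sample_mean n (\<lambda>i. e i * \<gamma> i)"
    by (simp add: algebra_simps)
  moreover have "- 2 * l * L2_inner T h f0 \<le> 2 * l * F * b"
  proof -
    have "- L2_inner T h f0 \<le> b * L2_norm T f0"
      using L2_inner_le_norms[OF hL2 f0(1)] by (simp add: b_def)
    also have "\<dots> \<le> b * F" using b0 f0(3) by (rule mult_left_mono[rotated])
    finally have "2 * l * (- L2_inner T h f0) \<le> 2 * l * (b * F)"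
      using l by (intro mult_left_mono) auto
    then show ?thesis by (simp add: mult_ac)
  qed
  moreover have "2 * sample_mean n (\<lambda>i. e i * \<eta> i) \<le> 2 * sqrt t1 * a"
    using c1[of u] by (simp add: e_def \<eta>_def a_def)
  moreover have "2 * sample_mean n (\<lambda>i. e i * \<gamma> i) \<le> 2 * (B * sqrt t2) * b"
    using c2[OF gL2] mult_left_mono[OF g_norm, of "sqrt t2"] t by (simp add: e_def \<gamma>_def mult_ac)
  ultimately have basic: "Qn + l * b\<^sup>2 \<le> 2 * l * F * b + 2 * sqrt t1 * a + 2 * (B * sqrt t2) * b"
    by linarith
  have Y_part: "0 \<le> (\<integral>x. (L2_inner T (Y x) g)\<^sup>2 \<partial>P)" by simp
  have "m * a\<^sup>2 \<le> (\<integral>x. (\<Sum>j<p. X x j * u j)\<^sup>2 \<partial>P)"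
    using coercive[OF m(2), of u] by (simp add: a_def L2_set_def sum_nonneg)
  then have coercive_Q: "m * a\<^sup>2 \<le> Q" using Y_part unfolding Q_def by linarith
  have Q0: "0 \<le> Q" by (simp add: Q_def)
  have expand: "Qn = sample_mean n (\<lambda>i. (\<eta> i)\<^sup>2) + 2 * sample_mean n (\<lambda>i. \<eta> i * \<gamma> i) + sample_mean n (\<lambda>i. (\<gamma> i)\<^sup>2)"
    unfolding Qn_def sample_mean_add[symmetric] sample_mean_mult_left[symmetric]
    by (intro arg_cong[where f="sample_mean n"]) (simp add: fun_eq_iff power2_sum algebra_simps)
  have "(\<integral>x. (\<Sum>j<p. X x j * u j)\<^sup>2 \<partial>P) \<le> sample_mean n (\<lambda>i. (\<eta> i)\<^sup>2) + sqrt t3 * a\<^sup>2"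
    using c3[of u] by (simp add: \<eta>_def a_def abs_le_iff)
  moreover have "- sample_mean n (\<lambda>i. \<eta> i * \<gamma> i) \<le> (B * sqrt t4) * a * b"
  proof -
    have "- sample_mean n (\<lambda>i. \<eta> i * \<gamma> i) \<le> sqrt t4 * (a * L2_norm T g)"
      using c4[OF gL2, of u] by (simp add: \<eta>_def \<gamma>_def a_def abs_le_iff)
    also have "\<dots> \<le> sqrt t4 * (a * (B * b))"
      using t a0 by (intro mult_left_mono g_norm) auto
    finally show ?thesis by (simp add: mult_ac)
  qed
  moreover have "(\<integral>x. (L2_inner T (Y x) g)\<^sup>2 \<partial>P) \<le> sample_mean n (\<lambda>i. (\<gamma> i)\<^sup>2) + B\<^sup>2 * sqrt t5 * b\<^sup>2"
  proof -
    have "(\<integral>x. (L2_inner T (Y x) g)\<^sup>2 \<partial>P) \<le> sample_mean n (\<lambda>i. (\<gamma> i)\<^sup>2) + sqrt t5 * (L2_norm T g)\<^sup>2"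
      using c5[OF gL2] by (simp add: \<gamma>_def abs_le_iff)
    also have "\<dots> \<le> sample_mean n (\<lambda>i. (\<gamma> i)\<^sup>2) + sqrt t5 * (B * b)\<^sup>2"
      using t5 g_norm by (intro add_left_mono mult_left_mono power_mono L2_norm_nonneg) auto
    finally show ?thesis by (simp add: power_mult_distrib mult_ac)
  qed
  ultimately have compare: "Q \<le> Qn + sqrt t3 * a\<^sup>2 + 2 * (B * sqrt t4) * a * b + B\<^sup>2 * sqrt t5 * b\<^sup>2"
    unfolding Q_def expand by linarith
  have "Q \<le> risk_bound l m F (sqrt t1) (B * sqrt t2) (B * sqrt t4) (B\<^sup>2 * sqrt t5)"
    unfolding risk_bound_def
    by (rule ridge_error_bound[OF l m(1) _ _ basic coercive_Q compare t3 refl refl refl])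
       (use t5 in \<open>simp_all add: Qn_def sample_mean_nonneg\<close>)
  moreover have "pred_risk P Z X Y (pfl_predictor T p \<alpha>h (S fh)) - pred_risk P Z X Y (pfl_predictor T p \<alpha>0 \<beta>0) = Q"
    unfolding Q_def by (rule excess_risk[OF gL2 SL2[OF fh]]) (simp_all add: g_def u_def)
  ultimately show ?thesis using Q0 by simp
qed

lemma excess_risk_event:
  assumes S: "L2_operator T S" and B: "\<And>f. f \<in> L2 T \<Longrightarrow> L2_norm T (S f) \<le> B * L2_norm T f" "0 \<le> B"
    and f0: "f0 \<in> L2 T" "L2_eq T \<beta>0 (S f0)" "L2_norm T f0 \<le> F"
    and l: "0 < l" and m: "0 < m" "m \<le> lambda_min (second_moment_mat P p X)"
    and t: "0 < t1" "0 < t2" "0 < t3" "0 < t4" "0 < t5" and t3: "sqrt t3 \<le> m / 4"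
  obtains A where "A \<in> data.events"
    "emeasure M A \<le> ennreal (\<sigma>\<^sup>2 * v\<^sup>2 * real p / (real n * t1) + \<sigma>\<^sup>2 * M2\<^sup>2 / (real n * t2) +
      3 * M1 ^ 4 * (real p)\<^sup>2 / (real n * t3) + v\<^sup>2 * M2\<^sup>2 * real p / (real n * t4) +
      M2\<^sup>2 * M2\<^sup>2 / (real n * t5))"
    "\<And>x \<alpha>h fh. x \<in> space M - A \<Longrightarrow>
      is_arg_min (penalized_loss T S n p l (\<lambda>i. Zs i x) (\<lambda>i. Xs i x) (\<lambda>i. Ys i x))
        (\<lambda>(\<alpha>, f). f \<in> L2 T) (\<alpha>h, fh) \<Longrightarrow>
      \<bar>pred_risk P Z X Y (pfl_predictor T p \<alpha>h (S fh)) - pred_risk P Z X Y (pfl_predictor T p \<alpha>0 \<beta>0)\<bar>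
        \<le> risk_bound l m F (sqrt t1) (B * sqrt t2) (B * sqrt t4) (B\<^sup>2 * sqrt t5)"
proof -
  obtain A1 where A1: "A1 \<in> data.events" "emeasure M A1 \<le> ennreal (\<sigma>\<^sup>2 * v\<^sup>2 * real p / (real n * t1))"
    and c1: "\<And>x u. x \<in> space M - A1 \<Longrightarrow>
      \<bar>sample_mean n (\<lambda>i. sample_noise i x * (\<Sum>j<p. Xs i x j * u j))\<bar> \<le> sqrt t1 * L2_set u {..<p}"
    by (rule noise_covariate_event[OF t(1)]) (rule that, assumption, assumption, simp)
  obtain A2 where A2: "A2 \<in> data.events" "emeasure M A2 \<le> ennreal (\<sigma>\<^sup>2 * M2\<^sup>2 / (real n * t2))"
    and c2: "\<And>x g. x \<in> space M - A2 \<Longrightarrow> g \<in> L2 T \<Longrightarrow>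
      \<bar>sample_mean n (\<lambda>i. sample_noise i x * L2_inner T (Ys i x) g)\<bar> \<le> sqrt t2 * L2_norm T g"
    by (rule noise_function_event[OF t(2)]) (rule that, assumption, assumption, simp)
  obtain A3 where A3: "A3 \<in> data.events" "emeasure M A3 \<le> ennreal (3 * M1 ^ 4 * (real p)\<^sup>2 / (real n * t3))"
    and c3: "\<And>x u. x \<in> space M - A3 \<Longrightarrow>
      \<bar>sample_mean n (\<lambda>i. (\<Sum>j<p. Xs i x j * u j)\<^sup>2) - (\<integral>x. (\<Sum>j<p. X x j * u j)\<^sup>2 \<partial>P)\<bar>
        \<le> sqrt t3 * (L2_set u {..<p})\<^sup>2"
    by (rule covariate_second_moment_event[OF t(3)]) (rule that, assumption, assumption, simp)
  obtain A4 where A4: "A4 \<in> data.events" "emeasure M A4 \<le> ennreal (v\<^sup>2 * M2\<^sup>2 * real p / (real n * t4))"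
    and c4: "\<And>x u g. x \<in> space M - A4 \<Longrightarrow> g \<in> L2 T \<Longrightarrow>
      \<bar>sample_mean n (\<lambda>i. (\<Sum>j<p. Xs i x j * u j) * L2_inner T (Ys i x) g)\<bar>
        \<le> sqrt t4 * (L2_set u {..<p} * L2_norm T g)"
    by (rule cross_moment_event[OF t(4)]) (rule that, assumption, assumption, simp)
  obtain A5 where A5: "A5 \<in> data.events" "emeasure M A5 \<le> ennreal (M2\<^sup>2 * M2\<^sup>2 / (real n * t5))"
    and c5: "\<And>x g. x \<in> space M - A5 \<Longrightarrow> g \<in> L2 T \<Longrightarrow>
      \<bar>sample_mean n (\<lambda>i. (L2_inner T (Ys i x) g)\<^sup>2) - (\<integral>x. (L2_inner T (Y x) g)\<^sup>2 \<partial>P)\<bar>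
        \<le> sqrt t5 * (L2_norm T g)\<^sup>2"
    by (rule function_second_moment_event[OF t(5)]) (rule that, assumption, assumption, simp)
  let ?A = "A1 \<union> A2 \<union> A3 \<union> A4 \<union> A5"
  show ?thesis
  proof (rule that)
    show "?A \<in> data.events" using A1 A2 A3 A4 A5 by auto
    have "emeasure M ?A \<le> emeasure M A1 + emeasure M A2 + emeasure M A3 + emeasure M A4 + emeasure M A5"
      using A1(1) A2(1) A3(1) A4(1) A5(1)
      by (intro order_trans[OF emeasure_subadditive] add_mono order_refl sets.Un)
    also have "\<dots> \<le> ennreal (\<sigma>\<^sup>2 * v\<^sup>2 * real p / (real n * t1)) + ennreal (\<sigma>\<^sup>2 * M2\<^sup>2 / (real n * t2)) +
      ennreal (3 * M1 ^ 4 * (real p)\<^sup>2 / (real n * t3)) + ennreal (v\<^sup>2 * M2\<^sup>2 * real p / (real n * t4)) +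
      ennreal (M2\<^sup>2 * M2\<^sup>2 / (real n * t5))"
      by (intro add_mono A1(2) A2(2) A3(2) A4(2) A5(2))
    also have "\<dots> = ennreal (\<sigma>\<^sup>2 * v\<^sup>2 * real p / (real n * t1) + \<sigma>\<^sup>2 * M2\<^sup>2 / (real n * t2) +
      3 * M1 ^ 4 * (real p)\<^sup>2 / (real n * t3) + v\<^sup>2 * M2\<^sup>2 * real p / (real n * t4) +
      M2\<^sup>2 * M2\<^sup>2 / (real n * t5))"
      using t by (simp add: ennreal_plus[symmetric] zero_le_even_power del: ennreal_plus)
    finally show "emeasure M ?A \<le> \<dots>" .
    fix x \<alpha>h fh
    assume x: "x \<in> space M - ?A"
      and min: "is_arg_min (penalized_loss T S n p l (\<lambda>i. Zs i x) (\<lambda>i. Xs i x) (\<lambda>i. Ys i x))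
        (\<lambda>(\<alpha>, f). f \<in> L2 T) (\<alpha>h, fh)"
    show "\<bar>pred_risk P Z X Y (pfl_predictor T p \<alpha>h (S fh)) - pred_risk P Z X Y (pfl_predictor T p \<alpha>0 \<beta>0)\<bar>
        \<le> risk_bound l m F (sqrt t1) (B * sqrt t2) (B * sqrt t4) (B\<^sup>2 * sqrt t5)"
      by (rule excess_risk_le_risk_bound[OF S B f0 l m t3 t(5) _ min c1 c2 c3 c4 c5])
         (use x t in auto)
  qed
qed

end

text \<open>Markov's inequality costs a factor \<open>n\<^bsup>1/56\<^esup>\<close>: squared deviations of
order \<open>1 / n\<close> become \<open>n\<^bsup>-55/56\<^esup>\<close>, and those of order \<open>p / n \<le> n\<^bsup>-6/7\<^esup>\<close> become \<open>n\<^bsup>-47/56\<^esup>\<close>. With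
\<open>l\<close> at its lower bound \<open>n\<^bsup>-5/7\<^esup>\<close>, the factor \<open>L\<close> grows like \<open>n\<^bsup>25/112\<^esup>\<close> and \<open>A\<close> decays like
\<open>n\<^bsup>-15/56\<^esup>\<close>, so the product still vanishes, by a margin of \<open>n\<^bsup>-5/112\<^esup>\<close>. Any smaller positive exponent in place of \<open>1 / 56\<close> would do.\<close>

lemma risk_bound_tendsto:
  fixes l :: "nat \<Rightarrow> real"
  assumes pos: "0 < \<omega>" "0 < m" "0 < F" "0 < B"
    and l: "\<And>n. 1 \<le> n \<Longrightarrow> \<omega> * real n powr (- 5 / 7) \<le> l n" "\<And>n. 1 \<le> n \<Longrightarrow> l n \<le> \<omega> * real n powr (- 1 / 2)"
  shows "(\<lambda>n. risk_bound (l n) m F (sqrt (real n powr (- 47 / 56))) (B * sqrt (real n powr (- 55 / 56)))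
    (B * sqrt (real n powr (- 47 / 56))) (B\<^sup>2 * sqrt (real n powr (- 55 / 56)))) \<longlonglongrightarrow> 0"
proof -
  define G where "G x = 8 * (B\<^sup>2 * x powr (- 47 / 56)) / m + B\<^sup>2 * x powr (- 55 / 112)" for x
  define L where "L x = 1 + 2 * G x / (\<omega> * x powr (- 5 / 7))" for x
  define A where "A x = 4 * (\<omega> * x powr (- 1 / 2)) * F\<^sup>2 + 4 * (B\<^sup>2 * x powr (- 55 / 56)) / (\<omega> * x powr (- 5 / 7))" for x
  define U where "U x = 2 * L x * A x + 16 * (L x)\<^sup>2 * x powr (- 47 / 56) / m" for x
  have "((\<lambda>x. U x) \<longlongrightarrow> 0) at_top"
    unfolding U_def L_def A_def G_def using pos by real_asymp
  then have U: "(\<lambda>n. U (real n)) \<longlonglongrightarrow> 0"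
    by (rule filterlim_compose[OF _ filterlim_real_sequentially])
  have sandwich: "0 \<le> risk_bound (l n) m F (sqrt (real n powr (- 47 / 56))) (B * sqrt (real n powr (- 55 / 56)))
    (B * sqrt (real n powr (- 47 / 56))) (B\<^sup>2 * sqrt (real n powr (- 55 / 56))) \<and>
    risk_bound (l n) m F (sqrt (real n powr (- 47 / 56))) (B * sqrt (real n powr (- 55 / 56)))
    (B * sqrt (real n powr (- 47 / 56))) (B\<^sup>2 * sqrt (real n powr (- 55 / 56))) \<le> U (real n)"
    if n: "1 \<le> n" for n
  proof -
    let ?x = "real n"
    have lower: "0 < \<omega> * ?x powr (- 5 / 7)" using pos n by simp
    then have l0: "0 < l n" using l(1)[OF n] by linarith
    have sq: "(B * sqrt (?x powr a))\<^sup>2 = B\<^sup>2 * ?x powr a" for a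
      by (simp add: power_mult_distrib)
    have half: "sqrt (?x powr (- 55 / 56)) = ?x powr (- 55 / 112)"
      using n by (simp add: powr_half_sqrt[symmetric] powr_powr)
    have G0: "0 \<le> G ?x" using pos by (simp add: G_def)
    have G_eq: "8 * (B * sqrt (?x powr (- 47 / 56)))\<^sup>2 / m + B\<^sup>2 * sqrt (?x powr (- 55 / 56)) = G ?x"
      by (simp only: G_def sq half)
    have L_le: "1 + 2 * G ?x / l n \<le> L ?x"
      unfolding L_def using l(1)[OF n] lower G0 by (intro add_left_mono divide_left_mono) auto
    have L_pos: "0 \<le> 1 + 2 * G ?x / l n" using G0 l0 by simp
    have L_bound_pos: "0 \<le> L ?x" using L_pos L_le by (rule order_trans)
    have A_le: "2 * (l n * F + B * sqrt (?x powr (- 55 / 56)))\<^sup>2 / l n \<le> A ?x"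
    proof -
      have "(l n * F + B * sqrt (?x powr (- 55 / 56)))\<^sup>2 \<le> 2 * (l n * F)\<^sup>2 + 2 * (B\<^sup>2 * ?x powr (- 55 / 56))"
        using sum_squares_bound[of "l n * F" "B * sqrt (?x powr (- 55 / 56))"]
        by (simp only: power2_sum sq)
      then have "2 * (l n * F + B * sqrt (?x powr (- 55 / 56)))\<^sup>2 / l n \<le>
          2 * (2 * (l n * F)\<^sup>2 + 2 * (B\<^sup>2 * ?x powr (- 55 / 56))) / l n"
        using l0 by (intro divide_right_mono mult_left_mono) auto
      also have "\<dots> = 4 * l n * F\<^sup>2 + 4 * (B\<^sup>2 * ?x powr (- 55 / 56)) / l n"
        using l0 by (simp add: field_simps power2_eq_square)
      also have "\<dots> \<le> A ?x"
        unfolding A_def using l(1)[OF n] l(2)[OF n] lower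
        by (intro add_mono mult_right_mono mult_left_mono divide_left_mono) auto
      finally show ?thesis .
    qed
    have A_pos: "0 \<le> 2 * (l n * F + B * sqrt (?x powr (- 55 / 56)))\<^sup>2 / l n" using l0 by simp
    have sqx: "(sqrt (?x powr (- 47 / 56)))\<^sup>2 = ?x powr (- 47 / 56)" by simp
    show ?thesis
      unfolding risk_bound_def G_eq U_def sqx
      using L_le L_pos L_bound_pos A_le A_pos pos G0 l0
      by (intro conjI add_mono add_nonneg_nonneg divide_right_mono mult_right_mono mult_mono power_mono
          mult_nonneg_nonneg divide_nonneg_pos) auto
  qed
  show ?thesis
    by (rule tendsto_sandwich[OF _ _ tendsto_const U]; rule eventually_sequentiallyI[of 1])
       (use sandwich in blast)+
qed

lemma outer_measure_of_le_emeasure: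
  "A \<in> sets M \<Longrightarrow> E \<subseteq> A \<Longrightarrow> outer_measure_of M E \<le> emeasure M A"
  unfolding outer_measure_of_def by (rule INF_lower) simp

text \<open>For \<open>p \<ge> 3\<close> the logarithm is at least one and the growth condition gives \<open>p\<^sup>7 \<le> n\<close>. Smaller \<open>p\<close>, for which the logarithm
can vanish, are covered by \<open>n \<ge> 128 = 2\<^sup>7\<close>.\<close>

lemma dimension_le_root:
  fixes p :: "nat \<Rightarrow> nat"
  assumes "(\<lambda>n. real (p n) ^ 7 * ln (real (p n)) ^ 6) \<in> o(\<lambda>n. real n)"
  shows "\<forall>\<^sub>F n in sequentially. real (p n) \<le> real n powr (1 / 7)"
proof -
  have "\<forall>\<^sub>F n in sequentially. norm (real (p n) ^ 7 * ln (real (p n)) ^ 6) \<le> 1 * norm (real n)"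
    using assms by (rule landau_o.smallD) simp
  then show ?thesis
    using eventually_ge_at_top[of 128]
  proof eventually_elim
    case (elim n)
    have "real (p n) ^ 7 \<le> real n"
    proof (cases "3 \<le> p n")
      case True
      then have "exp 1 \<le> real (p n)" using exp_le by linarith
      then have "1 \<le> ln (real (p n))" using True by (subst ln_ge_iff) auto
      then have "1 \<le> ln (real (p n)) ^ 6" by (rule one_le_power)
      then have "real (p n) ^ 7 * 1 \<le> real (p n) ^ 7 * ln (real (p n)) ^ 6"
        by (intro mult_left_mono) auto
      also have "\<dots> \<le> real n" using elim(1) by simp
      finally show ?thesis by simp
    next
      case False
      then have "real (p n) ^ 7 \<le> 2 ^ 7" by (intro power_mono) auto
      also have "\<dots> \<le> real n" using elim(2) by simp
      finally show ?thesis .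
    qed
    then have "(real (p n) ^ 7) powr (1 / 7) \<le> real n powr (1 / 7)"
      by (intro powr_mono2) auto
    moreover have "(real (p n) ^ 7) powr (1 / 7) = real (p n)"
    proof (cases "p n = 0")
      case False
      then have "real (p n) ^ 7 = real (p n) powr 7" by (simp add: powr_numeral)
      then show ?thesis using False powr_powr[of "real (p n)" 7 "1 / 7"] by simp
    qed simp
    ultimately show ?case by simp
  qed
qed

text \<open>The thresholds for the five squared deviations are chosen so that each exceptional event has probability of
  order \<open>n\<^bsup>-1/56\<^esup>\<close> and the risk bound still tends to zero. The second moment matrix of \<open>X\<close> has squared
  deviations of order \<open>p\<^sup>2 / n \<le> n\<^bsup>-5/7\<^esup>\<close>, hence its threshold \<open>n\<^bsup>-39/56\<^esup>\<close>. It is only required to be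
  eventually below a fixed multiple of \<open>m'\<close>.\<close>

theorem corollary3:
  fixes T :: "real set"
    and K C :: "real \<Rightarrow> real \<Rightarrow> real"
    and S :: "(real \<Rightarrow> real) \<Rightarrow> real \<Rightarrow> real"
    and \<beta>0 :: "real \<Rightarrow> real"
    and M1 v M2 \<sigma> c \<theta> \<omega> m' M' :: real
    and p :: "nat \<Rightarrow> nat"
    and \<alpha>0 :: "nat \<Rightarrow> nat \<Rightarrow> real"
    and P :: "nat \<Rightarrow> 'a measure"
    and Z \<epsilon> :: "nat \<Rightarrow> 'a \<Rightarrow> real"
    and X :: "nat \<Rightarrow> 'a \<Rightarrow> nat \<Rightarrow> real"
    and Y :: "nat \<Rightarrow> 'a \<Rightarrow> real \<Rightarrow> real"
    and M :: "nat \<Rightarrow> 'b measure"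
    and Zs :: "nat \<Rightarrow> nat \<Rightarrow> 'b \<Rightarrow> real"
    and Xs :: "nat \<Rightarrow> nat \<Rightarrow> 'b \<Rightarrow> nat \<Rightarrow> real"
    and Ys :: "nat \<Rightarrow> nat \<Rightarrow> 'b \<Rightarrow> real \<Rightarrow> real"
    and \<alpha>h :: "nat \<Rightarrow> 'b \<Rightarrow> nat \<Rightarrow> real"
    and fh :: "nat \<Rightarrow> 'b \<Rightarrow> real \<Rightarrow> real"
    and lam :: "nat \<Rightarrow> real"
  assumes T_compact: "compact T"
    and kernel: "nonneg_kernel T K"
    and sqrt_K: "is_nonneg_sqrt T (kernel_op T K) S"
    and RKHS_dense: "L2_dense T (RKHS T S)"
    and S_injective: "L2_injective T S"
    and kappa: "1 < op_norm T S"
    and \<beta>0: "\<beta>0 \<in> RKHS T S"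
    and M2: "1 < M2"
    and P: "\<And>n. 1 \<le> n \<Longrightarrow> prob_space (P n)"
    and p_pos: "\<And>n. 1 \<le> n \<Longrightarrow> 1 \<le> p n"
    and X_rv: "\<And>n. 1 \<le> n \<Longrightarrow> X n \<in> P n \<rightarrow>\<^sub>M vec_borel (p n)"
    and Y_rv: "\<And>n. 1 \<le> n \<Longrightarrow> Y n \<in> P n \<rightarrow>\<^sub>M L2_borel T"
    and Y_joint: "\<And>n. 1 \<le> n \<Longrightarrow>
          (\<lambda>(x, t). Y n x t) \<in> borel_measurable (P n \<Otimes>\<^sub>M leb_on T)"
    and \<epsilon>_rv: "\<And>n. 1 \<le> n \<Longrightarrow> \<epsilon> n \<in> borel_measurable (P n)"
    and XY_indep: "\<And>n. 1 \<le> n \<Longrightarrow>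
          prob_space.indep_set (P n)
            (sets (generated_sigma (P n) (vec_borel (p n)) (X n)))
            (sets (generated_sigma (P n) (L2_borel T) (Y n)))"
    and X_mean: "\<And>n j. 1 \<le> n \<Longrightarrow> j < p n \<Longrightarrow>
          integrable (P n) (\<lambda>x. X n x j) \<and> (\<integral>x. X n x j \<partial>P n) = 0"
    and Y_mean: "\<And>n t. 1 \<le> n \<Longrightarrow> t \<in> T \<Longrightarrow>
          integrable (P n) (\<lambda>x. Y n x t) \<and> (\<integral>x. Y n x t \<partial>P n) = 0"
    and Y_cov: "\<And>n s t. 1 \<le> n \<Longrightarrow> s \<in> T \<Longrightarrow> t \<in> T \<Longrightarrow>
          integrable (P n) (\<lambda>x. Y n x s * Y n x t) \<and> C s t = (\<integral>x. Y n x s * Y n x t \<partial>P n)"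
    and model: "\<And>n x. 1 \<le> n \<Longrightarrow> x \<in> space (P n) \<Longrightarrow>
          Z n x = (\<Sum>j<p n. X n x j * \<alpha>0 n j) + L2_inner T (Y n x) \<beta>0 + \<epsilon> n x"
    and M: "\<And>n. 1 \<le> n \<Longrightarrow> prob_space (M n)"
    and data_indep: "\<And>n. 1 \<le> n \<Longrightarrow>
          prob_space.indep_vars (M n) (\<lambda>_. obs_space T (p n))
            (\<lambda>i x. (Zs n i x, Xs n i x, Ys n i x)) {1..n}"
    and data_law: "\<And>n i. 1 \<le> n \<Longrightarrow> i \<in> {1..n} \<Longrightarrow>
          distr (M n) (obs_space T (p n)) (\<lambda>x. (Zs n i x, Xs n i x, Ys n i x)) =
          distr (P n) (obs_space T (p n)) (\<lambda>x. (Z n x, X n x, Y n x))"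
    and estimator: "\<And>n x. 1 \<le> n \<Longrightarrow> x \<in> space (M n) \<Longrightarrow>
          is_arg_min
            (penalized_loss T S n (p n) (lam n)
               (\<lambda>i. Zs n i x) (\<lambda>i. Xs n i x) (\<lambda>i. Ys n i x))
            (\<lambda>(\<alpha>, f). f \<in> L2 T)
            (\<alpha>h n x, fh n x)"
    and cond1_p: "\<And>n. 1 \<le> n \<Longrightarrow> p n \<le> n"
    and cond1_Dn: "\<And>n. 1 \<le> n \<Longrightarrow>
          AE x in M n. pos_def_mat (sample_moment_mat n (p n) (\<lambda>i. Xs n i x))"
    and cond1_D: "\<And>n. 1 \<le> n \<Longrightarrow> pos_def_mat (second_moment_mat (P n) (p n) (X n))"
    and cond2_subgauss: "\<And>n j. 1 \<le> n \<Longrightarrow> j < p n \<Longrightarrow>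
          subgauss_norm (P n) (\<lambda>x. X n x j) \<le> ennreal M1"
    and cond2_moment: "\<And>n j. 1 \<le> n \<Longrightarrow> j < p n \<Longrightarrow>
          (\<integral>x. \<bar>X n x j\<bar>\<^sup>2 \<partial>P n) \<le> v\<^sup>2"
    and cond3: "\<And>n. 1 \<le> n \<Longrightarrow> AE x in P n. L2_norm T (Y n x) \<le> M2"
    and cond4_mean: "\<And>n. 1 \<le> n \<Longrightarrow> integrable (P n) (\<epsilon> n) \<and>
          (AE x in P n. real_cond_exp (P n)
             (generated_sigma (P n) (vec_borel (p n) \<Otimes>\<^sub>M L2_borel T) (\<lambda>x. (X n x, Y n x)))
             (\<epsilon> n) x = 0)"
    and cond4_var: "\<And>n. 1 \<le> n \<Longrightarrow>
          AE x in P n. nn_cond_exp (P n)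
             (generated_sigma (P n) (vec_borel (p n) \<Otimes>\<^sub>M L2_borel T) (\<lambda>x. (X n x, Y n x)))
             (\<lambda>x. ennreal ((\<epsilon> n x)\<^sup>2)) x < ennreal (\<sigma>\<^sup>2)"
    and cond5_const: "0 < c" "2/5 < \<theta>" "\<theta> \<le> 1"
    and cond5: "\<And>l. 0 < l \<Longrightarrow>
          effective_dim T (\<lambda>f. S (kernel_op T C (S f))) l \<le> ennreal (c * l powr (- \<theta>))"
    and cond6: "(\<lambda>n. real (p n) ^ 7 * ln (real (p n)) ^ 6) \<in> o(\<lambda>n. real n)"
    and cond7_const: "0 < m'" "0 < M'"
    and cond7: "\<And>n. 1 \<le> n \<Longrightarrow>
          m' < lambda_min (second_moment_mat (P n) (p n) (X n)) \<and>
          lambda_max (second_moment_mat (P n) (p n) (X n)) < M'"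
    and \<omega>: "0 < \<omega>"
    and lam: "\<And>n. 1 \<le> n \<Longrightarrow> lam n = \<omega> * real n powr (- 1 / (1 + \<theta>))"
  shows "small_op_one M (\<lambda>n x.
           pred_risk (P n) (Z n) (X n) (Y n) (pfl_predictor T (p n) (\<alpha>h n x) (S (fh n x)))
         - pred_risk (P n) (Z n) (X n) (Y n) (pfl_predictor T (p n) (\<alpha>0 n) \<beta>0))"
proof -
  have \<beta>0_L2: "\<beta>0 \<in> L2 T" using \<beta>0 by (simp add: RKHS_def)
  obtain f0 where f0: "f0 \<in> L2 T" "L2_eq T \<beta>0 (S f0)" using \<beta>0 by (auto simp: RKHS_def)
  have S: "L2_operator T S" using sqrt_K by (simp add: is_nonneg_sqrt_def nonneg_operator_def)
  then obtain B' where B': "\<And>f. f \<in> L2 T \<Longrightarrow> L2_norm T (S f) \<le> B' * L2_norm T f"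
    unfolding L2_operator_def by blast
  \<comment> \<open>Adding one makes both constants strictly positive, as the asymptotic estimate requires.\<close>
  define B where "B = \<bar>B'\<bar> + 1"
  define F where "F = L2_norm T f0 + 1"
  have B: "L2_norm T (S f) \<le> B * L2_norm T f" if "f \<in> L2 T" for f
  proof -
    have "B' \<le> B" by (simp add: B_def)
    then show ?thesis using B'[OF that] mult_right_mono[OF _ L2_norm_nonneg] order_trans by blast
  qed
  have F: "L2_norm T f0 \<le> F" "0 < F" using L2_norm_nonneg[of T f0] by (auto simp: F_def)
  define bound where "bound n = risk_bound (lam n) m' F (sqrt (real n powr (- 47 / 56)))
    (B * sqrt (real n powr (- 55 / 56))) (B * sqrt (real n powr (- 47 / 56)))
    (B\<^sup>2 * sqrt (real n powr (- 55 / 56)))" for n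
  define V where "V n x = pred_risk (P n) (Z n) (X n) (Y n) (pfl_predictor T (p n) (\<alpha>h n x) (S (fh n x)))
    - pred_risk (P n) (Z n) (X n) (Y n) (pfl_predictor T (p n) (\<alpha>0 n) \<beta>0)" for n x
  define c where "c = \<sigma>\<^sup>2 * v\<^sup>2 + \<sigma>\<^sup>2 * M2\<^sup>2 + 3 * M1 ^ 4 + v\<^sup>2 * M2\<^sup>2 + M2\<^sup>2 * M2\<^sup>2"
  have lam_bounds: "\<omega> * real n powr (- 5 / 7) \<le> lam n" "lam n \<le> \<omega> * real n powr (- 1 / 2)" if n: "1 \<le> n" for n
  proof -
    \<comment> \<open>The lower bound is the condition \<open>\<theta> \<ge> 2 / 5\<close>, the upper bound is \<open>\<theta> \<le> 1\<close>.\<close>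
    have "- 5 / 7 \<le> - 1 / (1 + \<theta>)" "- 1 / (1 + \<theta>) \<le> - 1 / 2"
      using cond5_const by (simp_all add: field_simps)
    then show "\<omega> * real n powr (- 5 / 7) \<le> lam n" "lam n \<le> \<omega> * real n powr (- 1 / 2)"
      using n \<omega> by (auto simp: lam intro!: mult_left_mono powr_mono)
  qed
  have lam_pos: "0 < lam n" if "1 \<le> n" for n
    using that \<omega> by (simp add: lam)
  have bound_lim: "bound \<longlonglongrightarrow> 0"
    unfolding bound_def
    by (rule risk_bound_tendsto[OF \<omega> cond7_const(1) F(2) _ lam_bounds]) (simp_all add: B_def)
  have "((\<lambda>x::real. sqrt (x powr (- 39 / 56))) \<longlongrightarrow> 0) at_top" by real_asymp
  then have "(\<lambda>n. sqrt (real n powr (- 39 / 56))) \<longlonglongrightarrow> 0"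
    by (rule filterlim_compose[OF _ filterlim_real_sequentially])
  then have t3_small: "\<forall>\<^sub>F n in sequentially. sqrt (real n powr (- 39 / 56)) < m' / 4"
    using cond7_const by (intro order_tendstoD(2)) auto
  have "((\<lambda>x::real. c * x powr (- 1 / 56)) \<longlongrightarrow> 0) at_top" by real_asymp
  then have "(\<lambda>n. c * real n powr (- 1 / 56)) \<longlonglongrightarrow> 0"
    by (rule filterlim_compose[OF _ filterlim_real_sequentially])
  then have prob_lim: "(\<lambda>n. ennreal (c * real n powr (- 1 / 56))) \<longlonglongrightarrow> 0"
    using tendsto_ennrealI by force
  have "(\<lambda>n. outer_measure_of (M n) {x \<in> space (M n). r < \<bar>V n x\<bar>}) \<longlonglongrightarrow> 0" if r: "0 < r" for r
  proof (rule tendsto_sandwich[OF _ _ tendsto_const prob_lim])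
    have "\<forall>\<^sub>F n in sequentially. bound n < r"
      using bound_lim r by (rule order_tendstoD(2))
    then show "\<forall>\<^sub>F n in sequentially. outer_measure_of (M n) {x \<in> space (M n). r < \<bar>V n x\<bar>}
        \<le> ennreal (c * real n powr (- 1 / 56))"
      using t3_small dimension_le_root[OF cond6] eventually_ge_at_top[of 1]
    proof eventually_elim
      fix n :: nat
      assume small: "bound n < r" and t3: "sqrt (real n powr (- 39 / 56)) < m' / 4"
        and dim: "real (p n) \<le> real n powr (1 / 7)" and n: "1 \<le> n"
      interpret pfl_sample "P n" T "p n" "X n" "Y n" "\<epsilon> n" "Z n" "\<alpha>0 n" \<beta>0 M1 v M2 \<sigma> "M n" n "Zs n" "Xs n" "Ys n"
      proof (intro pfl_sample.intro pfl_population.intro pfl_population_axioms.intro pfl_sample_axioms.intro)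
        show "prob_space (P n)" "prob_space (M n)" using P M n by auto
        show "compact T" "\<beta>0 \<in> L2 T" using T_compact \<beta>0_L2 by auto
      qed (use n X_rv Y_rv \<epsilon>_rv XY_indep X_mean model cond2_subgauss cond2_moment cond3 cond4_mean cond4_var
            data_indep data_law in auto)
      let ?x = "real n"
      have x: "0 < ?x" using n by simp
      show "outer_measure_of (M n) {x \<in> space (M n). r < \<bar>V n x\<bar>} \<le> ennreal (c * ?x powr (- 1 / 56))"
      proof (rule excess_risk_event[where l="lam n" and m=m' and ?t1.0="?x powr (- 47 / 56)" and ?t2.0="?x powr (- 55 / 56)"
            and ?t3.0="?x powr (- 39 / 56)" and ?t4.0="?x powr (- 47 / 56)" and ?t5.0="?x powr (- 55 / 56)",
            OF S B _ f0 F(1) lam_pos[OF n] cond7_const(1)])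
        show "0 \<le> B" by (simp add: B_def)
        show "m' \<le> lambda_min (second_moment_mat (P n) (p n) (X n))" using cond7[OF n] by simp
        show "sqrt (?x powr (- 39 / 56)) \<le> m' / 4" using t3 by simp
        show "0 < ?x powr (- 47 / 56)" "0 < ?x powr (- 55 / 56)" "0 < ?x powr (- 39 / 56)"
          "0 < ?x powr (- 47 / 56)" "0 < ?x powr (- 55 / 56)" using x by simp_all
      next
        fix A
        assume A: "A \<in> data.events"
          "emeasure (M n) A \<le> ennreal (\<sigma>\<^sup>2 * v\<^sup>2 * real (p n) / (?x * ?x powr (- 47 / 56)) +
            \<sigma>\<^sup>2 * M2\<^sup>2 / (?x * ?x powr (- 55 / 56)) +
            3 * M1 ^ 4 * (real (p n))\<^sup>2 / (?x * ?x powr (- 39 / 56)) +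
            v\<^sup>2 * M2\<^sup>2 * real (p n) / (?x * ?x powr (- 47 / 56)) +
            M2\<^sup>2 * M2\<^sup>2 / (?x * ?x powr (- 55 / 56)))"
          and good: "\<And>x \<alpha>h fh. x \<in> space (M n) - A \<Longrightarrow>
            is_arg_min (penalized_loss T S n (p n) (lam n) (\<lambda>i. Zs n i x) (\<lambda>i. Xs n i x) (\<lambda>i. Ys n i x))
              (\<lambda>(\<alpha>, f). f \<in> L2 T) (\<alpha>h, fh) \<Longrightarrow>
            \<bar>pred_risk (P n) (Z n) (X n) (Y n) (pfl_predictor T (p n) \<alpha>h (S fh)) -
              pred_risk (P n) (Z n) (X n) (Y n) (pfl_predictor T (p n) (\<alpha>0 n) \<beta>0)\<bar>
            \<le> risk_bound (lam n) m' F (sqrt (?x powr (- 47 / 56))) (B * sqrt (?x powr (- 55 / 56)))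
              (B * sqrt (?x powr (- 47 / 56))) (B\<^sup>2 * sqrt (?x powr (- 55 / 56)))"
        have "{x \<in> space (M n). r < \<bar>V n x\<bar>} \<subseteq> A"
        proof
          fix x assume x: "x \<in> {x \<in> space (M n). r < \<bar>V n x\<bar>}"
          show "x \<in> A"
          proof (rule ccontr)
            assume "x \<notin> A"
            then have "\<bar>V n x\<bar> \<le> bound n"
              unfolding V_def bound_def using x by (intro good[OF _ estimator[OF n]]) auto
            with small x show False by simp
          qed
        qed
        then have "outer_measure_of (M n) {x \<in> space (M n). r < \<bar>V n x\<bar>} \<le> emeasure (M n) A"
          by (rule outer_measure_of_le_emeasure[OF A(1)])
        also note A(2)
        also have "ennreal (\<sigma>\<^sup>2 * v\<^sup>2 * real (p n) / (?x * ?x powr (- 47 / 56)) +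
            \<sigma>\<^sup>2 * M2\<^sup>2 / (?x * ?x powr (- 55 / 56)) +
            3 * M1 ^ 4 * (real (p n))\<^sup>2 / (?x * ?x powr (- 39 / 56)) +
            v\<^sup>2 * M2\<^sup>2 * real (p n) / (?x * ?x powr (- 47 / 56)) +
            M2\<^sup>2 * M2\<^sup>2 / (?x * ?x powr (- 55 / 56))) \<le> ennreal (c * ?x powr (- 1 / 56))"
        proof (rule ennreal_leI)
          have ratio: "q / (?x * ?x powr a) \<le> ?x powr (- 1 / 56)" if q: "q \<le> ?x powr b" and ab: "b = a + 55 / 56" for q a b
          proof -
            have denom: "?x * ?x powr a = ?x powr (1 + a)" using x by (simp add: powr_add)
            have "q / ?x powr (1 + a) \<le> ?x powr b / ?x powr (1 + a)"
              using q x by (intro divide_right_mono) auto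
            also have "\<dots> = ?x powr (b - (1 + a))" by (rule powr_diff[symmetric])
            also have "b - (1 + a) = - 1 / 56" using ab by simp
            finally show ?thesis unfolding denom .
          qed
          have p1: "real (p n) / (?x * ?x powr (- 47 / 56)) \<le> ?x powr (- 1 / 56)"
            by (rule ratio[OF dim]) simp
          have one: "1 / (?x * ?x powr (- 55 / 56)) \<le> ?x powr (- 1 / 56)"
            by (rule ratio[of 1 0]) (use x in simp_all)
          have "(real (p n))\<^sup>2 \<le> (?x powr (1 / 7))\<^sup>2" using dim by (intro power_mono) auto
          also have "\<dots> = ?x powr (2 / 7)" using x by (simp add: powr_power)
          finally have p2: "(real (p n))\<^sup>2 / (?x * ?x powr (- 39 / 56)) \<le> ?x powr (- 1 / 56)"
            by (rule ratio) simp
          have M1_nonneg: "0 \<le> 3 * M1 ^ 4" by (simp add: zero_le_even_power)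
          show "\<sigma>\<^sup>2 * v\<^sup>2 * real (p n) / (?x * ?x powr (- 47 / 56)) +
            \<sigma>\<^sup>2 * M2\<^sup>2 / (?x * ?x powr (- 55 / 56)) +
            3 * M1 ^ 4 * (real (p n))\<^sup>2 / (?x * ?x powr (- 39 / 56)) +
            v\<^sup>2 * M2\<^sup>2 * real (p n) / (?x * ?x powr (- 47 / 56)) +
            M2\<^sup>2 * M2\<^sup>2 / (?x * ?x powr (- 55 / 56)) \<le> c * ?x powr (- 1 / 56)"
            using mult_left_mono[OF p1, of "\<sigma>\<^sup>2 * v\<^sup>2"] mult_left_mono[OF one, of "\<sigma>\<^sup>2 * M2\<^sup>2"]
              mult_left_mono[OF p2 M1_nonneg] mult_left_mono[OF p1, of "v\<^sup>2 * M2\<^sup>2"]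
              mult_left_mono[OF one, of "M2\<^sup>2 * M2\<^sup>2"]
            unfolding c_def distrib_right times_divide_eq_right mult_1_right
            by (auto intro!: add_mono)
        qed
        finally show "outer_measure_of (M n) {x \<in> space (M n). r < \<bar>V n x\<bar>}
          \<le> ennreal (c * real n powr (- 1 / 56))" .
      qed (assumption)
    qed
  qed simp
  then show ?thesis by (simp add: small_op_one_def V_def)
qed

end
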